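(* Let $0<\beta<1/2$. For each $(t,x)\in\mathbb R_+\times\mathbb R$, $u^\varepsilon(t,x)$ converges in $L^2(P)$, as $\varepsilon\to0$, to the deterministic limit $$u(t,x)=\mathbb E[g(x+B_t)]\,\exp(t\Sigma'),\qquad \Sigma'=\int_0^\infty\Phi(u,0)\,du,$$ which is a solution of the deterministic parabolic PDE $$\frac{\partial u}{\partial t}(t,x)=\frac12\frac{\partial^2u}{\partial x^2}(t,x)+\Sigma'\,u(t,x),\quad t\ge0,\ x\in\mathbb R;\qquad u(0,x)=g(x),\ x\in\mathbb R.$$
   Context: Setting. $(\mathcal S,\mathcal A,P)$ and $(\Omega,\mathcal F,\mathbb P)$ are probability spaces with expectations $E$ and $\mathbb E$; everything lives on the product space, and $\mathbb E$ applied to a function on the product integrates only over $\Omega$. $B$ is a standard Brownian motion on $(\Omega,\mathcal F,\mathbb P)$. $c=\{c(t,x):t\in\mathbb R_+,x\in\mathbb R\}$ is a stationary (jointly measurable) real random field on $(\mathcal S,\mathcal A,P)$ with $E\,c(t,x)=0$, uniformly bounded in $(t,x,s)\in\mathbb R_+\times\mathbb R\times\mathcal S$. $\Phi(t,x):=E[c(s,y)c(s+t,y+x)]$, assumed in $L^1(\mathbb R\times\mathbb R)$. Mixing assumption. For $A\subset\mathbb R_+\times\mathbb R$ let $\mathcal F_A=\sigma\{c(t,x):(t,x)\in A\}$ and $$\alpha_{\rm um}(r)=\sup_{A_1,A_2:\ \mathrm{dist}(A_1,A_2)\ge r}\ \ \sup_{S_1\in\mathcal F_{A_1},\,S_2\in\mathcal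 F_{A_2},\,P(S_2)\ne0}|P(S_1|S_2)-P(S_1)|.$$ It is assumed that there exist $C,\delta>0$ such that $\alpha_{\rm um}(r)\le C(1+r)^{-(2+\delta)}$ for all $r\ge0$. The equation. $g\in L^2(\mathbb R)\cap C(\mathbb R)$ and $u^\varepsilon$ is the solution of $\partial_tu^\varepsilon=\frac12\partial_{xx}u^\varepsilon+\varepsilon^{-1/2}c\left(\frac t{\varepsilon},\frac x{\varepsilon^\beta}\right)u^\varepsilon$, $u^\varepsilon(0,x)=g(x)$, given by the Feynman–Kac formula $$u^\varepsilon(t,x)=\mathbb E\left[g(x+B_t)\exp\left(\varepsilon^{-1/2}\int_0^tc\left(\frac s{\varepsilon},\frac{x+B_s}{\varepsilon^\beta}\right)ds\right)\right].$$
   Formalization: The PDE is proved for t > 0 rather than t ≥ 0, since for merely continuous g the derivatives at t = 0 need not exist (e.g. a tent function); instead u is shown to be jointly continuous on [0,∞)×R with u(0,x) = g(x). *)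

theory Defs
  imports "HOL-Probability.Probability"
begin

definition standard_brownian_motion :: "'w measure \<Rightarrow> (real \<Rightarrow> 'w \<Rightarrow> real) \<Rightarrow> bool" where
  "standard_brownian_motion W B \<longleftrightarrow>
     (\<forall>t\<ge>0. B t \<in> borel_measurable W) \<and>
     (\<forall>\<omega>\<in>space W. B 0 \<omega> = 0) \<and>
     (\<forall>\<omega>\<in>space W. continuous_on {0..} (\<lambda>t. B t \<omega>)) \<and>
     (\<forall>s t. 0 \<le> s \<and> s < t \<longrightarrow>
        distributed W lborel (\<lambda>\<omega>. B t \<omega> - B s \<omega>) (normal_density 0 (sqrt (t - s)))) \<and>
     (\<forall>(n::nat) \<tau>. 0 \<le> \<tau> 0 \<and> (\<forall>i<n. \<tau> i < \<tau> (Suc i)) \<longrightarrow>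
        prob_space.indep_vars W (\<lambda>_. borel) (\<lambda>i \<omega>. B (\<tau> (Suc i)) \<omega> - B (\<tau> i) \<omega>) {..<n})"

text \<open>A random field \<open>c\<close> is a function \<open>c t x s\<close> of time, space and the sample point; only its
  values at \<open>t \<ge> 0\<close> are ever used.\<close>

definition measurable_field :: "'s measure \<Rightarrow> (real \<Rightarrow> real \<Rightarrow> 's \<Rightarrow> real) \<Rightarrow> bool" where
  "measurable_field M c \<longleftrightarrow>
     (\<lambda>(t, x, s). c t x s)
       \<in> borel_measurable (restrict_space borel {0..} \<Otimes>\<^sub>M borel \<Otimes>\<^sub>M M)"

text \<open>Stationarity: the finite-dimensional distributions are invariant under all shifts that map
  \<open>{0..} \<times> UNIV\<close> into itself.\<close>

definition stationary_field :: "'s measure \<Rightarrow> (real \<Rightarrow> real \<Rightarrow> 's \<Rightarrow> real) \<Rightarrow> bool" where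
  "stationary_field M c \<longleftrightarrow>
     (\<forall>J h k. finite J \<and> J \<subseteq> {0..} \<times> UNIV \<and> h \<ge> 0 \<longrightarrow>
        distr M (\<Pi>\<^sub>M p\<in>J. borel) (\<lambda>s. \<lambda>p\<in>J. c (fst p + h) (snd p + k) s) =
        distr M (\<Pi>\<^sub>M p\<in>J. borel) (\<lambda>s. \<lambda>p\<in>J. c (fst p) (snd p) s))"

text \<open>\<open>E[c(s,y) c(s+t,y+x)]\<close> for \<open>t\<close> and \<open>x\<close> of either sign. By stationarity it does not depend on
  the base point \<open>(s,y)\<close> with \<open>s \<ge> 0\<close> and \<open>s + t \<ge> 0\<close>; we take \<open>s = max 0 (- t)\<close>,
  so that \<open>s + t = max 0 t\<close>, and \<open>y = 0\<close>.\<close>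

definition covariance :: "'s measure \<Rightarrow> (real \<Rightarrow> real \<Rightarrow> 's \<Rightarrow> real) \<Rightarrow> real \<Rightarrow> real \<Rightarrow> real" where
  "covariance M c t x = (LINT s|M. c (max 0 (- t)) 0 s * c (max 0 t) x s)"

definition field_events ::
    "'s measure \<Rightarrow> (real \<Rightarrow> real \<Rightarrow> 's \<Rightarrow> real) \<Rightarrow> (real \<times> real) set \<Rightarrow> 's set set" where
  "field_events M c A =
     sigma_sets (space M) (\<Union>(t, x)\<in>A. {c t x -` U \<inter> space M |U. U \<in> sets borel})"

text \<open>The set below is nonempty and, for a probability space, bounded by \<open>1\<close>, so the real supremum
  is the intended one. Since \<open>setdist\<close> is \<open>0\<close> if one of its arguments is empty, empty index sets are
  left out when \<open>r > 0\<close>; their events are trivial and would only contribute the value \<open>0\<close>.\<close>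

definition alpha_um :: "'s measure \<Rightarrow> (real \<Rightarrow> real \<Rightarrow> 's \<Rightarrow> real) \<Rightarrow> real \<Rightarrow> real" where
  "alpha_um M c r =
     Sup {\<bar>\<P>(s in M. s \<in> S1 \<bar> s \<in> S2) - measure M S1\<bar> |S1 S2 A1 A2.
        A1 \<subseteq> {0..} \<times> UNIV \<and> A2 \<subseteq> {0..} \<times> UNIV \<and> setdist A1 A2 \<ge> r \<and>
        S1 \<in> field_events M c A1 \<and> S2 \<in> field_events M c A2 \<and> measure M S2 \<noteq> 0}"

definition feynman_kac ::
    "'w measure \<Rightarrow> (real \<Rightarrow> 'w \<Rightarrow> real) \<Rightarrow> (real \<Rightarrow> real \<Rightarrow> 's \<Rightarrow> real) \<Rightarrow> (real \<Rightarrow> real) \<Rightarrow> real \<Rightarrow>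
     real \<Rightarrow> real \<Rightarrow> real \<Rightarrow> 's \<Rightarrow> real" where
  "feynman_kac W B c g \<beta> \<epsilon> t x s =
     (LINT \<omega>|W. g (x + B t \<omega>) *
        exp (\<epsilon> powr (- 1 / 2) *
          (LINT r:{0..t}|lborel. c (r / \<epsilon>) ((x + B r \<omega>) / \<epsilon> powr \<beta>) s)))"

definition square_integrable :: "'a measure \<Rightarrow> ('a \<Rightarrow> real) \<Rightarrow> bool" where
  "square_integrable M f \<longleftrightarrow> f \<in> borel_measurable M \<and> integrable M (\<lambda>x. (f x)\<^sup>2)"

definition tendsto_L2 ::
    "'a measure \<Rightarrow> ('i \<Rightarrow> 'a \<Rightarrow> real) \<Rightarrow> ('a \<Rightarrow> real) \<Rightarrow> 'i filter \<Rightarrow> bool" where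
  "tendsto_L2 M X Y F \<longleftrightarrow>
     (\<forall>\<^sub>F i in F. square_integrable M (X i)) \<and> square_integrable M Y \<and>
     ((\<lambda>i. LINT a|M. (X i a - Y a)\<^sup>2) \<longlongrightarrow> 0) F"

text \<open>Classical solution, in \<open>C\<^sup>1\<^sup>,\<^sup>2((0,\<infinity>) \<times> \<real>) \<inter> C([0,\<infinity>) \<times> \<real>)\<close>, of the Cauchy problem
  \<open>\<partial>\<^sub>t u = \<partial>\<^sub>x\<^sub>x u / 2 + \<sigma> u\<close>, \<open>u(0,\<cdot>) = g\<close>. At \<open>t = 0\<close> the derivatives need not exist for a merely
  continuous \<open>g\<close>; there the solution is required to be continuous and equal to \<open>g\<close>. Continuity of
  the time derivative follows from that of \<open>u\<close> and \<open>uxx\<close>.\<close>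

definition classical_solution :: "real \<Rightarrow> (real \<Rightarrow> real) \<Rightarrow> (real \<Rightarrow> real \<Rightarrow> real) \<Rightarrow> bool" where
  "classical_solution \<sigma> g u \<longleftrightarrow>
     continuous_on ({0..} \<times> UNIV) (\<lambda>(t, x). u t x) \<and>
     (\<forall>x. u 0 x = g x) \<and>
     (\<exists>ux uxx.
        continuous_on ({0<..} \<times> UNIV) (\<lambda>(t, x). ux t x) \<and>
        continuous_on ({0<..} \<times> UNIV) (\<lambda>(t, x). uxx t x) \<and>
        (\<forall>t>0. \<forall>x.
           ((\<lambda>y. u t y) has_real_derivative ux t x) (at x) \<and>
           ((\<lambda>y. ux t y) has_real_derivative uxx t x) (at x) \<and>
           ((\<lambda>r. u r x) has_real_derivative (1 / 2 * uxx t x + \<sigma> * u t x)) (at t)))"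

end

theory Submission
  imports Defs
begin

text \<open>The square of \<open>u\<^sup>\<epsilon> - u\<close> is expanded with two independent copies of the Brownian motion, so
  that everything reduces to exponential moments \<open>F(t) = E exp(Z\<^sub>t)\<close> of
  \<open>Z\<^sub>t = \<epsilon>\<^bsup>-1/2\<^esup> \<integral>\<^sub>0\<^sup>t X\<^sub>r dr\<close>, where \<open>X\<close> is the field along one path, or the sum of the field along
  two paths, kept fixed. Differentiating \<open>exp(Z)\<close> twice in time gives
  \<open>F'(r) = \<epsilon>\<^sup>-\<^sup>1 \<integral>\<^sub>0\<^sup>r E[X\<^sub>r X\<^sub>q exp(Z\<^sub>q)] dq\<close>. Uniform mixing bounds the integrand by \<open>\<alpha>((r - q)/\<epsilon>) F(q)\<close>,
  hence \<open>F\<close> by a Gronwall argument, and separates \<open>X\<^sub>r X\<^sub>q\<close> from \<open>exp(Z\<^sub>q)\<close> up to a small error, so that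
  \<open>F' = D F + o(1)\<close> with \<open>D(r) = \<epsilon>\<^sup>-\<^sup>1 \<integral>\<^sub>0\<^sup>r E[X\<^sub>r X\<^sub>q] dq\<close>.

  At lag \<open>\<epsilon> u\<close> a Brownian path moves by \<open>(\<epsilon> u)\<^bsup>1/2\<^esup>\<close>, which is negligible compared with \<open>\<epsilon>\<^sup>\<beta>\<close> since \<open>\<beta> < 1/2\<close>,
  so \<open>D\<close> tends to \<open>\<integral> \<Phi>(u, 0) du\<close> for one path, as \<open>\<Phi>(u, \<cdot>)\<close> is continuous at \<open>0\<close> by stationarity and
  measurability. Two independent paths are at distance of order \<open>1\<close>, so their cross correlations
  vanish.\<close>

section \<open>Mixing inequalities\<close>

text \<open>\<open>exp (Z q)\<close> can be as large as \<open>exp (\<kappa> * K * t)\<close> with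
  \<kappa> = \<epsilon>^(-1/2), so no estimate may involve its supremum. Hence uniform mixing is
  applied with the past event as the condition: its error carries the factor
  \<open>measure M T\<close>, which turns into the L1 norm of the past variable. Every covariance
  error is then a multiple of \<open>F q\<close> itself, and a linear Gronwall inequality closes
  with constants free of \<epsilon>.

  The rate (1 + r)^(-(2 + \<delta>)) is written as the square of \<open>decay\<close> with \<eta> =
  \<delta>/2. One factor, of exponent 1 + \<eta>, must stay integrable in the lag; the other can be
  spent: it pays for the increment of \<open>F\<close> over the lag and, through a geometric mean,
  for the decoupling error.

  The moment estimates hold for all frozen measurable paths with one constant, but their errors are
  path functionals that are small only on average over Brownian motion. As the product of the two
  values of \<open>g\<close> is merely square integrable, L1 smallness of the moment differences is
  combined with their boundedness by Young's inequality.\<close>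

text \<open>The covariance and the L1 norm are both linear and continuous under monotone limits on
  nonnegative \<open>V\<close>, so the inequality extends from indicators of \<open>T\<close>; for a
  signed \<open>V\<close> the bounds of the positive and the negative part add up to the L1
  norm.\<close>

lemma mixing_indicator:
  assumes "prob_space M" and F: "subalgebra M F" and S: "S \<in> sets M"
    and mix: "\<And>T. T \<in> sets F \<Longrightarrow> \<bar>measure M (S \<inter> T) - measure M S * measure M T\<bar> \<le> a * measure M T"
    and V: "V \<in> borel_measurable F" "integrable M V"
  shows "\<bar>(LINT s|M. indicator S s * V s) - measure M S * (LINT s|M. V s)\<bar> \<le> a * (LINT s|M. \<bar>V s\<bar>)"
proof -
  interpret prob_space M by fact
  have spF: "space F = space M" and sF: "sets F \<subseteq> sets M"
    using F by (auto simp: subalgebra_def)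
  note [measurable] = S
  \<comment> \<open>Integrability is a premise inside the induction formula: an integrable sum or
    limit dominates its nonnegative summands or approximants, so the premise passes down to the
    induction hypotheses.\<close>
  have nonneg: "integrable M V \<longrightarrow>
     \<bar>(LINT s|M. indicator S s * V s) - measure M S * (LINT s|M. V s)\<bar> \<le> a * (LINT s|M. V s)"
    if "V \<in> borel_measurable F" "\<And>s. 0 \<le> V s" for V
    using that
  proof (induction V rule: borel_measurable_induct_real)
    case (set T)
    then have "T \<in> sets M" using sF by auto
    then show ?case using mix[OF set]
      by (simp flip: indicator_inter_arith)
  next
    case (mult u c)
    show ?case
    proof (cases "c = 0")
      case False
      show ?thesis
      proof
        assume "integrable M (\<lambda>x. c * u x)"
        then have "integrable M u" using False by simp
        with mult have *: "\<bar>(LINT s|M. indicator S s * u s) - measure M S * (LINT s|M. u s)\<bar> \<le> a * (LINT s|M. u s)"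
          by blast
        have "\<bar>(LINT s|M. indicator S s * (c * u s)) - measure M S * (LINT s|M. c * u s)\<bar>
            = c * \<bar>(LINT s|M. indicator S s * u s) - measure M S * (LINT s|M. u s)\<bar>"
          using mult(1) by (simp add: mult.left_commute abs_mult flip: right_diff_distrib)
        then show "\<bar>(LINT s|M. indicator S s * (c * u s)) - measure M S * (LINT s|M. c * u s)\<bar>
           \<le> a * (LINT s|M. c * u s)"
          using mult_left_mono[OF * mult(1)] by (simp add: mult.left_commute)
      qed
    qed simp
  next
    case (add u v)
    show ?case
    proof
      assume int: "integrable M (\<lambda>x. v x + u x)"
      have "integrable M u" "integrable M v"
        using add measurable_from_subalg[OF F \<open>u \<in> borel_measurable F\<close>]
          measurable_from_subalg[OF F \<open>v \<in> borel_measurable F\<close>]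
        by (auto intro!: Bochner_Integration.integrable_bound[OF int])
      moreover from this have "integrable M (\<lambda>s. indicator S s * u s)" "integrable M (\<lambda>s. indicator S s * v s)"
        by (auto intro!: integrable_real_mult_indicator simp: mult.commute)
      ultimately show "\<bar>(LINT s|M. indicator S s * (v s + u s)) - measure M S * (LINT s|M. v s + u s)\<bar>
           \<le> a * (LINT s|M. v s + u s)"
        using add.IH by (simp add: distrib_left)
    qed
  next
    case (seq U)
    show ?case
    proof
      assume int: "integrable M V"
      have UV: "U i x \<le> V x" if "x \<in> space M" for i x
        by (rule incseq_le[of "\<lambda>i. U i x"]) (use seq that spF in \<open>auto simp: incseq_def le_fun_def\<close>)
      have [measurable]: "U i \<in> borel_measurable M" for i
        using seq(1) measurable_from_subalg[OF F] by blast
      have [measurable]: "V \<in> borel_measurable M" using int by simp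
      have iU: "integrable M (U i)" for i
        by (rule Bochner_Integration.integrable_bound[OF int])
           (use order_trans[OF UV abs_ge_self] seq in \<open>auto intro!: AE_I2\<close>)
      have 1: "(\<lambda>i. LINT s|M. U i s) \<longlonglongrightarrow> (LINT s|M. V s)"
        by (rule integral_dominated_convergence[where w=V])
           (use int UV seq spF in \<open>auto intro!: AE_I2\<close>)
      have 2: "(\<lambda>i. LINT s|M. indicator S s * U i s) \<longlonglongrightarrow> (LINT s|M. indicator S s * V s)"
        by (rule integral_dominated_convergence[where w=V])
           (use int UV seq spF order_trans[OF seq(2) UV] in \<open>auto intro!: AE_I2 tendsto_mult_left simp: indicator_def\<close>)
      show "\<bar>(LINT s|M. indicator S s * V s) - measure M S * (LINT s|M. V s)\<bar> \<le> a * (LINT s|M. V s)"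
      proof (rule LIMSEQ_le)
        show "(\<lambda>i. \<bar>(LINT s|M. indicator S s * U i s) - measure M S * (LINT s|M. U i s)\<bar>) \<longlonglongrightarrow>
            \<bar>(LINT s|M. indicator S s * V s) - measure M S * (LINT s|M. V s)\<bar>"
          by (intro tendsto_intros 1 2)
        show "(\<lambda>i. a * (LINT s|M. U i s)) \<longlonglongrightarrow> a * (LINT s|M. V s)"
          by (intro tendsto_intros 1)
      qed (use seq.IH iU in blast)
    qed
  qed
  let ?p = "\<lambda>s. max 0 (V s)" and ?n = "\<lambda>s. max 0 (- V s)"
  have ip: "integrable M ?p" "integrable M ?n" using V by auto
  have ip': "integrable M (\<lambda>s. indicator S s * ?p s)" "integrable M (\<lambda>s. indicator S s * ?n s)"
    using integrable_real_mult_indicator[OF S ip(1)] integrable_real_mult_indicator[OF S ip(2)]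
    by (simp_all add: mult.commute)
  have e1: "(LINT s|M. V s) = (LINT s|M. ?p s) - (LINT s|M. ?n s)"
    by (subst Bochner_Integration.integral_diff[OF ip, symmetric])
       (auto intro!: Bochner_Integration.integral_cong simp: max_def)
  have e2: "(LINT s|M. indicator S s * V s) = (LINT s|M. indicator S s * ?p s) - (LINT s|M. indicator S s * ?n s)"
    by (subst Bochner_Integration.integral_diff[OF ip', symmetric])
       (auto intro!: Bochner_Integration.integral_cong simp: max_def indicator_def)
  have e3: "(LINT s|M. \<bar>V s\<bar>) = (LINT s|M. ?p s) + (LINT s|M. ?n s)"
    by (subst Bochner_Integration.integral_add[OF ip, symmetric])
       (auto intro!: Bochner_Integration.integral_cong simp: max_def)
  have "\<bar>(LINT s|M. indicator S s * ?p s) - measure M S * (LINT s|M. ?p s)\<bar> \<le> a * (LINT s|M. ?p s)"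
    "\<bar>(LINT s|M. indicator S s * ?n s) - measure M S * (LINT s|M. ?n s)\<bar> \<le> a * (LINT s|M. ?n s)"
    using nonneg[of ?p] nonneg[of ?n] ip V by auto
  then show ?thesis unfolding e1 e2 e3 by (simp add: algebra_simps)
qed

text \<open>Testing the conditional expectation \<open>d = E[V - E V | F1]\<close> with the sign of \<open>d\<close> reduces
  a bounded \<open>Y\<close> to indicators.\<close>

lemma mixing_covariance:
  assumes P: "prob_space M" and F1: "subalgebra M F1" and F2: "subalgebra M F2"
    and mix: "\<And>S T. S \<in> sets F1 \<Longrightarrow> T \<in> sets F2 \<Longrightarrow>
      \<bar>measure M (S \<inter> T) - measure M S * measure M T\<bar> \<le> a * measure M T"
    and V: "V \<in> borel_measurable F2" "integrable M V"
    and Y: "Y \<in> borel_measurable F1" "\<And>s. s \<in> space M \<Longrightarrow> \<bar>Y s\<bar> \<le> b"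
  shows "\<bar>(LINT s|M. Y s * V s) - (LINT s|M. Y s) * (LINT s|M. V s)\<bar> \<le> 2 * b * a * (LINT s|M. \<bar>V s\<bar>)"
proof -
  interpret prob_space M by fact
  interpret finite_measure_subalgebra M F1 by unfold_locales fact
  have sp: "space F1 = space M" and sF: "sets F1 \<subseteq> sets M"
    using F1 by (auto simp: subalgebra_def)
  obtain s0 where "s0 \<in> space M" using not_empty by blast
  then have b: "0 \<le> b" using Y(2)[of s0] by linarith
  have [measurable]: "Y \<in> borel_measurable M" using measurable_from_subalg[OF F1 Y(1)] .
  define V0 where "V0 = (\<lambda>s. V s - (LINT s|M. V s))"
  define d where "d = real_cond_exp M F1 V0"
  have iV0: "integrable M V0" unfolding V0_def using V by auto
  have id: "integrable M d" unfolding d_def using iV0 by (rule real_cond_exp_int)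
  have dF[measurable]: "d \<in> borel_measurable F1" unfolding d_def by simp
  have iY: "integrable M Y" by (rule integrable_const_bound[of _ b]) (use Y in auto)
  have iYV: "integrable M (\<lambda>s. Y s * f s)" if "integrable M f" for f
    by (rule Bochner_Integration.integrable_bound[of _ "\<lambda>s. b * \<bar>f s\<bar>"])
       (use that Y b in \<open>auto intro!: AE_I2 mult_right_mono simp: abs_mult\<close>)
  have test: "(LINT s|M. Z s * d s) = (LINT s|M. Z s * V0 s)"
    if "Z \<in> borel_measurable F1" "integrable M (\<lambda>s. Z s * V0 s)" for Z
    unfolding d_def by (rule real_cond_exp_intg) (use that iV0 in auto)
  \<comment> \<open>Tested with the indicator of a set in \<open>F1\<close>, \<open>d\<close>
    returns the covariance of that indicator with \<open>V\<close>, which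
    \<open>mixing_indicator\<close> controls.\<close>
  have ind: "\<bar>LINT s|M. indicator S s * d s\<bar> \<le> a * (LINT s|M. \<bar>V s\<bar>)" if S: "S \<in> sets F1" for S
  proof -
    have [measurable]: "S \<in> sets M" using S sF by auto
    have i: "integrable M (\<lambda>s. indicator S s * V0 s)" "integrable M (\<lambda>s. indicator S s * V s)"
      using integrable_real_mult_indicator[OF \<open>S \<in> sets M\<close> iV0] integrable_real_mult_indicator[OF \<open>S \<in> sets M\<close> V(2)]
      by (simp_all add: mult.commute)
    have "(LINT s|M. indicator S s * d s) = (LINT s|M. indicator S s * V s - (LINT s|M. V s) * indicator S s)"
      by (subst test) (use S i in \<open>auto simp: V0_def algebra_simps\<close>)
    also have "\<dots> = (LINT s|M. indicator S s * V s) - measure M S * (LINT s|M. V s)"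
      using i by (subst Bochner_Integration.integral_diff) (auto simp: less_top[symmetric])
    finally show ?thesis using mixing_indicator[OF P F2 \<open>S \<in> sets M\<close> mix[OF S] V] by simp
  qed
  have "(LINT s|M. Y s * V s) - (LINT s|M. Y s) * (LINT s|M. V s) = (LINT s|M. Y s * V s - (LINT s|M. V s) * Y s)"
    using iYV[OF V(2)] iY by (subst Bochner_Integration.integral_diff) auto
  also have "\<dots> = (LINT s|M. Y s * V0 s)" by (simp add: V0_def algebra_simps)
  also have "\<dots> = (LINT s|M. Y s * d s)" using test[OF Y(1) iYV[OF iV0]] by simp
  finally have "\<bar>(LINT s|M. Y s * V s) - (LINT s|M. Y s) * (LINT s|M. V s)\<bar> \<le> (LINT s|M. \<bar>Y s * d s\<bar>)"
    by (simp only: integral_abs_bound)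
  also have "\<dots> \<le> (LINT s|M. b * \<bar>d s\<bar>)"
    using id Y b by (intro integral_mono integrable_abs iYV) (auto simp: abs_mult intro!: mult_right_mono)
  also have "\<dots> = b * (LINT s|M. \<bar>d s\<bar>)" by simp
  finally have 1: "\<bar>(LINT s|M. Y s * V s) - (LINT s|M. Y s) * (LINT s|M. V s)\<bar> \<le> b * (LINT s|M. \<bar>d s\<bar>)" .
  \<comment> \<open>The sign set of \<open>d\<close> lies in \<open>F1\<close>, so the L1 norm of
    \<open>d\<close> is a difference of two such tests; this produces the factor 2.\<close>
  define S where "S = {s \<in> space M. 0 \<le> d s}"
  have S: "S \<in> sets F1" "space M - S \<in> sets F1" unfolding S_def
    by (auto simp flip: sp intro!: sets.compl_sets)
  then have S': "S \<in> sets M" "space M - S \<in> sets M" using sF by auto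
  have i: "integrable M (\<lambda>s. indicator S s * d s)" "integrable M (\<lambda>s. indicator (space M - S) s * d s)"
    using integrable_real_mult_indicator[OF S'(1) id] integrable_real_mult_indicator[OF S'(2) id]
    by (simp_all add: mult.commute)
  have "(LINT s|M. \<bar>d s\<bar>) = (LINT s|M. indicator S s * d s - indicator (space M - S) s * d s)"
    by (intro Bochner_Integration.integral_cong) (auto simp: S_def indicator_def)
  also have "\<dots> = (LINT s|M. indicator S s * d s) - (LINT s|M. indicator (space M - S) s * d s)"
    using i by (rule Bochner_Integration.integral_diff)
  also have "\<dots> \<le> 2 * a * (LINT s|M. \<bar>V s\<bar>)" using ind[OF S(1)] ind[OF S(2)] by linarith
  finally have "b * (LINT s|M. \<bar>d s\<bar>) \<le> b * (2 * a * (LINT s|M. \<bar>V s\<bar>))"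
    using b by (intro mult_left_mono)
  then show ?thesis using 1 by (simp add: algebra_simps)
qed

text \<open>\<open>X\<close> is only jointly measurable with respect to the big \<open>\<sigma>\<close>-algebra, so its time integral is
  \<open>F\<close>-measurable only up to a null set: \<open>E[Z E[Z|F]] = E[Z Z]\<close> by Fubini.\<close>

lemma integral_AE_measurable_subalgebra:
  fixes X :: "real \<Rightarrow> 'a \<Rightarrow> real"
  assumes P: "prob_space M" and F: "subalgebra M F"
    and X[measurable]: "(\<lambda>(r, s). X r s) \<in> borel_measurable (borel \<Otimes>\<^sub>M M)"
    and K: "\<And>r s. s \<in> space M \<Longrightarrow> \<bar>X r s\<bar> \<le> K"
    and XF: "\<And>r. r \<in> {0..t} \<Longrightarrow> X r \<in> borel_measurable F"
  shows "\<exists>Z' \<in> borel_measurable F. AE s in M. Z' s = (LINT r:{0..t}|lborel. X r s)"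
proof -
  interpret prob_space M by fact
  interpret finite_measure_subalgebra M F by unfold_locales fact
  define L where "L = restrict_space lborel {0..t}"
  interpret L: finite_measure L
    by standard (simp add: L_def emeasure_restrict_space space_restrict_space emeasure_lborel_Icc_eq)
  interpret LM: pair_sigma_finite L M ..
  interpret LMf: finite_measure "L \<Otimes>\<^sub>M M"
    by (rule finite_measure_pair_measure) unfold_locales
  have [measurable]: "(\<lambda>(r, s). X r s) \<in> borel_measurable (L \<Otimes>\<^sub>M M)"
  proof -
    have "(\<lambda>p. (fst p, snd p)) \<in> L \<Otimes>\<^sub>M M \<rightarrow>\<^sub>M borel \<Otimes>\<^sub>M M"
      unfolding L_def
      by (intro measurable_Pair measurable_snd measurable_compose[OF measurable_fst] measurable_restrict_space1) auto
    from measurable_compose[OF this X] show ?thesis by simp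
  qed
  obtain s0 where "s0 \<in> space M" using not_empty by blast
  then have K0: "0 \<le> K" using K[of s0 0] by linarith
  define Z where "Z = (\<lambda>s. LINT r|L. X r s)"
  have Z_eq: "Z s = (LINT r:{0..t}|lborel. X r s)" for s
    unfolding Z_def L_def set_lebesgue_integral_def by (subst integral_restrict_space) auto
  have [measurable]: "Z \<in> borel_measurable M"
    unfolding Z_def by measurable
  have iX: "integrable (L \<Otimes>\<^sub>M M) (\<lambda>(r, s). X r s)"
    by (rule LMf.integrable_const_bound[of _ K]) (auto simp: K space_pair_measure intro!: AE_I2)
  have Zb: "\<bar>Z s\<bar> \<le> K * measure L (space L)" if "s \<in> space M" for s
  proof -
    have "norm (Z s) \<le> (LINT r|L. norm (X r s))" unfolding Z_def by (rule integral_norm_bound)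
    also have "\<dots> \<le> (LINT r|L. K)"
      by (intro integral_mono L.integrable_const_bound[of _ K] AE_I2) (use that K K0 in \<open>auto\<close>)
    finally show ?thesis by (simp add: mult.commute)
  qed
  have iZ: "integrable M Z" by (rule integrable_const_bound[of _ "K * measure L (space L)"]) (use Zb in auto)
  define Z' where "Z' = real_cond_exp M F Z"
  have Z'F[measurable]: "Z' \<in> borel_measurable F" "Z' \<in> borel_measurable M" by (auto simp: Z'_def)
  have Z'b: "AE s in M. \<bar>Z' s\<bar> \<le> K * measure L (space L)"
  proof -
    have "AE s in M. Z' s \<le> K * measure L (space L)" unfolding Z'_def
      by (rule real_cond_exp_le_c[OF iZ]) (use Zb in \<open>force intro!: AE_I2\<close>)
    moreover have "AE s in M. Z' s \<ge> - (K * measure L (space L))" unfolding Z'_def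
      by (rule real_cond_exp_ge_c[OF iZ]) (use Zb in \<open>force intro!: AE_I2\<close>)
    ultimately show ?thesis by eventually_elim auto
  qed
  have iH: "integrable M (\<lambda>s. f s * g s)" if [measurable]: "f \<in> borel_measurable M" "g \<in> borel_measurable M"
    and "AE s in M. \<bar>f s\<bar> \<le> a" "AE s in M. \<bar>g s\<bar> \<le> b" for f g and a b :: real
    by (rule integrable_const_bound[of _ "a * b"]; (measurable)?)
       (use that(3,4) in eventually_elim, auto simp: abs_mult intro!: mult_mono)
  have Zb': "AE s in M. \<bar>Z s\<bar> \<le> K * measure L (space L)" using Zb by auto
  have Xm[measurable]: "X r \<in> borel_measurable M" for r
    by measurable
  have fub: "(LINT s|M. Z s * G s) = (LINT r|L. (LINT s|M. X r s * G s))"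
    if [measurable]: "G \<in> borel_measurable M" and G: "AE s in M. \<bar>G s\<bar> \<le> b" for G b
  proof -
    have "(LINT s|M. Z s * G s) = (LINT s|M. (LINT r|L. X r s * G s))" unfolding Z_def by simp
    also have "\<dots> = (LINT r|L. (LINT s|M. X r s * G s))"
    proof (rule LM.Fubini_integral)
      have "AE x in L \<Otimes>\<^sub>M M. \<bar>G (snd x)\<bar> \<le> b"
      proof (rule LM.AE_pair_measure)
        show "AE x in L. AE y in M. \<bar>G (snd (x, y))\<bar> \<le> b" using G by auto
      qed measurable
      moreover have "AE x in L \<Otimes>\<^sub>M M. \<bar>X (fst x) (snd x)\<bar> \<le> K"
        by (auto simp: space_pair_measure K intro!: AE_I2)
      ultimately have "AE x in L \<Otimes>\<^sub>M M. norm (case x of (r, s) \<Rightarrow> X r s * G s) \<le> K * b"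
        by eventually_elim (auto simp: abs_mult split_beta intro!: mult_mono K0)
      then show "integrable (L \<Otimes>\<^sub>M M) (\<lambda>(r, s). X r s * G s)"
        by (rule LMf.integrable_const_bound) measurable
    qed
    finally show ?thesis .
  qed
  \<comment> \<open>Under the time integral each \<open>X r\<close> is \<open>F\<close>-measurable,
    so \<open>Z'\<close> may be replaced by \<open>Z\<close> for every fixed \<open>r\<close>,
    although \<open>Z\<close> itself is not known to be \<open>F\<close>-measurable.\<close>
  have "(LINT s|M. Z s * Z' s) = (LINT r|L. (LINT s|M. X r s * Z' s))"
    by (rule fub[OF _ Z'b]) measurable
  also have "\<dots> = (LINT r|L. (LINT s|M. X r s * Z s))"
  proof (rule Bochner_Integration.integral_cong[OF refl])
    fix r assume "r \<in> space L"
    then have "X r \<in> borel_measurable F" using XF by (auto simp: L_def space_restrict_space)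
    then show "(LINT s|M. X r s * Z' s) = (LINT s|M. X r s * Z s)"
      unfolding Z'_def by (intro real_cond_exp_intg(2) iH[OF _ _ _ Zb', of _ K]) (use K in auto)
  qed
  also have "\<dots> = (LINT s|M. Z s * Z s)"
    by (rule fub[OF _ Zb', symmetric]) measurable
  finally have ZZ': "(LINT s|M. Z s * Z' s) = (LINT s|M. Z s * Z s)" .
  \<comment> \<open>Projection identity for the \<open>F\<close>-measurable \<open>Z'\<close>;
    together with \<open>ZZ'\<close> it makes all three second moments of \<open>Z\<close> and
    \<open>Z'\<close> equal.\<close>
  have Z'Z': "(LINT s|M. Z' s * Z' s) = (LINT s|M. Z' s * Z s)"
    unfolding Z'_def[symmetric]
    using real_cond_exp_intg(2)[of Z' Z] iH[OF _ _ Z'b Zb'] by (simp add: Z'_def[symmetric])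
  note i1 = iH[OF _ _ Zb' Zb'] iH[OF _ _ Zb' Z'b] iH[OF _ _ Z'b Z'b]
  have "(LINT s|M. (Z s - Z' s)\<^sup>2) = (LINT s|M. (Z s * Z s - 2 * (Z s * Z' s)) + Z' s * Z' s)"
    by (simp add: power2_eq_square algebra_simps)
  also have "\<dots> = (LINT s|M. Z s * Z s) - 2 * (LINT s|M. Z s * Z' s) + (LINT s|M. Z' s * Z' s)"
    using i1 by (simp add: Bochner_Integration.integral_diff Bochner_Integration.integral_add)
  also have "\<dots> = 0" using ZZ' Z'Z' by (simp add: mult.commute)
  finally have 0: "(LINT s|M. (Z s - Z' s)\<^sup>2) = 0" .
  have "integrable M (\<lambda>s. (Z s - Z' s)\<^sup>2)"
  proof -
    have "integrable M (\<lambda>s. (Z s * Z s - 2 * (Z s * Z' s)) + Z' s * Z' s)" using i1 by simp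
    then show ?thesis by (simp add: power2_eq_square algebra_simps)
  qed
  then have "AE s in M. (Z s - Z' s)\<^sup>2 = 0"
    using 0 integral_nonneg_eq_0_iff_AE[of M "\<lambda>s. (Z s - Z' s)\<^sup>2"] by simp
  then have "AE s in M. Z' s = (LINT r:{0..t}|lborel. X r s)"
    by eventually_elim (simp add: Z_eq)
  then show ?thesis using Z'F by blast
qed

section \<open>Auxiliary estimates on the real line\<close>

text \<open>A non-integrable \<open>f\<close> has integral 0 by convention, so only the majorant
  \<open>g\<close> must be integrable and no measurability of \<open>f\<close> has to be
  shown.\<close>

lemma abs_integral_le:
  fixes f g :: "'a \<Rightarrow> real"
  assumes "integrable M g" "\<And>x. x \<in> space M \<Longrightarrow> \<bar>f x\<bar> \<le> g x"
  shows "\<bar>integral\<^sup>L M f\<bar> \<le> integral\<^sup>L M g"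
proof (cases "integrable M f")
  case True
  have "\<bar>integral\<^sup>L M f\<bar> \<le> (LINT x|M. \<bar>f x\<bar>)" by (rule integral_abs_bound)
  also have "\<dots> \<le> integral\<^sup>L M g" using True assms by (intro integral_mono) auto
  finally show ?thesis .
next
  case False
  have "0 \<le> integral\<^sup>L M g"
    by (rule Bochner_Integration.integral_nonneg) (use assms(2) abs_ge_zero order_trans in blast)
  then show ?thesis using False by (simp add: not_integrable_integral_eq)
qed

lemma abs_set_integral_le:
  fixes f g :: "real \<Rightarrow> real"
  assumes "set_integrable lborel {a..b} g" "\<And>x. x \<in> {a..b} \<Longrightarrow> \<bar>f x\<bar> \<le> g x"
  shows "\<bar>LINT x:{a..b}|lborel. f x\<bar> \<le> (LINT x:{a..b}|lborel. g x)"
  unfolding set_lebesgue_integral_def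
  by (rule abs_integral_le) (use assms in \<open>auto simp: set_integrable_def indicator_def\<close>)

lemma set_integrable_Icc_bounded:
  fixes f :: "real \<Rightarrow> real"
  assumes [measurable]: "f \<in> borel_measurable borel" and "\<And>x. x \<in> {a..b} \<Longrightarrow> \<bar>f x\<bar> \<le> K"
  shows "set_integrable lborel {a..b} f"
  unfolding set_integrable_def
proof (rule Bochner_Integration.integrable_bound)
  show "integrable lborel (\<lambda>x. K * indicator {a..b} x :: real)"
    by (intro integrable_mult_right integrable_real_indicator) (auto simp: emeasure_lborel_Icc_eq)
  show "AE x in lborel. norm (indicator {a..b} x *\<^sub>R f x) \<le> norm (K * indicator {a..b} x :: real)"
    using assms(2) by (intro AE_I2) (force simp: indicator_def intro: order_trans[OF _ abs_ge_self])
qed measurable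

lemma abs_set_integral_Icc_bounded:
  fixes f :: "real \<Rightarrow> real"
  assumes "a \<le> b" "\<And>x. x \<in> {a..b} \<Longrightarrow> \<bar>f x\<bar> \<le> K"
  shows "\<bar>LINT x:{a..b}|lborel. f x\<bar> \<le> K * (b - a)"
proof -
  have "\<bar>LINT x:{a..b}|lborel. f x\<bar> \<le> (LINT x:{a..b}|lborel. K)"
    by (rule abs_set_integral_le[OF set_integrable_Icc_bounded[of _ _ _ "\<bar>K\<bar>"]]) (use assms in auto)
  also have "\<dots> = K * (b - a)" using assms(1) by (simp add: set_lebesgue_integral_def)
  finally show ?thesis .
qed

lemma set_integral_Icc_combine:
  fixes f :: "real \<Rightarrow> real"
  assumes "a \<le> b" "b \<le> c" "set_integrable lborel {a..c} f"
  shows "(LINT x:{a..c}|lborel. f x) = (LINT x:{a..b}|lborel. f x) + (LINT x:{b..c}|lborel. f x)"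
proof -
  have i: "set_integrable lborel {a..b} f" "set_integrable lborel {b..c} f"
    by (rule set_integrable_subset[OF assms(3)]; use assms in auto)+
  show ?thesis
    using Henstock_Kurzweil_Integration.integral_combine[OF assms(1,2) set_borel_integral_eq_integral(1)[OF assms(3)]]
      set_borel_integral_eq_integral(2)[OF assms(3)] set_borel_integral_eq_integral(2)[OF i(1)]
      set_borel_integral_eq_integral(2)[OF i(2)] by simp
qed

lemma measurable_integral_upto [measurable (raw)]:
  fixes f :: "'n \<Rightarrow> real \<Rightarrow> real"
  assumes [measurable]: "(\<lambda>(x, q). f x q) \<in> borel_measurable (N \<Otimes>\<^sub>M borel)" "h \<in> borel_measurable N"
  shows "(\<lambda>x. LINT q:{0..h x}|lborel. f x q) \<in> borel_measurable N"
proof -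
  have "(\<lambda>x. LINT q:{0..h x}|lborel. f x q) = (\<lambda>x. LINT q|lborel. (if 0 \<le> q \<and> q \<le> h x then f x q else 0))"
    unfolding set_lebesgue_integral_def
    by (intro ext Bochner_Integration.integral_cong) (auto simp: indicator_def)
  also have "\<dots> \<in> borel_measurable N" by measurable
  finally show ?thesis .
qed

lemma exp_diff_bounds:
  fixes x y b :: real
  assumes "x \<le> b" "y \<le> b"
  shows "\<bar>exp x - exp y\<bar> \<le> \<bar>x - y\<bar> * exp b"
    and "\<bar>exp x - exp y - (x - y) * exp y\<bar> \<le> (x - y)\<^sup>2 * exp b"
proof -
  \<comment> \<open>The intermediate point stays within \<open>\<bar>x - y\<bar>\<close> of
    \<open>y\<close>, which allows a second application, to \<open>exp z - exp y\<close>, for the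
    quadratic remainder.\<close>
  have mvt: "\<exists>z. exp x - exp y = (x - y) * exp z \<and> z \<le> b \<and> \<bar>z - y\<bar> \<le> \<bar>x - y\<bar>" if "x \<le> b" "y \<le> b" for x y
  proof -
    consider "x < y" | "x = y" | "y < x" by linarith
    then show ?thesis
    proof cases
      case 1
      then obtain z where "x < z" "z < y" "exp y - exp x = (y - x) * exp z"
        using MVT2[of x y exp exp] by auto
      then show ?thesis using that by (intro exI[of _ z]) (auto simp: algebra_simps)
    next
      case 3
      then obtain z where "y < z" "z < x" "exp x - exp y = (x - y) * exp z"
        using MVT2[of y x exp exp] by auto
      then show ?thesis using that by (intro exI[of _ z]) auto
    qed (use that in auto)
  qed
  obtain z where z: "exp x - exp y = (x - y) * exp z" "z \<le> b" "\<bar>z - y\<bar> \<le> \<bar>x - y\<bar>" using mvt[OF assms] by blast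
  obtain v where v: "exp z - exp y = (z - y) * exp v" "v \<le> b" using mvt[OF z(2) assms(2)] by blast
  show "\<bar>exp x - exp y\<bar> \<le> \<bar>x - y\<bar> * exp b" using z by (simp add: abs_mult mult_left_mono)
  have "\<bar>exp x - exp y - (x - y) * exp y\<bar> = \<bar>(x - y) * ((z - y) * exp v)\<bar>"
    by (simp only: z(1) right_diff_distrib flip: v(1))
  also have "\<dots> = \<bar>x - y\<bar> * (\<bar>z - y\<bar> * exp v)" by (simp add: abs_mult)
  also have "\<dots> \<le> \<bar>x - y\<bar> * (\<bar>x - y\<bar> * exp b)" using z v by (intro mult_left_mono mult_mono) auto
  finally show "\<bar>exp x - exp y - (x - y) * exp y\<bar> \<le> (x - y)\<^sup>2 * exp b"
    by (simp add: power2_eq_square flip: mult.assoc)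
qed

text \<open>Increments of second order force a vanishing derivative. This replaces the fundamental
  theorem of calculus for functions such as \<open>exp (I t)\<close> below, where \<open>I\<close>
  is only Lipschitz.\<close>

lemma constant_if_quadratic_increments:
  fixes h :: "real \<Rightarrow> real"
  assumes "\<And>p q. 0 \<le> p \<Longrightarrow> p \<le> q \<Longrightarrow> q \<le> t \<Longrightarrow> \<bar>h q - h p\<bar> \<le> C * (q - p)\<^sup>2" "0 \<le> t"
  shows "h t = h 0"
proof -
  have "(h has_field_derivative 0) (at p within {0..t})" if p: "p \<in> {0..t}" for p
    unfolding has_field_derivative_iff
  proof (rule Lim_null_comparison)
    have "\<forall>\<^sub>F q in at p within {0..t}. q \<in> {0..t} \<and> q \<noteq> p"
      by (simp add: eventually_at_filter)
    then show "\<forall>\<^sub>F q in at p within {0..t}. norm ((h q - h p) / (q - p)) \<le> \<bar>C\<bar> * \<bar>q - p\<bar>"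
    proof eventually_elim
      case (elim q)
      have "\<bar>h q - h p\<bar> \<le> C * (q - p)\<^sup>2"
      proof (cases "p \<le> q")
        case True
        then show ?thesis using assms(1)[of p q] p elim by simp
      next
        case False
        then show ?thesis using assms(1)[of q p] p elim
          by (simp add: abs_minus_commute[of "h q"] power2_commute[of q])
      qed
      also have "\<dots> \<le> \<bar>C\<bar> * \<bar>q - p\<bar> * \<bar>q - p\<bar>"
        by (simp add: power2_eq_square mult_right_mono mult.assoc)
      finally show ?case using elim by (simp add: divide_le_eq)
    qed
    show "((\<lambda>q. \<bar>C\<bar> * \<bar>q - p\<bar>) \<longlongrightarrow> 0) (at p within {0..t})"
      by (auto intro!: tendsto_eq_intros)
  qed
  then have "\<exists>c. \<forall>x\<in>{0..t}. h x = c"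
    by (intro has_field_derivative_zero_constant) auto
  then obtain c where "\<And>x. x \<in> {0..t} \<Longrightarrow> h x = c" by blast
  then show ?thesis using assms(2) by simp
qed

lemma exp_integral_eq:
  fixes f :: "real \<Rightarrow> real"
  assumes [measurable]: "f \<in> borel_measurable borel" and K: "\<And>r. \<bar>f r\<bar> \<le> K"
  defines "I \<equiv> \<lambda>t. LINT r:{0..t}|lborel. f r"
  assumes t: "0 \<le> p" "p \<le> t"
  shows "exp (I t) - exp (I p) = (LINT r:{p..t}|lborel. f r * exp (I r))"
proof -
  have K0: "0 \<le> K" using K[of 0] by linarith
  have I_diff: "I q - I p = (LINT r:{p..q}|lborel. f r)" if "0 \<le> p" "p \<le> q" for p q
    using set_integral_Icc_combine[OF that, of f] set_integrable_Icc_bounded[of f 0 q K] K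
    by (simp add: I_def)
  have I_lip: "\<bar>I q - I p\<bar> \<le> K * (q - p)" if "0 \<le> p" "p \<le> q" for p q
    unfolding I_diff[OF that] by (rule abs_set_integral_Icc_bounded) (use that K in auto)
  have I0: "I 0 = 0" using abs_set_integral_Icc_bounded[of 0 0 f K] K by (simp add: I_def)
  have [measurable]: "I \<in> borel_measurable borel" unfolding I_def by measurable
  have Ib: "I r \<le> K * T" if "0 \<le> r" "r \<le> T" for r T
    using I_lip[of 0 r] that I0 mult_left_mono[OF that(2) K0] by (simp add: abs_le_iff)
  have fe: "\<bar>f r * exp (I r)\<bar> \<le> K * exp (K * T)" if "0 \<le> r" "r \<le> T" for r T
    using K[of r] Ib[OF that] K0 by (auto simp: abs_mult intro!: mult_mono)
  have ife: "set_integrable lborel {a..b} (\<lambda>r. f r * exp (I r))" if "0 \<le> a" for a b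
    by (rule set_integrable_Icc_bounded[of _ _ _ "K * exp (K * b)"]) (use fe that in auto)
  have main: "exp (I t) - (LINT r:{0..t}|lborel. f r * exp (I r)) = exp (I 0) - (LINT r:{0..0}|lborel. f r * exp (I r))"
    if t: "0 \<le> t" for t
  proof (rule constant_if_quadratic_increments[OF _ t])
    fix p q assume pq: "0 \<le> p" "p \<le> q" "q \<le> t"
    have "(LINT r:{0..q}|lborel. f r * exp (I r)) - (LINT r:{0..p}|lborel. f r * exp (I r))
        = (LINT r:{p..q}|lborel. f r * exp (I r))"
      using set_integral_Icc_combine[OF pq(1,2) ife[of 0]] by simp
    moreover have "(I q - I p) * exp (I p) = (LINT r:{p..q}|lborel. f r * exp (I p))"
      by (simp add: I_diff[OF pq(1,2)])
    moreover have "(LINT r:{p..q}|lborel. f r * exp (I r)) - (LINT r:{p..q}|lborel. f r * exp (I p))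
        = (LINT r:{p..q}|lborel. f r * exp (I r) - f r * exp (I p))"
      by (rule set_integral_diff(2)[symmetric])
         (use pq K in \<open>auto intro!: ife set_integrable_mult_left set_integrable_Icc_bounded\<close>)
    moreover have "\<bar>LINT r:{p..q}|lborel. f r * exp (I r) - f r * exp (I p)\<bar> \<le> K * (K * (q - p) * exp (K * t)) * (q - p)"
    proof (rule abs_set_integral_Icc_bounded[OF pq(2)])
      fix r assume r: "r \<in> {p..q}"
      have "\<bar>exp (I r) - exp (I p)\<bar> \<le> \<bar>I r - I p\<bar> * exp (K * t)"
        by (rule exp_diff_bounds) (use Ib r pq in auto)
      also have "\<dots> \<le> K * (q - p) * exp (K * t)"
        using order_trans[OF I_lip[of p r] mult_left_mono[of "r - p" "q - p" K]] r pq K0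
        by (intro mult_right_mono) auto
      finally show "\<bar>f r * exp (I r) - f r * exp (I p)\<bar> \<le> K * (K * (q - p) * exp (K * t))"
        using K[of r] K0 by (simp add: abs_mult mult_mono flip: right_diff_distrib)
    qed
    moreover have "\<bar>exp (I q) - exp (I p) - (I q - I p) * exp (I p)\<bar> \<le> (K * (q - p))\<^sup>2 * exp (K * t)"
    proof -
      have "\<bar>exp (I q) - exp (I p) - (I q - I p) * exp (I p)\<bar> \<le> (I q - I p)\<^sup>2 * exp (K * t)"
        by (rule exp_diff_bounds) (use Ib pq in auto)
      also have "\<dots> \<le> (K * (q - p))\<^sup>2 * exp (K * t)"
        using I_lip[OF pq(1,2)] by (intro mult_right_mono) (auto simp: abs_le_square_iff[symmetric])
      finally show ?thesis .
    qed
    ultimately show "\<bar>(exp (I q) - (LINT r:{0..q}|lborel. f r * exp (I r)))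
       - (exp (I p) - (LINT r:{0..p}|lborel. f r * exp (I r)))\<bar> \<le> (2 * K\<^sup>2 * exp (K * t)) * (q - p)\<^sup>2"
      by (simp add: power2_eq_square algebra_simps)
  qed
  show ?thesis
    using main[of p] main[of t] t set_integral_Icc_combine[OF t ife[of 0]] by simp
qed

text \<open>A Gronwall inequality through the weighted norm \<open>N\<close>, the supremum of
  \<open>h q * exp (- (l * q))\<close>: the step gives \<open>N \<le> e + N / 2\<close>. The bound
  \<open>b\<close> only makes \<open>N\<close> finite and does not enter the result, which is
  essential because it will blow up as \<epsilon> tends to 0.\<close>

lemma weighted_sup_bound:
  fixes h :: "real \<Rightarrow> real"
  assumes bdd: "\<And>r. r \<in> {0..t} \<Longrightarrow> 0 \<le> h r" "\<And>r. r \<in> {0..t} \<Longrightarrow> h r \<le> b"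
    and step: "\<And>r N. r \<in> {0..t} \<Longrightarrow> 0 \<le> N \<Longrightarrow> (\<And>q. q \<in> {0..r} \<Longrightarrow> h q \<le> N * exp (l * q)) \<Longrightarrow>
      h r \<le> e + N / 2 * exp (l * r)"
    and "0 \<le> l" "0 \<le> e" and r: "r \<in> {0..t}"
  shows "h r \<le> 2 * e * exp (l * r)"
proof -
  define g where "g = (\<lambda>r. h r * exp (- (l * r)))"
  define N where "N = Sup (g ` {0..t})"
  have h_eq: "h r = g r * exp (l * r)" for r by (simp add: g_def exp_minus)
  have "bdd_above (g ` {0..t})"
  proof (rule bdd_aboveI2)
    fix r assume r: "r \<in> {0..t}"
    then have "g r \<le> h r * 1" unfolding g_def using bdd(1)[OF r] \<open>0 \<le> l\<close> by (intro mult_left_mono) auto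
    then show "g r \<le> b" using bdd(2)[OF r] by simp
  qed
  then have gN: "g r \<le> N" if "r \<in> {0..t}" for r unfolding N_def using that by (intro cSUP_upper)
  have "0 \<le> g r" using bdd(1)[OF r] by (simp add: g_def)
  then have N0: "0 \<le> N" using gN[OF r] by linarith
  have "g r \<le> e + N / 2" if r: "r \<in> {0..t}" for r
  proof -
    have "h r \<le> e + N / 2 * exp (l * r)"
      by (rule step[OF r N0]) (use gN r in \<open>auto simp: h_eq\<close>)
    then have "g r \<le> (e + N / 2 * exp (l * r)) * exp (- (l * r))"
      unfolding g_def by (intro mult_right_mono) auto
    also have "\<dots> = e * exp (- (l * r)) + N / 2" by (simp add: exp_minus field_simps)
    also have "\<dots> \<le> e * 1 + N / 2" using \<open>0 \<le> e\<close> \<open>0 \<le> l\<close> r by (intro add_right_mono mult_left_mono) auto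
    finally show ?thesis by simp
  qed
  then have "N \<le> e + N / 2" unfolding N_def using r by (intro cSUP_least) auto
  then have "g r \<le> 2 * e" using gN[OF r] by linarith
  then show ?thesis by (simp add: h_eq)
qed

text \<open>The square of this function is the mixing rate, with \<eta> half of the excess over 2 in
  the exponent; a single factor is still integrable on the half line.\<close>

definition decay :: "real \<Rightarrow> real \<Rightarrow> real" where
  "decay \<eta> h = (1 + h) powr (- (1 + \<eta>))"

lemma decay_measurable [measurable]: "decay \<eta> \<in> borel_measurable borel"
  unfolding decay_def[abs_def] by measurable

lemma decay_bounds:
  assumes "0 < \<eta>" "0 \<le> h"
  shows "0 < decay \<eta> h" "decay \<eta> h \<le> 1" "h * decay \<eta> h \<le> 1"
proof -
  show "0 < decay \<eta> h" using assms by (simp add: decay_def)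
  show "decay \<eta> h \<le> 1" using assms powr_mono[of "- (1 + \<eta>)" 0 "1 + h"] by (simp add: decay_def)
  have "decay \<eta> h \<le> (1 + h) powr (- 1)" unfolding decay_def using assms by (intro powr_mono) auto
  then have "h * decay \<eta> h \<le> h * (1 + h) powr (- 1)" using assms by (intro mult_left_mono)
  also have "\<dots> \<le> 1" using assms by (simp add: powr_minus_divide)
  finally show "h * decay \<eta> h \<le> 1" .
qed

lemma decay_integral:
  assumes "0 < \<eta>" "0 < \<epsilon>" "0 \<le> r"
  shows "(LINT q:{0..r}|lborel. decay \<eta> ((r - q) / \<epsilon>)) \<le> \<epsilon> / \<eta>"
proof -
  let ?F = "\<lambda>q. \<epsilon> / \<eta> * (1 + (r - q) / \<epsilon>) powr (- \<eta>)"
  have "(LINT q|lborel. decay \<eta> ((r - q) / \<epsilon>) * indicator {0..r} q) = ?F r - ?F 0"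
  proof (rule integral_FTC_Icc_real[OF assms(3)])
    fix q assume q: "0 \<le> q" "q \<le> r"
    have pos: "1 + (r - q) / \<epsilon> > 0" using q assms by (simp add: add_pos_nonneg)
    show "(?F has_real_derivative decay \<eta> ((r - q) / \<epsilon>)) (at q)"
    proof -
      have "((\<lambda>q. 1 + (r - q) / \<epsilon>) has_real_derivative - 1 / \<epsilon>) (at q)"
        using assms(2) by (auto intro!: derivative_eq_intros)
      from DERIV_cmult[OF DERIV_fun_powr[OF this pos, of "- \<eta>"], of "\<epsilon> / \<eta>"] show ?thesis
        using assms by (simp add: decay_def minus_diff_commute)
    qed
    show "isCont (\<lambda>q. decay \<eta> ((r - q) / \<epsilon>)) q"
      unfolding decay_def using pos assms(2) by (auto intro!: continuous_intros)
  qed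
  also have "\<dots> \<le> \<epsilon> / \<eta>" using assms by simp
  finally show ?thesis by (simp add: set_lebesgue_integral_def mult.commute)
qed

lemma exp_integral_le:
  assumes "0 < l" "0 \<le> (t::real)"
  shows "(LINT r:{0..t}|lborel. exp (l * r)) \<le> exp (l * t) / l"
proof -
  have "(LINT r|lborel. exp (l * r) * indicator {0..t} r) = exp (l * t) / l - exp (l * 0) / l"
    by (rule integral_FTC_Icc_real[OF assms(2)])
       (use assms in \<open>auto intro!: derivative_eq_intros continuous_intros\<close>)
  then show ?thesis using assms by (simp add: set_lebesgue_integral_def mult.commute)
qed

lemma (in prob_space) Fubini_Icc:
  fixes G :: "real \<Rightarrow> 'a \<Rightarrow> real"
  assumes [measurable]: "(\<lambda>(r, s). G r s) \<in> borel_measurable (borel \<Otimes>\<^sub>M M)"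
    and b: "\<And>r s. r \<in> {a..b} \<Longrightarrow> s \<in> space M \<Longrightarrow> \<bar>G r s\<bar> \<le> k"
  shows "(LINT s|M. (LINT r:{a..b}|lborel. G r s)) = (LINT r:{a..b}|lborel. (LINT s|M. G r s))"
    and "(\<lambda>s. LINT r:{a..b}|lborel. G r s) \<in> borel_measurable M"
    and "(\<lambda>r. LINT s|M. G r s) \<in> borel_measurable borel"
proof -
  interpret LM: pair_sigma_finite lborel M ..
  have [measurable]: "(\<lambda>(r, s). G r s) \<in> borel_measurable (lborel \<Otimes>\<^sub>M M)" by simp
  show "(\<lambda>s. LINT r:{a..b}|lborel. G r s) \<in> borel_measurable M"
    unfolding set_lebesgue_integral_def by measurable
  show "(\<lambda>r. LINT s|M. G r s) \<in> borel_measurable borel" by measurable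
  have "(LINT s|M. (LINT r|lborel. indicator {a..b} r *\<^sub>R G r s)) = (LINT r|lborel. (LINT s|M. indicator {a..b} r *\<^sub>R G r s))"
  proof (rule LM.Fubini_integral)
    have "integrable (lborel \<Otimes>\<^sub>M M) (\<lambda>p. indicator ({a..b} \<times> space M) p * k :: real)"
      by (intro integrable_mult_left integrable_real_indicator)
         (auto simp: emeasure_pair_measure_Times emeasure_lborel_Icc_eq emeasure_space_1)
    then show "integrable (lborel \<Otimes>\<^sub>M M) (\<lambda>(r, s). indicator {a..b} r *\<^sub>R G r s)"
      by (rule Bochner_Integration.integrable_bound)
         (use b in \<open>auto intro!: AE_I2 simp: space_pair_measure indicator_def intro: order_trans[OF _ abs_ge_self]\<close>)
  qed
  then show "(LINT s|M. (LINT r:{a..b}|lborel. G r s)) = (LINT r:{a..b}|lborel. (LINT s|M. G r s))"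
    by (simp add: set_lebesgue_integral_def)
qed

section \<open>Exponential moments of an additive functional of a mixing process\<close>

text \<open>\<open>X\<close> and its bound are given at all real times, so that joint measurability
  refers to plain \<open>borel\<close>; centring and adaptedness concern nonnegative times.
  \<open>past\<close> and \<open>fut\<close> are abstract, which lets the same estimates serve one
  path and the sum of two.\<close>

locale mixing_process = prob_space M for M :: "'a measure" +
  fixes X :: "real \<Rightarrow> 'a \<Rightarrow> real" and past fut :: "real \<Rightarrow> 'a measure" and K A \<eta> \<epsilon> :: real
  assumes X_meas [measurable]: "(\<lambda>(r, s). X r s) \<in> borel_measurable (borel \<Otimes>\<^sub>M M)"
    and X_bound: "s \<in> space M \<Longrightarrow> \<bar>X r s\<bar> \<le> K"
    and X_centred: "0 \<le> r \<Longrightarrow> (LINT s|M. X r s) = 0"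
    and past: "subalgebra M (past r)" and fut: "subalgebra M (fut r)"
    and X_past: "0 \<le> q \<Longrightarrow> q \<le> r \<Longrightarrow> X q \<in> borel_measurable (past r)"
    and X_fut: "0 \<le> r \<Longrightarrow> r \<le> q \<Longrightarrow> X q \<in> borel_measurable (fut r)"
    and mixing: "0 \<le> q \<Longrightarrow> q \<le> r \<Longrightarrow> S \<in> sets (fut r) \<Longrightarrow> T \<in> sets (past q) \<Longrightarrow>
      \<bar>measure M (S \<inter> T) - measure M S * measure M T\<bar> \<le> A * (decay \<eta> ((r - q) / \<epsilon>))\<^sup>2 * measure M T"
    and eps: "0 < \<epsilon>" "\<epsilon> \<le> 1" and eta: "0 < \<eta>" and A: "0 \<le> A"
begin

definition Z :: "real \<Rightarrow> 'a \<Rightarrow> real" where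
  "Z t s = \<epsilon> powr (- 1 / 2) * (LINT r:{0..t}|lborel. X r s)"

definition F :: "real \<Rightarrow> real" where "F t = (LINT s|M. exp (Z t s))"

definition R :: "real \<Rightarrow> real \<Rightarrow> real" where "R r q = (LINT s|M. X r s * X q s)"

text \<open>The constant of \<open>mixing_covariance\<close> for two factors whose bounds have
  product \<open>K\<^sup>2\<close>; the three covariance bounds below all lead to this
  value.\<close>

definition L :: real where "L = 2 * K\<^sup>2 * A"

abbreviation "\<kappa> \<equiv> \<epsilon> powr (- 1 / 2)"

abbreviation "d h \<equiv> decay \<eta> (h / \<epsilon>)"

lemma K0: "0 \<le> K"
proof -
  obtain s where "s \<in> space M" using not_empty by blast
  then show ?thesis using X_bound[of s 0] by linarith
qed

lemma L0: "0 \<le> L" using A by (simp add: L_def)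

lemma kappa: "0 < \<kappa>" "\<kappa> * \<kappa> = 1 / \<epsilon>"
  using eps by (simp_all flip: powr_add add: powr_minus_divide)

lemma d_bounds: assumes "0 \<le> h" shows "0 < d h" "d h \<le> 1" "h * d h \<le> \<epsilon>"
proof -
  have "0 \<le> h / \<epsilon>" using assms eps by simp
  from decay_bounds[OF eta this] show "0 < d h" "d h \<le> 1" "h * d h \<le> \<epsilon>"
    using eps by (auto simp: field_simps)
qed

lemma d_sq: assumes "0 \<le> h" shows "(d h)\<^sup>2 \<le> d h"
  using d_bounds[OF assms] by (simp add: power2_eq_square mult_le_cancel_left1)

lemma X_measurable [measurable]: "X r \<in> borel_measurable M"
  by measurable

lemma Z_meas [measurable]: "(\<lambda>(r, s). Z r s) \<in> borel_measurable (borel \<Otimes>\<^sub>M M)"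
  unfolding Z_def by measurable

lemma Z_measurable [measurable]: "Z r \<in> borel_measurable M"
  by measurable

lemma X_path: assumes "s \<in> space M" shows "(\<lambda>r. X r s) \<in> borel_measurable borel"
  using assms by measurable

lemma Z_bound: assumes "s \<in> space M" "0 \<le> r" "r \<le> t" shows "\<bar>Z r s\<bar> \<le> \<kappa> * K * t"
proof -
  have "\<bar>LINT q:{0..r}|lborel. X q s\<bar> \<le> K * (r - 0)"
    by (rule abs_set_integral_Icc_bounded) (use assms X_bound in auto)
  also have "\<dots> \<le> K * t" using assms K0 by (intro mult_left_mono) auto
  finally show ?thesis using kappa unfolding Z_def by (simp add: abs_mult mult.assoc)
qed

lemma exp_Z_bound: assumes "s \<in> space M" "0 \<le> r" "r \<le> t" shows "exp (Z r s) \<le> exp (\<kappa> * K * t)"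
  using Z_bound[OF assms] by simp

lemma Z_0: "s \<in> space M \<Longrightarrow> Z 0 s = 0"
  using Z_bound[of s 0 0] by simp

lemma exp_Z_diff:
  assumes s: "s \<in> space M" and t: "0 \<le> p" "p \<le> t"
  shows "exp (Z t s) - exp (Z p s) = \<kappa> * (LINT r:{p..t}|lborel. X r s * exp (Z r s))"
proof -
  have [measurable]: "(\<lambda>r. X r s) \<in> borel_measurable borel" by (rule X_path[OF s])
  have Z_eq: "Z t s = (LINT r:{0..t}|lborel. \<kappa> * X r s)" for t by (simp add: Z_def)
  have "exp (Z t s) - exp (Z p s) = (LINT r:{p..t}|lborel. \<kappa> * X r s * exp (Z r s))"
    unfolding Z_eq by (rule exp_integral_eq[of _ "\<kappa> * K"])
      (use t X_bound[OF s] kappa in \<open>auto simp: abs_mult\<close>)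
  then show ?thesis by (simp add: mult.assoc)
qed

lemma integrable_bdd: "f \<in> borel_measurable M \<Longrightarrow> (\<And>s. s \<in> space M \<Longrightarrow> \<bar>f s\<bar> \<le> b) \<Longrightarrow> integrable M f"
  for f :: "'a \<Rightarrow> real"
  by (rule integrable_const_bound[of _ b]) auto

lemma integrable_exp_Z: assumes "0 \<le> t" shows "integrable M (\<lambda>s. exp (Z t s))"
  by (rule integrable_bdd[of _ "exp (\<kappa> * K * t)"]) (use assms exp_Z_bound[of _ t t] in auto)

lemma integrable_mult_exp_Z:
  assumes "0 \<le> t" "f \<in> borel_measurable M" "\<And>s. s \<in> space M \<Longrightarrow> \<bar>f s\<bar> \<le> b"
  shows "integrable M (\<lambda>s. f s * exp (Z t s))"
  by (rule Bochner_Integration.integrable_bound[OF integrable_mult_right[OF integrable_exp_Z[OF assms(1)], of b]])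
     (use assms in \<open>auto intro!: AE_I2 mult_right_mono intro: order_trans[OF _ abs_ge_self] simp: abs_mult\<close>)

lemma XX_bound: assumes "s \<in> space M" shows "\<bar>X r s * X q s\<bar> \<le> K\<^sup>2"
  using mult_mono[OF X_bound[OF assms, of r] X_bound[OF assms, of q] K0] by (simp add: abs_mult power2_eq_square)

lemma F_bounds: assumes "0 \<le> r" "r \<le> t" shows "0 \<le> F r" "F r \<le> exp (\<kappa> * K * t)"
proof -
  show "0 \<le> F r" unfolding F_def by simp
  have "F r \<le> (LINT s|M. exp (\<kappa> * K * t))" unfolding F_def
    using assms by (intro integral_mono integrable_exp_Z exp_Z_bound) auto
  then show "F r \<le> exp (\<kappa> * K * t)" by (simp add: prob_space)
qed

lemma F_0: "F 0 = 1"
  unfolding F_def by (simp add: Z_0 prob_space cong: Bochner_Integration.integral_cong)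

lemma F_meas [measurable]: "F \<in> borel_measurable borel"
  unfolding F_def[abs_def] by measurable

section \<open>Decoupling the exponential from later values of \<open>X\<close>\<close>

text \<open>\<open>Z q\<close> is replaced by an almost surely equal version that is measurable for
  the past; then \<open>mixing_covariance\<close> applies with the L1 norm of
  \<open>H * exp (Z q)\<close>, which is at most \<open>h * F q\<close>.\<close>

lemma exp_Z_mixing:
  assumes qr: "0 \<le> q" "q \<le> r"
    and Y: "Y \<in> borel_measurable (fut r)" "\<And>s. s \<in> space M \<Longrightarrow> \<bar>Y s\<bar> \<le> b"
    and H: "H \<in> borel_measurable (past q)" "\<And>s. s \<in> space M \<Longrightarrow> \<bar>H s\<bar> \<le> h"
  shows "\<bar>(LINT s|M. Y s * (H s * exp (Z q s))) - (LINT s|M. Y s) * (LINT s|M. H s * exp (Z q s))\<bar>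
    \<le> 2 * b * (A * (d (r - q))\<^sup>2) * (h * F q)"
proof -
  obtain Z' where Z'[measurable]: "Z' \<in> borel_measurable (past q)"
    and Z'_eq: "AE s in M. Z' s = (LINT u:{0..q}|lborel. X u s)"
    using integral_AE_measurable_subalgebra[OF prob_space_axioms past X_meas X_bound, where t=q] X_past qr
    by (metis atLeastAtMost_iff)
  note [measurable] = H(1)
  have [measurable]: "H \<in> borel_measurable M" "Z' \<in> borel_measurable M" "Y \<in> borel_measurable M"
    using measurable_from_subalg past fut H(1) Z' Y(1) by blast+
  define V where "V = (\<lambda>s. H s * exp (\<kappa> * Z' s))"
  have V1: "V \<in> borel_measurable (past q)" unfolding V_def by measurable
  then have [measurable]: "V \<in> borel_measurable M" unfolding V_def by measurable
  have V_eq: "AE s in M. H s * exp (Z q s) = V s"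
    using Z'_eq by eventually_elim (simp add: V_def Z_def)
  have iHZ: "integrable M (\<lambda>s. H s * exp (Z q s))"
    by (rule integrable_mult_exp_Z[OF qr(1) _ H(2)]) auto
  have iV: "integrable M V"
    by (rule iffD1[OF integrable_cong_AE iHZ]) (use V_eq in auto)
  have e: "(LINT s|M. V s) = (LINT s|M. H s * exp (Z q s))"
    "(LINT s|M. Y s * V s) = (LINT s|M. Y s * (H s * exp (Z q s)))"
    "(LINT s|M. \<bar>V s\<bar>) = (LINT s|M. \<bar>H s * exp (Z q s)\<bar>)"
    by (rule integral_cong_AE; use V_eq in \<open>(measurable; fail) | (eventually_elim, simp)\<close>)+
  obtain s0 where s0: "s0 \<in> space M" using not_empty by blast
  then have b0: "0 \<le> b" using Y(2)[OF s0] by linarith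
  have "\<bar>(LINT s|M. Y s * V s) - (LINT s|M. Y s) * (LINT s|M. V s)\<bar>
     \<le> 2 * b * (A * (d (r - q))\<^sup>2) * (LINT s|M. \<bar>V s\<bar>)"
    by (rule mixing_covariance[OF prob_space_axioms fut[of r] past[of q] mixing[OF qr] V1 iV Y])
  also have "(LINT s|M. \<bar>V s\<bar>) \<le> (LINT s|M. h * exp (Z q s))"
    unfolding e(3) using H(2)
    by (intro integral_mono integrable_abs integrable_mult_right iHZ integrable_exp_Z[OF qr(1)])
       (auto simp: abs_mult intro!: mult_right_mono)
  also have "\<dots> = h * F q" by (simp add: F_def)
  finally show ?thesis unfolding e using b0 A by (simp add: mult_left_mono)
qed

text \<open>\<open>X r\<close> is the future variable across the gap \<open>r - q\<close>; its mean
  vanishes, so the product term drops out.\<close>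

lemma cov_exp_bound:
  assumes qr: "0 \<le> q" "q \<le> r"
  shows "\<bar>LINT s|M. X r s * (X q s * exp (Z q s))\<bar> \<le> L * (d (r - q))\<^sup>2 * F q"
  using exp_Z_mixing[OF qr X_fut X_bound X_past X_bound, of r q] qr X_centred[of r]
  by (simp add: L_def power2_eq_square mult_ac)

text \<open>The complementary split: both field values now belong to the future of \<open>q\<close>,
  and the gap \<open>q - p\<close> separates them from the exponential.\<close>

lemma cov_exp_factor:
  assumes pqr: "0 \<le> p" "p \<le> q" "q \<le> r"
  shows "\<bar>(LINT s|M. X r s * X q s * exp (Z p s)) - R r q * F p\<bar> \<le> L * (d (q - p))\<^sup>2 * F p"
proof -
  have [measurable]: "X r \<in> borel_measurable (fut q)" "X q \<in> borel_measurable (fut q)"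
    using X_fut pqr by auto
  have "(\<lambda>s. X r s * X q s) \<in> borel_measurable (fut q)" by measurable
  from exp_Z_mixing[OF pqr(1,2) this XX_bound, of "\<lambda>_. 1" 1]
  show ?thesis by (simp add: L_def R_def F_def mult_ac)
qed

lemma R_bound:
  assumes qr: "0 \<le> q" "q \<le> r"
  shows "\<bar>R r q\<bar> \<le> L * (d (r - q))\<^sup>2"
proof -
  have i: "integrable M (X q)" by (rule integrable_bdd[OF _ X_bound]) auto
  have "\<bar>(LINT s|M. X r s * X q s) - (LINT s|M. X r s) * (LINT s|M. X q s)\<bar>
     \<le> 2 * K * (A * (d (r - q))\<^sup>2) * (LINT s|M. \<bar>X q s\<bar>)"
    by (rule mixing_covariance[OF prob_space_axioms fut[of r] past[of q] mixing[OF qr] X_past i X_fut X_bound]) (use qr in auto)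
  also have "\<dots> \<le> 2 * K * (A * (d (r - q))\<^sup>2) * K"
  proof (rule mult_left_mono)
    have "(LINT s|M. \<bar>X q s\<bar>) \<le> (LINT s|M. K)" using i X_bound by (intro integral_mono) auto
    then show "(LINT s|M. \<bar>X q s\<bar>) \<le> K" by (simp add: prob_space)
  qed (use K0 A in auto)
  finally show ?thesis using X_centred[of r] qr
    by (simp add: R_def L_def power2_eq_square mult_ac)
qed

lemma R_meas [measurable]: "(\<lambda>(r, q). R r q) \<in> borel_measurable (borel \<Otimes>\<^sub>M borel)"
  unfolding R_def by measurable

section \<open>Second-order expansion of \<open>F\<close> in time\<close>

definition U :: "real \<Rightarrow> real \<Rightarrow> real" where "U r q = (LINT s|M. X r s * (X q s * exp (Z q s)))"

lemma U_meas [measurable]: "(\<lambda>(r, q). U r q) \<in> borel_measurable (borel \<Otimes>\<^sub>M borel)"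
  unfolding U_def by measurable

text \<open>The derivative of \<open>F\<close>, in the integrated sense of \<open>F_eq\<close>;
  \<open>D\<close> below is the same average without the exponential weight.\<close>

definition G :: "real \<Rightarrow> real" where "G r = (LINT q:{0..r}|lborel. U r q) / \<epsilon>"

definition D :: "real \<Rightarrow> real" where "D r = (LINT q:{0..r}|lborel. R r q) / \<epsilon>"

lemma G_meas [measurable]: "G \<in> borel_measurable borel"
  unfolding G_def[abs_def] by measurable

lemma D_meas [measurable]: "D \<in> borel_measurable borel"
  unfolding D_def[abs_def] by measurable

lemma F_diff:
  assumes "0 \<le> p" "p \<le> t"
  shows "F t - F p = \<kappa> * (LINT r:{p..t}|lborel. (LINT s|M. X r s * exp (Z r s)))"
proof -
  have "F t - F p = (LINT s|M. exp (Z t s) - exp (Z p s))"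
    unfolding F_def using assms by (subst Bochner_Integration.integral_diff) (auto intro!: integrable_exp_Z)
  also have "\<dots> = \<kappa> * (LINT s|M. (LINT r:{p..t}|lborel. X r s * exp (Z r s)))"
    using assms by (simp add: exp_Z_diff cong: Bochner_Integration.integral_cong)
  also have "(LINT s|M. (LINT r:{p..t}|lborel. X r s * exp (Z r s))) = (LINT r:{p..t}|lborel. (LINT s|M. X r s * exp (Z r s)))"
    by (rule Fubini_Icc(1)[where k="K * exp (\<kappa> * K * t)"])
       (use assms X_bound exp_Z_bound K0 in \<open>auto simp: abs_mult intro!: mult_mono\<close>)
  finally show ?thesis .
qed

text \<open>A second use of \<open>exp_Z_diff\<close>, now from time 0: the constant term 1 is
  killed by the centring of \<open>X r\<close>, and the two factors \<kappa> combine to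
  1/\<epsilon>.\<close>

lemma EX_exp:
  assumes "0 \<le> r"
  shows "\<kappa> * (LINT s|M. X r s * exp (Z r s)) = G r"
proof -
  have b: "\<bar>X r s * (X q s * exp (Z q s))\<bar> \<le> K * (K * exp (\<kappa> * K * r))" if "s \<in> space M" "q \<in> {0..r}" for s q
    using that X_bound exp_Z_bound[of s q r] K0 by (auto simp: abs_mult intro!: mult_mono)
  have "(LINT s|M. X r s * exp (Z r s)) = (LINT s|M. X r s + \<kappa> * (LINT q:{0..r}|lborel. X r s * (X q s * exp (Z q s))))"
  proof (rule Bochner_Integration.integral_cong[OF refl])
    fix s assume s: "s \<in> space M"
    have "exp (Z r s) = 1 + \<kappa> * (LINT q:{0..r}|lborel. X q s * exp (Z q s))"
      using exp_Z_diff[OF s order_refl assms] Z_0[OF s] by simp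
    then show "X r s * exp (Z r s) = X r s + \<kappa> * (LINT q:{0..r}|lborel. X r s * (X q s * exp (Z q s)))"
      by (simp only: distrib_left mult_1_right set_integral_mult_right mult.left_commute[of "X r s" \<kappa>])
  qed
  also have "\<dots> = (LINT s|M. X r s) + \<kappa> * (LINT s|M. (LINT q:{0..r}|lborel. X r s * (X q s * exp (Z q s))))"
  proof (subst Bochner_Integration.integral_add)
    show "integrable M (X r)" by (rule integrable_bdd[OF _ X_bound]) auto
    have "integrable M (\<lambda>s. LINT q:{0..r}|lborel. X r s * (X q s * exp (Z q s)))"
    proof (rule integrable_bdd[where b="K * (K * exp (\<kappa> * K * r)) * (r - 0)"])
      show "(\<lambda>s. LINT q:{0..r}|lborel. X r s * (X q s * exp (Z q s))) \<in> borel_measurable M"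
        by (rule Fubini_Icc(2)[where k="K * (K * exp (\<kappa> * K * r))"]) (use b in auto)
    qed (rule abs_set_integral_Icc_bounded, use b assms in auto)
    then show "integrable M (\<lambda>s. \<kappa> * (LINT q:{0..r}|lborel. X r s * (X q s * exp (Z q s))))" by simp
  qed simp
  also have "(LINT s|M. (LINT q:{0..r}|lborel. X r s * (X q s * exp (Z q s)))) = (LINT q:{0..r}|lborel. U r q)"
    unfolding U_def by (rule Fubini_Icc(1)[where k="K * (K * exp (\<kappa> * K * r))"]) (use b in auto)
  finally have "(LINT s|M. X r s * exp (Z r s)) = \<kappa> * (LINT q:{0..r}|lborel. U r q)"
    using X_centred[OF assms] by simp
  then have "\<kappa> * (LINT s|M. X r s * exp (Z r s)) = \<kappa> * \<kappa> * (LINT q:{0..r}|lborel. U r q)"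
    by (simp only: mult.assoc)
  also have "\<dots> = G r" unfolding kappa(2) G_def by simp
  finally show ?thesis .
qed

lemma F_eq:
  assumes "0 \<le> t"
  shows "F t = 1 + (LINT r:{0..t}|lborel. G r)"
proof -
  have "F t - F 0 = (LINT r:{0..t}|lborel. \<kappa> * (LINT s|M. X r s * exp (Z r s)))"
    using F_diff[of 0 t] assms by simp
  also have "\<dots> = (LINT r:{0..t}|lborel. G r)"
    by (rule set_lebesgue_integral_cong) (use EX_exp in auto)
  finally show ?thesis by (simp add: F_0)
qed

lemma d_integrable: "set_integrable lborel {0..r} (\<lambda>q. d (r - q))"
proof (rule set_integrable_Icc_bounded[where K=1])
  fix q assume "q \<in> {0..r}"
  then show "\<bar>d (r - q)\<bar> \<le> 1" using d_bounds[of "r - q"] by simp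
qed measurable

text \<open>The factor 1/\<epsilon> is compensated by the integral of the decay, which is
  concentrated on lags of order \<epsilon>, so the bound is free of \<epsilon>.\<close>

lemma averaged_bound:
  assumes "0 \<le> r" "0 \<le> c" "\<And>q. q \<in> {0..r} \<Longrightarrow> \<bar>f q\<bar> \<le> c * d (r - q)"
  shows "\<bar>(LINT q:{0..r}|lborel. f q) / \<epsilon>\<bar> \<le> c / \<eta>"
proof -
  have "\<bar>LINT q:{0..r}|lborel. f q\<bar> \<le> (LINT q:{0..r}|lborel. c * d (r - q))"
    by (rule abs_set_integral_le) (use assms d_integrable in auto)
  also have "\<dots> = c * (LINT q:{0..r}|lborel. d (r - q))" by simp
  also have "\<dots> \<le> c * (\<epsilon> / \<eta>)"
    using decay_integral[OF eta eps(1) assms(1)] assms(2) by (rule mult_left_mono)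
  finally show ?thesis using eps by (simp add: divide_le_eq)
qed

section \<open>Bounds on \<open>F\<close> uniform in \<epsilon>\<close>

text \<open>The growth rate is chosen so that \<open>L / \<eta> / \<mu> \<le> 1 / 2\<close>, as the
  halving in \<open>weighted_sup_bound\<close> requires; the summand 1 keeps it positive when
  \<open>L = 0\<close>.\<close>

definition \<mu> :: real where "\<mu> = 2 * L / \<eta> + 1"

lemma F_exp_bound:
  assumes t: "0 \<le> t"
  shows "F t \<le> 2 * exp (\<mu> * t)"
proof -
  have mu: "0 < \<mu>" "L / \<eta> / \<mu> \<le> 1 / 2" using L0 eta by (auto simp: \<mu>_def field_simps add_pos_nonneg)
  have "F t \<le> 2 * 1 * exp (\<mu> * t)"
  proof (rule weighted_sup_bound[where t=t])
    show "0 \<le> F r" "F r \<le> exp (\<kappa> * K * t)" if "r \<in> {0..t}" for r using F_bounds[of r t] that by auto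
    fix r N assume r: "r \<in> {0..t}" and N: "0 \<le> N" and IH: "\<And>q. q \<in> {0..r} \<Longrightarrow> F q \<le> N * exp (\<mu> * q)"
    \<comment> \<open>The assumed bound on \<open>F\<close> is frozen at the later time
      \<open>u\<close>, which leaves only the decay to be averaged over \<open>q\<close>.\<close>
    have G: "\<bar>G u\<bar> \<le> L / \<eta> * N * exp (\<mu> * u)" if u: "u \<in> {0..r}" for u
    proof -
      have "\<bar>G u\<bar> \<le> (L * N * exp (\<mu> * u)) / \<eta>"
        unfolding G_def
      proof (rule averaged_bound)
        fix q assume q: "q \<in> {0..u}"
        have "\<bar>U u q\<bar> \<le> L * (d (u - q))\<^sup>2 * F q" unfolding U_def using q by (intro cov_exp_bound) auto
        also have "\<dots> \<le> L * d (u - q) * (N * exp (\<mu> * u))"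
        proof (intro mult_mono)
          show "(d (u - q))\<^sup>2 \<le> d (u - q)" using d_sq q by simp
          have "F q \<le> N * exp (\<mu> * q)" using IH q u by simp
          also have "\<dots> \<le> N * exp (\<mu> * u)" using q N mu by (intro mult_left_mono) auto
          finally show "F q \<le> N * exp (\<mu> * u)" .
        qed (use L0 d_bounds(1)[of "u - q"] q F_bounds[of q q] in auto)
        finally show "\<bar>U u q\<bar> \<le> L * N * exp (\<mu> * u) * d (u - q)" by (simp add: mult_ac)
      qed (use u L0 N in auto)
      then show ?thesis by simp
    qed
    have "F r \<le> 1 + \<bar>LINT u:{0..r}|lborel. G u\<bar>" using F_eq[of r] r by simp
    also have "\<bar>LINT u:{0..r}|lborel. G u\<bar> \<le> (LINT u:{0..r}|lborel. L / \<eta> * N * exp (\<mu> * u))"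
      by (rule abs_set_integral_le)
         (use G eta in \<open>auto intro!: borel_integrable_atLeastAtMost' continuous_intros\<close>)
    also have "\<dots> = L / \<eta> * N * (LINT u:{0..r}|lborel. exp (\<mu> * u))" by (simp add: mult.assoc)
    also have "\<dots> \<le> L / \<eta> * N * (exp (\<mu> * r) / \<mu>)"
      using exp_integral_le[OF mu(1), of r] r L0 N eta by (intro mult_left_mono) auto
    also have "\<dots> = (L / \<eta> / \<mu>) * (N * exp (\<mu> * r))" by simp
    also have "\<dots> \<le> 1 / 2 * (N * exp (\<mu> * r))" using mu N by (intro mult_right_mono) auto
    finally show "F r \<le> 1 + N / 2 * exp (\<mu> * r)" by simp
  qed (use t mu in auto)
  then show ?thesis by simp
qed

lemma F_le:
  assumes "0 \<le> r" "r \<le> t"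
  shows "F r \<le> 2 * exp (\<mu> * t)"
proof -
  have "0 < \<mu>" using L0 eta by (auto simp: \<mu>_def add_nonneg_pos)
  then have "2 * exp (\<mu> * r) \<le> 2 * exp (\<mu> * t)" using assms by simp
  then show ?thesis using F_exp_bound[OF assms(1)] by linarith
qed

lemma U_bound:
  assumes "q \<in> {0..r}" "r \<le> t"
  shows "\<bar>U r q\<bar> \<le> L * (2 * exp (\<mu> * t)) * d (r - q)"
proof -
  have "\<bar>U r q\<bar> \<le> L * (d (r - q))\<^sup>2 * F q" unfolding U_def using assms by (intro cov_exp_bound) auto
  also have "\<dots> \<le> L * d (r - q) * (2 * exp (\<mu> * t))"
    using d_sq[of "r - q"] F_le[of q t] L0 d_bounds(1)[of "r - q"] F_bounds[of q q] assms
    by (intro mult_mono) auto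
  finally show ?thesis by (simp add: mult_ac)
qed

section \<open>The approximate linear equation for \<open>F\<close>\<close>

text \<open>The time derivative of \<open>exp Z\<close> carries the factor \<kappa>, so in L1 the
  exponential is stable only over lags much shorter than \<epsilon>^(1/2).\<close>

lemma F_increment:
  assumes "0 \<le> p" "p \<le> q" "q \<le> t"
  shows "(LINT s|M. \<bar>exp (Z q s) - exp (Z p s)\<bar>) \<le> \<kappa> * K * (2 * exp (\<mu> * t)) * (q - p)"
proof -
  have "(LINT s|M. \<bar>exp (Z q s) - exp (Z p s)\<bar>) \<le> (LINT s|M. \<kappa> * K * (LINT r:{p..q}|lborel. exp (Z r s)))"
  proof (intro integral_mono)
    show "integrable M (\<lambda>s. \<bar>exp (Z q s) - exp (Z p s)\<bar>)"
      using assms by (intro integrable_abs Bochner_Integration.integrable_diff integrable_exp_Z) auto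
    have "integrable M (\<lambda>s. LINT r:{p..q}|lborel. exp (Z r s))"
    proof (rule integrable_bdd[where b="exp (\<kappa> * K * q) * (q - p)"])
      show "(\<lambda>s. LINT r:{p..q}|lborel. exp (Z r s)) \<in> borel_measurable M"
        by (rule Fubini_Icc(2)[where k="exp (\<kappa> * K * q)"]) (use assms exp_Z_bound in auto)
    qed (rule abs_set_integral_Icc_bounded, use assms exp_Z_bound in auto)
    then show "integrable M (\<lambda>s. \<kappa> * K * (LINT r:{p..q}|lborel. exp (Z r s)))" by simp
    fix s assume s: "s \<in> space M"
    have [measurable]: "(\<lambda>r. X r s) \<in> borel_measurable borel" "(\<lambda>r. Z r s) \<in> borel_measurable borel"
      using s by measurable
    have "\<bar>LINT r:{p..q}|lborel. X r s * exp (Z r s)\<bar> \<le> (LINT r:{p..q}|lborel. K * exp (Z r s))"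
    proof (rule abs_set_integral_le)
      show "set_integrable lborel {p..q} (\<lambda>r. K * exp (Z r s))"
        using assms exp_Z_bound[OF s] K0
        by (intro set_integrable_mult_right set_integrable_Icc_bounded[where K="exp (\<kappa> * K * q)"]) auto
    qed (use X_bound[OF s] in \<open>auto simp: abs_mult intro!: mult_right_mono\<close>)
    then show "\<bar>exp (Z q s) - exp (Z p s)\<bar> \<le> \<kappa> * K * (LINT r:{p..q}|lborel. exp (Z r s))"
      using kappa(1) by (simp add: exp_Z_diff[OF s assms(1,2)] abs_mult mult.assoc mult_left_mono)
  qed
  also have "\<dots> = \<kappa> * K * (LINT s|M. (LINT r:{p..q}|lborel. exp (Z r s)))" by simp
  also have "(LINT s|M. (LINT r:{p..q}|lborel. exp (Z r s))) = (LINT r:{p..q}|lborel. F r)"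
    unfolding F_def by (rule Fubini_Icc(1)[where k="exp (\<kappa> * K * q)"]) (use assms exp_Z_bound in auto)
  finally have "(LINT s|M. \<bar>exp (Z q s) - exp (Z p s)\<bar>) \<le> \<kappa> * K * (LINT r:{p..q}|lborel. F r)" .
  also have "\<kappa> * K * (LINT r:{p..q}|lborel. F r) \<le> \<kappa> * K * (2 * exp (\<mu> * t) * (q - p))"
  proof (rule mult_left_mono)
    have "\<bar>LINT r:{p..q}|lborel. F r\<bar> \<le> 2 * exp (\<mu> * t) * (q - p)"
  proof (rule abs_set_integral_Icc_bounded[OF assms(2)])
    fix r assume r: "r \<in> {p..q}"
    then show "\<bar>F r\<bar> \<le> 2 * exp (\<mu> * t)" using F_le[of r t] F_bounds[of r r] assms by auto
    qed
    then show "(LINT r:{p..q}|lborel. F r) \<le> 2 * exp (\<mu> * t) * (q - p)" by linarith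
  qed (use kappa K0 in auto)
  finally show ?thesis by (simp add: mult.assoc)
qed

lemma F_lipschitz:
  assumes "0 \<le> p" "p \<le> q" "q \<le> t"
  shows "\<bar>F q - F p\<bar> \<le> \<kappa> * K * (2 * exp (\<mu> * t)) * (q - p)"
proof -
  have "F q - F p = (LINT s|M. exp (Z q s) - exp (Z p s))"
    unfolding F_def using assms by (subst Bochner_Integration.integral_diff) (auto intro!: integrable_exp_Z)
  then have "\<bar>F q - F p\<bar> \<le> (LINT s|M. \<bar>exp (Z q s) - exp (Z p s)\<bar>)" by (simp only: integral_abs_bound)
  then show ?thesis using F_increment[OF assms] by linarith
qed

text \<open>The lag \<open>m = \<epsilon> powr (3/4)\<close> is long on the correlation scale \<open>\<epsilon>\<close>, yet \<open>Z\<close> changes only by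
  \<open>\<epsilon> powr (-1/2) * m\<close> over it. The geometric mean of this bound with the trivial one remains
  integrable in \<open>r - q\<close>.\<close>

lemma U_factor:
  assumes qr: "0 \<le> q" "q \<le> r" "r \<le> t"
  shows "\<bar>U r q - R r q * F q\<bar> \<le> (2 * L + 2 * K ^ 3) * \<epsilon> powr (1 / 8) * (2 * exp (\<mu> * t)) * d (r - q)"
proof -
  define m where "m = \<epsilon> powr (3 / 4)"
  define Fm where "Fm = 2 * exp (\<mu> * t)"
  define \<theta> where "\<theta> = \<epsilon> powr (1 / 4)"
  have Fm: "F r \<le> Fm" "0 \<le> F r" if "0 \<le> r" "r \<le> t" for r
    unfolding Fm_def using F_le[OF that] F_bounds[of r r] that by auto
  have m: "0 < m" "\<kappa> * m = \<theta>" using eps by (auto simp: m_def \<theta>_def simp flip: powr_add)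
  \<comment> \<open>Since \<epsilon> = \<open>m * \<theta>\<close>, the bound
    \<open>h * d h \<le> \<epsilon>\<close> at \<open>h = m\<close> yields
    \<open>d m \<le> \<theta>\<close>.\<close>
  have dm: "(d m)\<^sup>2 \<le> \<theta>"
  proof -
    have "m * d m \<le> m * \<theta>"
      using d_bounds(3)[of m] m eps by (simp add: m_def \<theta>_def flip: powr_add)
    then show ?thesis using d_sq[of m] m by simp
  qed
  have Fm0: "0 \<le> Fm" by (simp add: Fm_def)
  have th0: "0 \<le> \<theta>" by (simp add: \<theta>_def)
  \<comment> \<open>Both terms are small separately across the gap \<open>r - q\<close>: this bound
    has the full decay but no small factor.\<close>
  have 1: "\<bar>U r q - R r q * F q\<bar> \<le> 2 * L * (d (r - q))\<^sup>2 * Fm"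
  proof -
    have "\<bar>U r q\<bar> \<le> L * (d (r - q))\<^sup>2 * F q" unfolding U_def using qr by (intro cov_exp_bound) auto
    moreover have "\<bar>R r q * F q\<bar> \<le> L * (d (r - q))\<^sup>2 * F q"
      unfolding abs_mult using R_bound[of q r] Fm[of q] qr by (intro mult_mono) auto
    moreover have "L * (d (r - q))\<^sup>2 * F q \<le> L * (d (r - q))\<^sup>2 * Fm"
      using Fm[of q] qr L0 by (intro mult_left_mono) auto
    ultimately show ?thesis by linarith
  qed
  \<comment> \<open>This bound has the small factor \<theta> but no decay: the exponential is moved
    back from \<open>q\<close> to \<open>p\<close>, decoupled there, and \<open>F p\<close> is moved
    forward again to \<open>F q\<close>.\<close>
  have 2: "\<bar>U r q - R r q * F q\<bar> \<le> (L + 2 * K ^ 3) * \<theta> * Fm"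
  proof -
    \<comment> \<open>Near time 0 the lag is cut off at \<open>p = 0\<close>, where the exponential
      is 1 and the factorization is exact.\<close>
    define p where "p = max 0 (q - m)"
    have p: "0 \<le> p" "p \<le> q" "q - p \<le> m" using qr m by (auto simp: p_def)
    have inc: "\<kappa> * K * Fm * (q - p) \<le> K * \<theta> * Fm"
    proof -
      have "\<kappa> * K * Fm * (q - p) \<le> \<kappa> * K * Fm * m" using p kappa K0 Fm0 by (intro mult_left_mono) auto
      also have "\<dots> = K * (\<kappa> * m) * Fm" by simp
      finally show ?thesis using m by simp
    qed
    have iq: "integrable M (\<lambda>s. X r s * X q s * exp (Z u s))" if "0 \<le> u" for u
      by (rule integrable_mult_exp_Z[OF that _ XX_bound]) auto
    have "U r q - (LINT s|M. X r s * X q s * exp (Z p s)) = (LINT s|M. X r s * X q s * exp (Z q s) - X r s * X q s * exp (Z p s))"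
      unfolding U_def using iq[of q] iq[of p] qr p by (subst Bochner_Integration.integral_diff) (auto simp: mult.assoc)
    then have "\<bar>U r q - (LINT s|M. X r s * X q s * exp (Z p s))\<bar>
        = \<bar>LINT s|M. X r s * X q s * exp (Z q s) - X r s * X q s * exp (Z p s)\<bar>" by (rule arg_cong)
    also have "\<dots> \<le> (LINT s|M. K\<^sup>2 * \<bar>exp (Z q s) - exp (Z p s)\<bar>)"
    proof (rule abs_integral_le)
      show "integrable M (\<lambda>s. K\<^sup>2 * \<bar>exp (Z q s) - exp (Z p s)\<bar>)"
        using qr p by (intro integrable_mult_right integrable_abs Bochner_Integration.integrable_diff integrable_exp_Z) auto
      fix s assume "s \<in> space M"
      then show "\<bar>X r s * X q s * exp (Z q s) - X r s * X q s * exp (Z p s)\<bar> \<le> K\<^sup>2 * \<bar>exp (Z q s) - exp (Z p s)\<bar>"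
        using XX_bound[of s r q] by (auto simp: abs_mult mult_right_mono simp flip: right_diff_distrib)
    qed
    also have "\<dots> = K\<^sup>2 * (LINT s|M. \<bar>exp (Z q s) - exp (Z p s)\<bar>)" by simp
    also have "\<dots> \<le> K\<^sup>2 * (K * \<theta> * Fm)"
      using order_trans[OF F_increment[of p q t] inc[unfolded Fm_def]] p qr
      by (intro mult_left_mono) (auto simp: Fm_def)
    finally have a: "\<bar>U r q - (LINT s|M. X r s * X q s * exp (Z p s))\<bar> \<le> K ^ 3 * \<theta> * Fm"
      by (simp add: power2_eq_square power3_eq_cube mult.assoc)
    have b: "\<bar>(LINT s|M. X r s * X q s * exp (Z p s)) - R r q * F p\<bar> \<le> L * \<theta> * Fm"
    proof (cases "m \<le> q")
      case True
      then have qp: "q - p = m" by (simp add: p_def)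
      have "\<bar>(LINT s|M. X r s * X q s * exp (Z p s)) - R r q * F p\<bar> \<le> L * (d m)\<^sup>2 * F p"
        using cov_exp_factor[OF p(1,2) qr(2)] by (simp add: qp)
      also have "\<dots> \<le> L * \<theta> * Fm" using dm L0 Fm[of p] p qr th0 by (intro mult_mono mult_left_mono) auto
      finally show ?thesis .
    next
      case False
      then have "p = 0" by (simp add: p_def)
      then have "(LINT s|M. X r s * X q s * exp (Z p s)) = R r q * F p"
        by (simp add: F_0 R_def Z_0 cong: Bochner_Integration.integral_cong)
      then show ?thesis using L0 th0 Fm0 by simp
    qed
    have c: "\<bar>R r q * F p - R r q * F q\<bar> \<le> K ^ 3 * \<theta> * Fm"
    proof -
      have "\<bar>R r q\<bar> \<le> (LINT s|M. K\<^sup>2)" unfolding R_def by (rule abs_integral_le) (use XX_bound in auto)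
      then have "\<bar>R r q\<bar> * \<bar>F p - F q\<bar> \<le> K\<^sup>2 * (K * \<theta> * Fm)"
        using order_trans[OF F_lipschitz[of p q t] inc[unfolded Fm_def]] p qr
        by (intro mult_mono) (auto simp: prob_space Fm_def abs_minus_commute)
      then show ?thesis by (simp add: abs_mult power2_eq_square power3_eq_cube mult.assoc flip: right_diff_distrib)
    qed
    show ?thesis using a b c by (simp add: algebra_simps)
  qed
  \<comment> \<open>Multiplying the two bounds and taking the root keeps one factor
    \<open>d (r - q)\<close> and leaves \<theta>^(1/2) = \<epsilon>^(1/8).\<close>
  have "\<bar>U r q - R r q * F q\<bar>\<^sup>2 \<le> (2 * L * (d (r - q))\<^sup>2 * Fm) * ((L + 2 * K ^ 3) * \<theta> * Fm)"
    unfolding power2_eq_square[of "\<bar>_\<bar>"] using 1 2 Fm0 L0 by (intro mult_mono) auto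
  also have "\<dots> = 2 * L * (L + 2 * K ^ 3) * (\<theta> * (d (r - q))\<^sup>2 * Fm\<^sup>2)" by (simp add: power2_eq_square)
  also have "\<dots> \<le> (2 * L + 2 * K ^ 3)\<^sup>2 * (\<theta> * (d (r - q))\<^sup>2 * Fm\<^sup>2)"
  proof (intro mult_right_mono)
    have "(2 * L + 2 * K ^ 3)\<^sup>2 - 2 * L * (L + 2 * K ^ 3) = 2 * L\<^sup>2 + 4 * L * K ^ 3 + 4 * (K ^ 3)\<^sup>2"
      by (simp add: power2_eq_square algebra_simps)
    also have "\<dots> \<ge> 0" using L0 K0 by simp
    finally show "2 * L * (L + 2 * K ^ 3) \<le> (2 * L + 2 * K ^ 3)\<^sup>2" by simp
  qed (use th0 in auto)
  also have "\<theta> = (\<epsilon> powr (1 / 8))\<^sup>2" by (simp add: \<theta>_def power2_eq_square flip: powr_add)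
  finally have "\<bar>U r q - R r q * F q\<bar>\<^sup>2 \<le> ((2 * L + 2 * K ^ 3) * \<epsilon> powr (1 / 8) * Fm * d (r - q))\<^sup>2"
    by (simp add: power_mult_distrib mult_ac)
  then show ?thesis unfolding Fm_def[symmetric]
    by (rule power2_le_imp_le) (use L0 K0 Fm0 d_bounds(1)[of "r - q"] qr in auto)
qed

text \<open>The first two summands come from \<open>U_factor\<close>, the third from replacing
  \<open>F q\<close> by \<open>F r\<close> in \<open>G_approx\<close>; the division by \<eta> is the
  time average.\<close>

definition c\<^sub>0 :: real where "c\<^sub>0 = (2 * L + 2 * K ^ 3 + L * K) / \<eta>"

lemma G_approx:
  assumes r: "0 \<le> r" "r \<le> t"
  shows "\<bar>G r - D r * F r\<bar> \<le> c\<^sub>0 * \<epsilon> powr (1 / 8) * (2 * exp (\<mu> * t))"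
proof -
  define Fm where "Fm = 2 * exp (\<mu> * t)"
  have Fm0: "0 \<le> Fm" by (simp add: Fm_def)
  have ke: "\<kappa> * \<epsilon> \<le> \<epsilon> powr (1 / 8)"
  proof -
    have "\<kappa> * \<epsilon> = \<epsilon> powr (- 1 / 2) * \<epsilon> powr 1" using eps by simp
    also have "\<dots> = \<epsilon> powr (1 / 2)" by (subst powr_add[symmetric]) simp
    also have "\<dots> \<le> \<epsilon> powr (1 / 8)" using eps by (intro powr_mono') auto
    finally show ?thesis .
  qed
  have iU: "set_integrable lborel {0..r} (\<lambda>q. U r q)"
  proof (rule set_integrable_Icc_bounded[where K="L * (2 * exp (\<mu> * r))"])
    fix q assume q: "q \<in> {0..r}"
    have "L * (2 * exp (\<mu> * r)) * d (r - q) \<le> L * (2 * exp (\<mu> * r)) * 1"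
      using d_bounds(2)[of "r - q"] q L0 by (intro mult_left_mono) auto
    then show "\<bar>U r q\<bar> \<le> L * (2 * exp (\<mu> * r))" using U_bound[OF q order_refl] by linarith
  qed measurable
  have iR: "set_integrable lborel {0..r} (\<lambda>q. R r q)"
  proof (rule set_integrable_Icc_bounded[where K="K\<^sup>2"])
    fix q
    have "\<bar>R r q\<bar> \<le> (LINT s|M. K\<^sup>2)" unfolding R_def by (rule abs_integral_le) (use XX_bound in auto)
    then show "\<bar>R r q\<bar> \<le> K\<^sup>2" by (simp add: prob_space)
  qed measurable
  have "G r - D r * F r = (LINT q:{0..r}|lborel. U r q - R r q * F r) / \<epsilon>"
    unfolding G_def D_def using iU iR by (subst set_integral_diff(2)) (auto simp: diff_divide_distrib)
  then have "\<bar>G r - D r * F r\<bar> = \<bar>(LINT q:{0..r}|lborel. U r q - R r q * F r) / \<epsilon>\<bar>" by (rule arg_cong)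
  also have "\<dots> \<le> ((2 * L + 2 * K ^ 3 + L * K) * \<epsilon> powr (1 / 8) * Fm) / \<eta>"
  proof (rule averaged_bound[OF r(1)])
    fix q assume q: "q \<in> {0..r}"
    \<comment> \<open>The Lipschitz constant of \<open>F\<close> contains \<kappa>, but one of the
      two decay factors absorbs the lag, \<open>(r - q) * d (r - q) \<le> \<epsilon>\<close>, and
      \<open>\<kappa> * \<epsilon>\<close> is small.\<close>
    have "\<bar>R r q * (F q - F r)\<bar> \<le> (L * (d (r - q))\<^sup>2) * (\<kappa> * K * Fm * (r - q))"
      unfolding abs_mult Fm_def using q r F_lipschitz[of q r t] R_bound[of q r]
      by (intro mult_mono) (auto simp: abs_minus_commute)
    also have "\<dots> = L * K * Fm * d (r - q) * (\<kappa> * ((r - q) * d (r - q)))" by (simp add: power2_eq_square)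
    also have "\<dots> \<le> L * K * Fm * d (r - q) * (\<kappa> * \<epsilon>)"
      using d_bounds[of "r - q"] q L0 K0 Fm0 kappa by (intro mult_left_mono) auto
    also have "\<dots> \<le> L * K * Fm * d (r - q) * \<epsilon> powr (1 / 8)"
      using d_bounds[of "r - q"] q L0 K0 Fm0 ke by (intro mult_left_mono) auto
    finally have "\<bar>R r q * (F q - F r)\<bar> \<le> L * K * Fm * d (r - q) * \<epsilon> powr (1 / 8)" .
    moreover have "\<bar>U r q - R r q * F q\<bar> \<le> (2 * L + 2 * K ^ 3) * \<epsilon> powr (1 / 8) * Fm * d (r - q)"
      unfolding Fm_def using q r by (intro U_factor) auto
    ultimately show "\<bar>U r q - R r q * F r\<bar> \<le> (2 * L + 2 * K ^ 3 + L * K) * \<epsilon> powr (1 / 8) * Fm * d (r - q)"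
      by (simp add: algebra_simps)
  qed (use L0 K0 Fm0 in auto)
  finally show ?thesis by (simp add: c\<^sub>0_def Fm_def)
qed

lemma D_bound: assumes "0 \<le> r" shows "\<bar>D r\<bar> \<le> L / \<eta>"
  unfolding D_def
proof (rule averaged_bound[OF assms L0])
  fix q assume "q \<in> {0..r}"
  then show "\<bar>R r q\<bar> \<le> L * d (r - q)"
    using R_bound[of q r] mult_left_mono[OF d_sq[of "r - q"] L0] by auto
qed

lemma G_bound: assumes "r \<in> {0..t}" shows "\<bar>G r\<bar> \<le> L / \<eta> * (2 * exp (\<mu> * t))"
  using averaged_bound[of r "L * (2 * exp (\<mu> * t))" "U r"] U_bound[of _ r t] assms L0 by (simp add: G_def)

text \<open>Gronwall for the distance between \<open>F\<close> and the solution of y' = \<sigma> y.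
  Closeness of \<open>D\<close> to \<sigma> enters as a time average only: at times \<open>r\<close>
  of order \<epsilon> the integral defining \<open>D r\<close> has not yet seen all lags, and along
  a random path only an average of the deviation will be small.\<close>

theorem F_approx:
  assumes t: "0 \<le> t"
  shows "\<bar>F t - exp (\<sigma> * t)\<bar> \<le> 4 * exp ((\<mu> + 2 * \<bar>\<sigma>\<bar> + 1) * t) *
    (c\<^sub>0 * t * \<epsilon> powr (1 / 8) + (LINT r:{0..t}|lborel. \<bar>D r - \<sigma>\<bar>))"
proof -
  define Fm where "Fm = 2 * exp (\<mu> * t)"
  have Fm0: "0 \<le> Fm" by (simp add: Fm_def)
  have Fm: "F r \<le> Fm" "0 \<le> F r" if "0 \<le> r" "r \<le> t" for r
    unfolding Fm_def using F_le[OF that] F_bounds[of r r] that by auto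
  define h where "h = (\<lambda>r. \<bar>F r - exp (\<sigma> * r)\<bar>)"
  define e where "e = c\<^sub>0 * \<epsilon> powr (1 / 8) * Fm"
  \<comment> \<open>Makes \<open>\<bar>\<sigma>\<bar> / l \<le> 1 / 2\<close>, so that the feedback
    of \<open>h\<close> is halved in the weighted norm.\<close>
  define l where "l = 2 * \<bar>\<sigma>\<bar> + 1"
  have l: "0 < l" "\<bar>\<sigma>\<bar> / l \<le> 1 / 2" by (auto simp: l_def field_simps)
  have e0: "0 \<le> e" unfolding e_def c\<^sub>0_def using L0 K0 eta Fm0 by simp
  have iD: "set_integrable lborel {0..r} (\<lambda>r. \<bar>D r - \<sigma>\<bar>)" for r
  proof (rule set_integrable_Icc_bounded[where K="L / \<eta> + \<bar>\<sigma>\<bar>"])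
    fix u assume "u \<in> {0..r}"
    then show "\<bar>\<bar>D u - \<sigma>\<bar>\<bar> \<le> L / \<eta> + \<bar>\<sigma>\<bar>" using D_bound[of u] by auto
  qed measurable
  have "h t \<le> 2 * (e * t + (LINT r:{0..t}|lborel. \<bar>D r - \<sigma>\<bar>) * Fm) * exp (l * t)"
  proof (rule weighted_sup_bound[where t=t])
    show "0 \<le> h r" "h r \<le> Fm + exp (\<bar>\<sigma>\<bar> * t)" if "r \<in> {0..t}" for r
    proof -
      have "\<sigma> * r \<le> \<bar>\<sigma>\<bar> * t" 
        using mult_mono[of \<sigma> "\<bar>\<sigma>\<bar>" r t] that by simp
      then have "exp (\<sigma> * r) \<le> exp (\<bar>\<sigma>\<bar> * t)" by simp
      then show "h r \<le> Fm + exp (\<bar>\<sigma>\<bar> * t)" unfolding h_def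
        using Fm(1)[of r] Fm(2)[of r] that exp_gt_zero[of "\<sigma> * r"] unfolding atLeastAtMost_iff by linarith
    qed (simp add: h_def)
    fix r N assume r: "r \<in> {0..t}" and N: "0 \<le> N" and IH: "\<And>q. q \<in> {0..r} \<Longrightarrow> h q \<le> N * exp (l * q)"
    have "(LINT u:{0..r}|lborel. \<sigma> * exp (\<sigma> * u)) = exp (\<sigma> * r) - 1"
    proof -
      have "(LINT u|lborel. \<sigma> * exp (\<sigma> * u) * indicator {0..r} u) = exp (\<sigma> * r) - exp (\<sigma> * 0)"
        by (rule integral_FTC_Icc_real) (use r in \<open>auto intro!: derivative_eq_intros continuous_intros\<close>)
      then show ?thesis
        by (simp only: set_lebesgue_integral_def real_scaleR_def mult.commute[of "indicator {0..r} _"]) simp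
    qed
    moreover have iG: "set_integrable lborel {0..r} G"
      by (rule set_integrable_Icc_bounded[OF G_meas G_bound]) auto
    moreover have "set_integrable lborel {0..r} (\<lambda>u. \<sigma> * exp (\<sigma> * u))"
      by (intro borel_integrable_atLeastAtMost' continuous_intros)
    ultimately have "F r - exp (\<sigma> * r) = (LINT u:{0..r}|lborel. G u - \<sigma> * exp (\<sigma> * u))"
      using F_eq[of r] r by (simp add: set_integral_diff)
    then have "h r \<le> \<bar>LINT u:{0..r}|lborel. G u - \<sigma> * exp (\<sigma> * u)\<bar>" by (simp add: h_def)
    also have "\<dots> \<le> (LINT u:{0..r}|lborel. e + (\<bar>D u - \<sigma>\<bar> * Fm + \<bar>\<sigma>\<bar> * (N * exp (l * u))))"
    proof (rule abs_set_integral_le)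
      show "set_integrable lborel {0..r} (\<lambda>u. e + (\<bar>D u - \<sigma>\<bar> * Fm + \<bar>\<sigma>\<bar> * (N * exp (l * u))))"
        using iD by (intro set_integral_add set_integrable_mult_left)
          (auto intro!: borel_integrable_atLeastAtMost' continuous_intros)
      fix u assume u: "u \<in> {0..r}"
      \<comment> \<open>Error of the equation, error of the coefficient, and feedback of
        \<open>h\<close>.\<close>
      have "G u - \<sigma> * exp (\<sigma> * u) = (G u - D u * F u) + ((D u - \<sigma>) * F u + \<sigma> * (F u - exp (\<sigma> * u)))"
        by (simp add: algebra_simps)
      moreover have "\<bar>G u - D u * F u\<bar> \<le> e" unfolding e_def Fm_def using u r by (intro G_approx) auto
      moreover have "\<bar>(D u - \<sigma>) * F u\<bar> \<le> \<bar>D u - \<sigma>\<bar> * Fm"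
        unfolding abs_mult using Fm[of u] u r by (intro mult_left_mono) auto
      moreover have "\<bar>\<sigma> * (F u - exp (\<sigma> * u))\<bar> \<le> \<bar>\<sigma>\<bar> * (N * exp (l * u))"
        unfolding abs_mult using IH[OF u] by (intro mult_left_mono) (auto simp: h_def)
      ultimately show "\<bar>G u - \<sigma> * exp (\<sigma> * u)\<bar> \<le> e + (\<bar>D u - \<sigma>\<bar> * Fm + \<bar>\<sigma>\<bar> * (N * exp (l * u)))" by linarith
    qed
    also have "\<dots> = (LINT u:{0..r}|lborel. e) + ((LINT u:{0..r}|lborel. \<bar>D u - \<sigma>\<bar> * Fm) + (LINT u:{0..r}|lborel. \<bar>\<sigma>\<bar> * (N * exp (l * u))))"
    proof -
      have i: "set_integrable lborel {0..r} (\<lambda>u. e)" "set_integrable lborel {0..r} (\<lambda>u. \<bar>D u - \<sigma>\<bar> * Fm)"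
        "set_integrable lborel {0..r} (\<lambda>u. \<bar>\<sigma>\<bar> * (N * exp (l * u)))"
        using iD by (auto intro!: borel_integrable_atLeastAtMost' continuous_intros)
      show ?thesis using i by (simp add: set_integral_add)
    qed
    also have "(LINT u:{0..r}|lborel. e) \<le> e * t"
      using r e0 by (simp add: set_lebesgue_integral_def mult.commute mult_left_mono)
    also have "(LINT u:{0..r}|lborel. \<bar>D u - \<sigma>\<bar> * Fm) = (LINT u:{0..r}|lborel. \<bar>D u - \<sigma>\<bar>) * Fm" by simp
    also have "(LINT u:{0..r}|lborel. \<bar>D u - \<sigma>\<bar>) * Fm \<le> (LINT u:{0..t}|lborel. \<bar>D u - \<sigma>\<bar>) * Fm"
    proof (intro mult_right_mono Fm0)
      have "0 \<le> (LINT u:{r..t}|lborel. \<bar>D u - \<sigma>\<bar>)"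
        unfolding set_lebesgue_integral_def by (rule Bochner_Integration.integral_nonneg) (auto simp: indicator_def)
      then show "(LINT u:{0..r}|lborel. \<bar>D u - \<sigma>\<bar>) \<le> (LINT u:{0..t}|lborel. \<bar>D u - \<sigma>\<bar>)"
        using set_integral_Icc_combine[OF _ _ iD, of r t] r by simp
    qed
    also have "(LINT u:{0..r}|lborel. \<bar>\<sigma>\<bar> * (N * exp (l * u))) = \<bar>\<sigma>\<bar> * N * (LINT u:{0..r}|lborel. exp (l * u))"
      by simp
    also have "\<dots> \<le> \<bar>\<sigma>\<bar> * N * (exp (l * r) / l)"
      using exp_integral_le[OF l(1), of r] r N by (intro mult_left_mono) auto
    also have "\<dots> = (\<bar>\<sigma>\<bar> / l) * (N * exp (l * r))" by simp
    also have "\<dots> \<le> 1 / 2 * (N * exp (l * r))" using l N by (intro mult_right_mono) auto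
    finally show "h r \<le> e * t + (LINT r:{0..t}|lborel. \<bar>D r - \<sigma>\<bar>) * Fm + N / 2 * exp (l * r)" by simp
  qed (use t l e0 Fm0 in \<open>auto intro!: add_nonneg_nonneg mult_nonneg_nonneg
        Bochner_Integration.integral_nonneg simp: set_lebesgue_integral_def\<close>)
  also have "\<dots> = 4 * exp ((\<mu> + 2 * \<bar>\<sigma>\<bar> + 1) * t) * (c\<^sub>0 * t * \<epsilon> powr (1 / 8) + (LINT r:{0..t}|lborel. \<bar>D r - \<sigma>\<bar>))"
  proof -
    have "exp ((\<mu> + 2 * \<bar>\<sigma>\<bar> + 1) * t) = exp (\<mu> * t) * exp (l * t)"
      by (simp add: l_def distrib_right flip: exp_add)
    then show ?thesis by (simp add: e_def Fm_def distrib_left distrib_right mult_ac)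
  qed
  finally show ?thesis by (simp add: h_def)
qed

end

section \<open>Stationary mixing random fields\<close>

text \<open>\<open>f\<close> is an almost everywhere limit of continuous functions; clipped at
  \<open>K\<close> they converge to \<open>f\<close> in L1 on bounded intervals by dominated
  convergence, and for a continuous function uniform continuity on a compact interval does the
  rest.\<close>

lemma translation_L1_continuous:
  fixes f :: "real \<Rightarrow> real"
  assumes [measurable]: "f \<in> borel_measurable borel" and K: "\<And>x. \<bar>f x\<bar> \<le> K"
    and X: "X \<longlonglongrightarrow> 0"
  shows "(\<lambda>k. LINT x:{0..1}|lborel. \<bar>f (x + X k) - f x\<bar>) \<longlonglongrightarrow> 0"
proof -
  have K0: "0 \<le> K" using K[of 0] by linarith
  have "f measurable_on UNIV"
    by (rule lebesgue_measurable_imp_measurable_on) (auto intro!: measurable_completion)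
  then obtain N g where N: "negligible N" and g: "\<And>n. continuous_on UNIV (g n)"
    and lim: "\<And>x. x \<notin> N \<Longrightarrow> (\<lambda>n. g n x) \<longlonglongrightarrow> f x"
    unfolding measurable_on_def by auto
  define G where "G = (\<lambda>n x. max (- K) (min K (g n x)))"
  have G_cont: "continuous_on UNIV (G n)" for n
    unfolding G_def by (intro continuous_intros g)
  have [measurable]: "G n \<in> borel_measurable borel" for n
    by (rule borel_measurable_continuous_onI[OF G_cont])
  have G_bound: "\<bar>G n x\<bar> \<le> K" for n x using K0 by (auto simp: G_def)
  have AE_N: "AE x in lborel. x \<notin> N"
    using AE_not_in[of N lebesgue] N by (simp add: negligible_iff_null_sets AE_completion_iff)
  \<comment> \<open>The larger interval contains all shifts of \<open>{0..1}\<close> by less than 1,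
    so one approximation controls both \<open>f\<close> and its translate.\<close>
  have "(\<lambda>n. LINT x:{-1..2}|lborel. \<bar>f x - G n x\<bar>) \<longlonglongrightarrow> (LINT x:{-1..2::real}|lborel. (0::real))"
    unfolding set_lebesgue_integral_def
  proof (rule integral_dominated_convergence[where w="\<lambda>x. indicator {-1..2} x * (2 * K)"])
    show "integrable lborel (\<lambda>x. indicator {-1..2::real} x * (2 * K))"
      by (intro integrable_mult_left integrable_real_indicator) (auto simp: emeasure_lborel_Icc_eq)
    show "AE x in lborel. (\<lambda>n. indicator {-1..2} x *\<^sub>R \<bar>f x - G n x\<bar>) \<longlonglongrightarrow> indicator {-1..2} x *\<^sub>R (0::real)"
      using AE_N
    proof eventually_elim
      case (elim x)
      have "(\<lambda>n. G n x) \<longlonglongrightarrow> max (- K) (min K (f x))"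
        unfolding G_def by (intro tendsto_intros lim elim)
      moreover have "max (- K) (min K (f x)) = f x" using K[of x] by auto
      ultimately have "(\<lambda>n. G n x) \<longlonglongrightarrow> f x" by simp
      then have "(\<lambda>n. \<bar>f x - G n x\<bar>) \<longlonglongrightarrow> \<bar>f x - f x\<bar>" by (intro tendsto_intros)
      from tendsto_scaleR[OF tendsto_const this, of "indicator {-1..2} x"] show ?case by simp
    qed
    show "AE x in lborel. norm (indicator {-1..2} x *\<^sub>R \<bar>f x - G n x\<bar>) \<le> indicator {-1..2} x * (2 * K)" for n
    proof (rule AE_I2)
      fix x show "norm (indicator {-1..2} x *\<^sub>R \<bar>f x - G n x\<bar>) \<le> indicator {-1..2} x * (2 * K)"
        using K[of x] G_bound[of n x] by (auto simp: indicator_def)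
    qed
  qed measurable
  then have e: "(\<lambda>n. LINT x:{-1..2}|lborel. \<bar>f x - G n x\<bar>) \<longlonglongrightarrow> 0" by simp
  have bnd: "set_integrable lborel {a..b} (\<lambda>x. \<bar>p x - q x\<bar>)"
    if [measurable]: "p \<in> borel_measurable borel" "q \<in> borel_measurable borel"
      and "\<And>x. \<bar>p x\<bar> \<le> K" "\<And>x. \<bar>q x\<bar> \<le> K" for p q :: "real \<Rightarrow> real" and a b
  proof (rule set_integrable_Icc_bounded[where K="2 * K"])
    fix x show "\<bar>\<bar>p x - q x\<bar>\<bar> \<le> 2 * K" using that(3)[of x] that(4)[of x] by linarith
  qed measurable
  show ?thesis
  proof (rule LIMSEQ_I)
    fix r :: real assume r: "0 < r"
    obtain n where "\<bar>LINT x:{-1..2}|lborel. \<bar>f x - G n x\<bar>\<bar> < r / 4"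
      using LIMSEQ_D[OF e, of "r / 4"] r by auto
    then have n: "(LINT x:{-1..2}|lborel. \<bar>f x - G n x\<bar>) < r / 4" by linarith
    have "uniformly_continuous_on {-1..2} (G n)"
      by (rule compact_uniformly_continuous[OF continuous_on_subset[OF G_cont]]) auto
    then obtain \<delta> where \<delta>: "0 < \<delta>" "\<And>x y. x \<in> {-1..2} \<Longrightarrow> y \<in> {-1..2} \<Longrightarrow> dist y x < \<delta> \<Longrightarrow> dist (G n y) (G n x) < r / 4"
      unfolding uniformly_continuous_on_def using r by (metis zero_less_divide_iff zero_less_numeral)
    obtain k0 where k0: "\<And>k. k \<ge> k0 \<Longrightarrow> \<bar>X k\<bar> < min \<delta> 1"
      using LIMSEQ_D[OF X, of "min \<delta> 1"] \<delta> by auto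
    show "\<exists>k0. \<forall>k\<ge>k0. norm ((LINT x:{0..1}|lborel. \<bar>f (x + X k) - f x\<bar>) - 0) < r"
    proof (intro exI allI impI)
      fix k assume "k0 \<le> k"
      then have Xk: "\<bar>X k\<bar> < \<delta>" "\<bar>X k\<bar> < 1" using k0 by auto
      let ?h = "X k"
      have i1: "set_integrable lborel {0..1} (\<lambda>x. \<bar>f (x + ?h) - G n (x + ?h)\<bar>)"
        and i2: "set_integrable lborel {0..1} (\<lambda>x. \<bar>f x - G n x\<bar>)"
        and i3: "set_integrable lborel {0..1} (\<lambda>x. \<bar>f (x + ?h) - f x\<bar>)"
        using K G_bound by (auto intro!: bnd)
      have sub: "(LINT x:{0..1}|lborel. \<bar>f (x + a) - G n (x + a)\<bar>) \<le> (LINT x:{-1..2}|lborel. \<bar>f x - G n x\<bar>)"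
        if a: "\<bar>a\<bar> < 1" for a
      proof -
        have "(LINT x:{-1..2}|lborel. \<bar>f x - G n x\<bar>) = (LINT x|lborel. indicator {-1..2} (a + 1 * x) *\<^sub>R \<bar>f (a + 1 * x) - G n (a + 1 * x)\<bar>)"
          unfolding set_lebesgue_integral_def by (subst lborel_integral_real_affine[where c=1 and t=a]) auto
        also have "\<dots> \<ge> (LINT x:{0..1}|lborel. \<bar>f (x + a) - G n (x + a)\<bar>)"
          unfolding set_lebesgue_integral_def
        proof (rule integral_mono)
          show "integrable lborel (\<lambda>x. indicator {0..1} x *\<^sub>R \<bar>f (x + a) - G n (x + a)\<bar>)"
            using bnd[of "\<lambda>x. f (x + a)" "\<lambda>x. G n (x + a)" 0 1] K G_bound by (simp add: set_integrable_def)
          have "integrable lborel (\<lambda>x. indicator {-1..2} x *\<^sub>R \<bar>f x - G n x\<bar>)"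
            using bnd[of f "G n" "-1" 2] K G_bound by (simp add: set_integrable_def)
          from lborel_integrable_real_affine[OF this, of 1 a]
          show "integrable lborel (\<lambda>x. indicator {-1..2} (a + 1 * x) *\<^sub>R \<bar>f (a + 1 * x) - G n (a + 1 * x)\<bar>)" by simp
        qed (use a in \<open>auto simp: indicator_def add.commute\<close>)
        finally show ?thesis .
      qed
      have "\<bar>LINT x:{0..1}|lborel. \<bar>f (x + ?h) - f x\<bar>\<bar>
          \<le> (LINT x:{0..1}|lborel. \<bar>f (x + ?h) - G n (x + ?h)\<bar> + (\<bar>f x - G n x\<bar> + r / 4))"
      proof (rule abs_set_integral_le)
        show "set_integrable lborel {0..1} (\<lambda>x. \<bar>f (x + ?h) - G n (x + ?h)\<bar> + (\<bar>f x - G n x\<bar> + r / 4))"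
          
          using i1 i2 set_integrable_Icc_bounded[of "\<lambda>_. r / 4" 0 1 "r / 4"] r by (intro set_integral_add) auto
        fix x :: real assume x: "x \<in> {0..1}"
        have "dist (G n (x + ?h)) (G n x) < r / 4" using x Xk by (intro \<delta>) (auto simp: dist_real_def)
        then show "\<bar>\<bar>f (x + ?h) - f x\<bar>\<bar> \<le> \<bar>f (x + ?h) - G n (x + ?h)\<bar> + (\<bar>f x - G n x\<bar> + r / 4)"
          unfolding dist_real_def by linarith
      qed
      also have "\<dots> = (LINT x:{0..1}|lborel. \<bar>f (x + ?h) - G n (x + ?h)\<bar>) + ((LINT x:{0..1}|lborel. \<bar>f x - G n x\<bar>) + (LINT x:{0..1::real}|lborel. r / 4))"
        using i1 i2 set_integrable_Icc_bounded[of "\<lambda>_. r / 4" 0 1 "r / 4"] r by (simp add: set_integral_add)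
      also have "(LINT x:{0..1::real}|lborel. r / 4) = r / 4" by (simp add: set_lebesgue_integral_def)
      finally show "norm ((LINT x:{0..1}|lborel. \<bar>f (x + ?h) - f x\<bar>) - 0) < r"
        using sub[OF Xk(2)] sub[of 0] n r by simp
    qed
  qed
qed

text \<open>\<open>field_events\<close> repackaged as a measure object, so that
  \<open>subalgebra\<close> and measurability statements can refer to it.\<close>

definition field_algebra :: "'s measure \<Rightarrow> (real \<Rightarrow> real \<Rightarrow> 's \<Rightarrow> real) \<Rightarrow> (real \<times> real) set \<Rightarrow> 's measure" where
  "field_algebra M c A = sigma (space M) (\<Union>(t, x)\<in>A. {c t x -` U \<inter> space M |U. U \<in> sets borel})"

lemma space_field_algebra [simp]: "space (field_algebra M c A) = space M"
  unfolding field_algebra_def by (rule space_measure_of) auto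

lemma sets_field_algebra: "sets (field_algebra M c A) = field_events M c A"
  unfolding field_algebra_def field_events_def by (rule sets_measure_of) auto

lemma subalgebra_field_algebra:
  assumes "\<And>t x. (t, x) \<in> A \<Longrightarrow> c t x \<in> borel_measurable M"
  shows "subalgebra M (field_algebra M c A)"
  unfolding subalgebra_def field_algebra_def
  by (auto intro!: sets.sigma_sets_subset measurable_sets[OF assms] simp: space_measure_of_conv sets_measure_of_conv)

lemma measurable_field_algebra:
  assumes "(t, x) \<in> A"
  shows "c t x \<in> borel_measurable (field_algebra M c A)"
proof (rule measurableI)
  fix U :: "real set" assume "U \<in> sets borel"
  then have "c t x -` U \<inter> space M \<in> field_events M c A"
    unfolding field_events_def using assms by (intro sigma_sets.Basic) blast
  then show "c t x -` U \<inter> space (field_algebra M c A) \<in> sets (field_algebra M c A)"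
    by (simp add: sets_field_algebra)
qed simp

text \<open>Working form of the hypotheses: the field is jointly measurable at all real times,
  stationarity appears as invariance of expectations of two values, and the supremum defining the
  mixing coefficient is replaced by its rate.\<close>

locale mixing_field = prob_space M for M :: "'s measure" +
  fixes c :: "real \<Rightarrow> real \<Rightarrow> 's \<Rightarrow> real" and K A \<eta> :: real
  assumes c_meas [measurable]: "(\<lambda>(t, x, s). c t x s) \<in> borel_measurable (borel \<Otimes>\<^sub>M borel \<Otimes>\<^sub>M M)"
    and c_bound: "s \<in> space M \<Longrightarrow> \<bar>c t x s\<bar> \<le> K"
    and c_centred: "0 \<le> t \<Longrightarrow> (LINT s|M. c t x s) = 0"
    and c_stationary: "\<And>f :: real \<times> real \<Rightarrow> real. f \<in> borel_measurable (borel \<Otimes>\<^sub>M borel) \<Longrightarrow>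
      0 \<le> h \<Longrightarrow> 0 \<le> t1 \<Longrightarrow> 0 \<le> t2 \<Longrightarrow>
      (LINT s|M. f (c (t1 + h) (x1 + k) s, c (t2 + h) (x2 + k) s)) = (LINT s|M. f (c t1 x1 s, c t2 x2 s))"
    and c_mixing: "A1 \<subseteq> {0..} \<times> UNIV \<Longrightarrow> A2 \<subseteq> {0..} \<times> UNIV \<Longrightarrow> 0 \<le> r \<Longrightarrow> r \<le> setdist A1 A2 \<Longrightarrow>
      S \<in> field_events M c A1 \<Longrightarrow> T \<in> field_events M c A2 \<Longrightarrow>
      \<bar>measure M (S \<inter> T) - measure M S * measure M T\<bar> \<le> A * (decay \<eta> r)\<^sup>2 * measure M T"
    and eta: "0 < \<eta>" and A: "0 \<le> A"
begin

lemma K0: "0 \<le> K"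
proof -
  obtain s where "s \<in> space M" using not_empty by blast
  then show ?thesis using c_bound[of s 0 0] by linarith
qed

lemma c_compose_meas [measurable (raw)]:
  assumes "f \<in> borel_measurable N" "g \<in> borel_measurable N" "h \<in> N \<rightarrow>\<^sub>M M"
  shows "(\<lambda>x. c (f x) (g x) (h x)) \<in> borel_measurable N"
proof -
  have "(\<lambda>x. (f x, g x, h x)) \<in> N \<rightarrow>\<^sub>M borel \<Otimes>\<^sub>M borel \<Otimes>\<^sub>M M" using assms by measurable
  from measurable_compose[OF this c_meas] show ?thesis by simp
qed

lemma c_measurable [measurable]: "c t x \<in> borel_measurable M"
  by measurable

lemma integrable_bdd: "f \<in> borel_measurable M \<Longrightarrow> (\<And>s. s \<in> space M \<Longrightarrow> \<bar>f s\<bar> \<le> b) \<Longrightarrow> integrable M f"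
  for f :: "'s \<Rightarrow> real"
  by (rule integrable_const_bound[of _ b]) auto

lemma subalgebra_c: "subalgebra M (field_algebra M c A')"
  by (rule subalgebra_field_algebra) measurable

definition \<Phi> :: "real \<Rightarrow> real \<Rightarrow> real" where "\<Phi> t x = (LINT s|M. c 0 0 s * c t x s)"

definition \<sigma> :: real where "\<sigma> = (LINT r:{0..}|lborel. \<Phi> r 0)"

lemma Phi_meas [measurable]: "(\<lambda>(t, x). \<Phi> t x) \<in> borel_measurable (borel \<Otimes>\<^sub>M borel)"
  unfolding \<Phi>_def by measurable

lemma cc_bound: assumes "s \<in> space M" shows "\<bar>c t x s * c r y s\<bar> \<le> K\<^sup>2"
  using mult_mono[OF c_bound[OF assms, of t x] c_bound[OF assms, of r y] K0] by (simp add: abs_mult power2_eq_square)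

lemma Phi_shift:
  assumes "0 \<le> q" "q \<le> r"
  shows "(LINT s|M. c r y s * c q z s) = \<Phi> (r - q) (y - z)"
  using c_stationary[of "\<lambda>(a, b). a * b" q 0 "r - q" 0 z "y - z"] assms
  by (simp add: \<Phi>_def mult.commute)

text \<open>Mixing between two single space-time points. The separation may be read off in time,
  which gives integrability in the lag, or in space, which makes correlations between distant paths
  vanish.\<close>

lemma Phi_bound_dist:
  assumes "0 \<le> u" "0 \<le> h" "h \<le> dist (u, x) (0, 0)"
  shows "\<bar>\<Phi> u x\<bar> \<le> 2 * K\<^sup>2 * A * (decay \<eta> h)\<^sup>2"
proof -
  have i: "integrable M (c 0 0)" by (rule integrable_bdd[OF _ c_bound]) auto
  have "\<bar>(LINT s|M. c u x s * c 0 0 s) - (LINT s|M. c u x s) * (LINT s|M. c 0 0 s)\<bar>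
     \<le> 2 * K * (A * (decay \<eta> h)\<^sup>2) * (LINT s|M. \<bar>c 0 0 s\<bar>)"
  proof (rule mixing_covariance[OF prob_space_axioms subalgebra_c[of "{(u, x)}"] subalgebra_c[of "{(0, 0)}"]])
    fix S T assume "S \<in> sets (field_algebra M c {(u, x)})" "T \<in> sets (field_algebra M c {(0, 0)})"
    then show "\<bar>measure M (S \<inter> T) - measure M S * measure M T\<bar> \<le> A * (decay \<eta> h)\<^sup>2 * measure M T"
      using assms by (intro c_mixing[of "{(u, x)}" "{(0, 0)}"]) (auto simp: sets_field_algebra)
  qed (use i c_bound in \<open>auto intro!: measurable_field_algebra\<close>)
  also have "\<dots> \<le> 2 * K * (A * (decay \<eta> h)\<^sup>2) * K"
  proof (rule mult_left_mono)
    have "(LINT s|M. \<bar>c 0 0 s\<bar>) \<le> (LINT s|M. K)" using i c_bound by (intro integral_mono) auto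
    then show "(LINT s|M. \<bar>c 0 0 s\<bar>) \<le> K" by (simp add: prob_space)
  qed (use K0 A in auto)
  finally show ?thesis using c_centred[of 0 0] by (simp add: \<Phi>_def power2_eq_square mult_ac)
qed

lemma Phi_bound_time: "0 \<le> u \<Longrightarrow> \<bar>\<Phi> u x\<bar> \<le> 2 * K\<^sup>2 * A * (decay \<eta> u)\<^sup>2"
  using dist_fst_le[of "(u, x)" "(0, 0)"] by (intro Phi_bound_dist) auto

lemma Phi_bound_space: "0 \<le> u \<Longrightarrow> \<bar>\<Phi> u x\<bar> \<le> 2 * K\<^sup>2 * A * (decay \<eta> \<bar>x\<bar>)\<^sup>2"
  using dist_snd_le[of "(u, x)" "(0, 0)"] by (intro Phi_bound_dist) auto

lemma decay_sq_le: "0 \<le> u \<Longrightarrow> (decay \<eta> u)\<^sup>2 \<le> decay \<eta> u"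
  using decay_bounds[OF eta, of u] by (simp add: power2_eq_square mult_le_cancel_left1)

lemma Phi_decay: "0 \<le> u \<Longrightarrow> \<bar>\<Phi> u x\<bar> \<le> 2 * K\<^sup>2 * A * decay \<eta> u"
  using Phi_bound_time[of u x] decay_sq_le[of u] mult_left_mono[of "(decay \<eta> u)\<^sup>2" "decay \<eta> u" "2 * K\<^sup>2 * A"] A
  by auto

lemma decay_integrable: "set_integrable lborel {0..} (decay \<eta>)"
proof -
  have "(\<integral>\<^sup>+ x. ennreal (decay \<eta> x) * indicator {0..} x \<partial>lborel) = 0 - (- 1 / \<eta> * (1 + 0) powr (- \<eta>))"
  proof (rule nn_integral_FTC_atLeast)
    fix x :: real assume x: "0 \<le> x"
    show "0 \<le> decay \<eta> x" using decay_bounds[OF eta x] by simp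
    have "((\<lambda>x. 1 + x) has_real_derivative 1) (at x)" by (auto intro!: derivative_eq_intros)
    from DERIV_cmult[OF DERIV_fun_powr[OF this, of "- \<eta>"], of "- 1 / \<eta>"]
    show "((\<lambda>x. - 1 / \<eta> * (1 + x) powr (- \<eta>)) has_real_derivative decay \<eta> x) (at x)"
      using x eta by (simp add: decay_def minus_diff_commute)
  next
    have "((\<lambda>x::real. (1 + x) powr (- \<eta>)) \<longlongrightarrow> 0) at_top"
      using eta by (intro tendsto_neg_powr filterlim_tendsto_add_at_top[OF tendsto_const] filterlim_ident) auto
    from tendsto_mult_left[OF this, of "- 1 / \<eta>"]
    show "((\<lambda>x. - 1 / \<eta> * (1 + x) powr (- \<eta>)) \<longlongrightarrow> 0) at_top" by simp
  qed measurable
  then have fin: "(\<integral>\<^sup>+ x. ennreal (decay \<eta> x) * indicator {0..} x \<partial>lborel) < \<infinity>" by simp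
  show ?thesis unfolding set_integrable_def
  proof (rule integrableI_nonneg)
    show "AE x in lborel. 0 \<le> indicator {0..} x *\<^sub>R decay \<eta> x"
      using decay_bounds[OF eta] by (auto simp: indicator_def intro!: AE_I2 less_imp_le)
    show "(\<integral>\<^sup>+ x. ennreal (indicator {0..} x *\<^sub>R decay \<eta> x) \<partial>lborel) < \<infinity>"
      using fin by (subst nn_integral_cong[where v="\<lambda>x. ennreal (decay \<eta> x) * indicator {0..} x"]) (auto simp: indicator_def)
  qed measurable
qed

text \<open>The L1(P) modulus of continuity of the field in space; by stationarity it is the same at
  all nonnegative times and all base points.\<close>

definition \<psi> :: "real \<Rightarrow> real" where "\<psi> y = (LINT s|M. \<bar>c 0 y s - c 0 0 s\<bar>)"

lemma psi_meas [measurable]: "\<psi> \<in> borel_measurable borel"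
  unfolding \<psi>_def[abs_def] by measurable

lemma psi_bounds: "0 \<le> \<psi> y" "\<psi> y \<le> 2 * K"
proof -
  show "0 \<le> \<psi> y" unfolding \<psi>_def by simp
  have "\<bar>\<psi> y\<bar> \<le> (LINT s|M. 2 * K)" unfolding \<psi>_def
  proof (rule abs_integral_le)
    fix s assume "s \<in> space M"
    then show "\<bar>\<bar>c 0 y s - c 0 0 s\<bar>\<bar> \<le> 2 * K" using c_bound[of s 0 y] c_bound[of s 0 0] by linarith
  qed simp
  then show "\<psi> y \<le> 2 * K" by (simp add: prob_space)
qed

text \<open>The value at \<open>(0, 0)\<close> is bounded by \<open>K\<close>, and stationarity
  carries the spatial increment at time \<open>u\<close> to time 0; hence one modulus serves all
  lags.\<close>

lemma Phi_psi:
  assumes "0 \<le> u"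
  shows "\<bar>\<Phi> u x - \<Phi> u 0\<bar> \<le> K * \<psi> x"
proof -
  have i: "integrable M (\<lambda>s. c 0 0 s * c u x s)" for u x by (rule integrable_bdd[OF _ cc_bound]) auto
  have id: "integrable M (\<lambda>s. \<bar>c u x s - c u 0 s\<bar>)"
    by (intro integrable_abs Bochner_Integration.integrable_diff integrable_bdd[OF _ c_bound]) auto
  have "\<Phi> u x - \<Phi> u 0 = (LINT s|M. c 0 0 s * c u x s - c 0 0 s * c u 0 s)"
    unfolding \<Phi>_def using i by (subst Bochner_Integration.integral_diff) auto
  then have "\<bar>\<Phi> u x - \<Phi> u 0\<bar> = \<bar>LINT s|M. c 0 0 s * c u x s - c 0 0 s * c u 0 s\<bar>" by (rule arg_cong)
  also have "\<dots> \<le> (LINT s|M. K * \<bar>c u x s - c u 0 s\<bar>)"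
  proof (rule abs_integral_le)
    fix s assume "s \<in> space M"
    then show "\<bar>c 0 0 s * c u x s - c 0 0 s * c u 0 s\<bar> \<le> K * \<bar>c u x s - c u 0 s\<bar>"
      using c_bound[of s 0 0] by (auto simp: abs_mult mult_right_mono simp flip: right_diff_distrib)
  qed (use id in simp)
  also have "\<dots> = K * (LINT s|M. \<bar>c u x s - c u 0 s\<bar>)" by simp
  also have "(LINT s|M. \<bar>c u x s - c u 0 s\<bar>) = \<psi> x"
    using c_stationary[of "\<lambda>(a, b). \<bar>a - b\<bar>" u 0 0 x 0 0] assms by (simp add: \<psi>_def)
  finally show ?thesis .
qed

text \<open>\<open>\<psi> y\<close> equals \<open>E \<bar>c 0 (z + y) - c 0 z\<bar>\<close> for every \<open>z\<close>; averaging over \<open>z\<close> reduces its continuity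
  to continuity of translation for the sample paths, which are merely measurable.\<close>

lemma psi_tendsto_0:
  assumes X: "X \<longlonglongrightarrow> 0"
  shows "(\<lambda>k. \<psi> (X k)) \<longlonglongrightarrow> 0"
proof -
  have b: "\<bar>\<bar>c 0 (z + y) s - c 0 z s\<bar>\<bar> \<le> 2 * K" if "s \<in> space M" for s z y
    using c_bound[OF that, of 0 "z + y"] c_bound[OF that, of 0 z] by linarith
  have eq: "\<psi> y = (LINT s|M. (LINT z:{0..1}|lborel. \<bar>c 0 (z + y) s - c 0 z s\<bar>))" for y
  proof -
    have "\<psi> y = (LINT z:{0..1::real}|lborel. \<psi> y)" by (simp add: set_lebesgue_integral_def)
    also have "\<dots> = (LINT z:{0..1}|lborel. (LINT s|M. \<bar>c 0 (z + y) s - c 0 z s\<bar>))"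
    proof (rule set_lebesgue_integral_cong; safe?)
      fix z show "\<psi> y = (LINT s|M. \<bar>c 0 (z + y) s - c 0 z s\<bar>)"
        using c_stationary[of "\<lambda>(a, b). \<bar>a - b\<bar>" 0 0 0 y z 0] by (simp add: \<psi>_def add.commute)
    qed simp
    also have "\<dots> = (LINT s|M. (LINT z:{0..1}|lborel. \<bar>c 0 (z + y) s - c 0 z s\<bar>))"
      by (rule Fubini_Icc(1)[symmetric, where k="2 * K"]) (use b in auto)
    finally show ?thesis .
  qed
  have "(\<lambda>k. LINT s|M. (LINT z:{0..1}|lborel. \<bar>c 0 (z + X k) s - c 0 z s\<bar>)) \<longlonglongrightarrow> (LINT s|M. 0)"
  proof (rule integral_dominated_convergence[where w="\<lambda>_. 2 * K"])
    show "(\<lambda>s. LINT z:{0..1}|lborel. \<bar>c 0 (z + X k) s - c 0 z s\<bar>) \<in> borel_measurable M" for k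
      by (rule Fubini_Icc(2)[where k="2 * K"]) (use b in auto)
    show "AE s in M. (\<lambda>k. LINT z:{0..1}|lborel. \<bar>c 0 (z + X k) s - c 0 z s\<bar>) \<longlonglongrightarrow> 0"
    proof (rule AE_I2)
      fix s assume s: "s \<in> space M"
      then have "(\<lambda>x. c 0 x s) \<in> borel_measurable borel" by measurable
      then show "(\<lambda>k. LINT z:{0..1}|lborel. \<bar>c 0 (z + X k) s - c 0 z s\<bar>) \<longlonglongrightarrow> 0"
        by (rule translation_L1_continuous[OF _ c_bound[OF s] X])
    qed
    show "AE s in M. norm (LINT z:{0..1}|lborel. \<bar>c 0 (z + X k) s - c 0 z s\<bar>) \<le> 2 * K" for k
    proof (rule AE_I2)
      fix s assume s: "s \<in> space M"
      show "norm (LINT z:{0..1}|lborel. \<bar>c 0 (z + X k) s - c 0 z s\<bar>) \<le> 2 * K"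
        using abs_set_integral_Icc_bounded[of 0 1, OF _ b[OF s]] by simp
    qed
  qed auto
  then show ?thesis unfolding eq by simp
qed

end

section \<open>The field along paths\<close>

context mixing_field
begin

text \<open>\<theta> = 0 gives the field along one path and \<theta> = 1 the sum along two, at the
  cost of the doubled bound \<open>2 * K\<close>. Past and future are strips unbounded in space:
  separation in time alone suffices, so the paths may be arbitrary measurable functions.\<close>

lemma mixing_process_along_paths:
  assumes [measurable]: "y \<in> borel_measurable borel" "z \<in> borel_measurable borel"
    and \<theta>: "\<bar>\<theta>\<bar> \<le> 1" and eps: "0 < \<epsilon>" "\<epsilon> \<le> 1"
  shows "mixing_process M (\<lambda>r s. c (r / \<epsilon>) (y r) s + \<theta> * c (r / \<epsilon>) (z r) s)
    (\<lambda>r. field_algebra M c ({0..r / \<epsilon>} \<times> UNIV)) (\<lambda>r. field_algebra M c ({r / \<epsilon>..} \<times> UNIV)) (2 * K) A \<eta> \<epsilon>"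
proof unfold_locales
  show "(\<lambda>(r, s). c (r / \<epsilon>) (y r) s + \<theta> * c (r / \<epsilon>) (z r) s) \<in> borel_measurable (borel \<Otimes>\<^sub>M M)"
    by measurable
  show "\<bar>c (r / \<epsilon>) (y r) s + \<theta> * c (r / \<epsilon>) (z r) s\<bar> \<le> 2 * K" if s: "s \<in> space M" for s r
  proof -
    have "\<bar>\<theta> * c (r / \<epsilon>) (z r) s\<bar> \<le> 1 * K"
      unfolding abs_mult using \<theta> c_bound[OF s] by (intro mult_mono) auto
    then show ?thesis using c_bound[OF s, of "r / \<epsilon>" "y r"] by linarith
  qed
  show "(LINT s|M. c (r / \<epsilon>) (y r) s + \<theta> * c (r / \<epsilon>) (z r) s) = 0" if "0 \<le> r" for r
  proof -
    have "integrable M (c t x)" for t x by (rule integrable_bdd[OF _ c_bound]) auto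
    then show ?thesis using that eps c_centred[of "r / \<epsilon>"] by simp
  qed
  show "subalgebra M (field_algebra M c ({0..r / \<epsilon>} \<times> UNIV))" "subalgebra M (field_algebra M c ({r / \<epsilon>..} \<times> UNIV))" for r
    by (rule subalgebra_c)+
  show "(\<lambda>s. c (q / \<epsilon>) (y q) s + \<theta> * c (q / \<epsilon>) (z q) s) \<in> borel_measurable (field_algebra M c ({0..r / \<epsilon>} \<times> UNIV))"
    if "0 \<le> q" "q \<le> r" for q r
    using that eps by (intro borel_measurable_add borel_measurable_times measurable_field_algebra) (auto simp: divide_right_mono)
  show "(\<lambda>s. c (q / \<epsilon>) (y q) s + \<theta> * c (q / \<epsilon>) (z q) s) \<in> borel_measurable (field_algebra M c ({r / \<epsilon>..} \<times> UNIV))"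
    if "0 \<le> r" "r \<le> q" for q r
    using that eps by (intro borel_measurable_add borel_measurable_times measurable_field_algebra) (auto simp: divide_right_mono)
  show "\<bar>prob (S \<inter> T) - prob S * prob T\<bar> \<le> A * (decay \<eta> ((r - q) / \<epsilon>))\<^sup>2 * prob T"
    if qr: "0 \<le> q" "q \<le> r" and S: "S \<in> sets (field_algebra M c ({r / \<epsilon>..} \<times> UNIV))"
      and T: "T \<in> sets (field_algebra M c ({0..q / \<epsilon>} \<times> UNIV))" for q r S T
  proof (rule c_mixing)
    show "(r - q) / \<epsilon> \<le> setdist ({r / \<epsilon>..} \<times> UNIV) ({0..q / \<epsilon>} \<times> (UNIV :: real set))"
    proof (rule le_setdistI)
      fix a b :: "real \<times> real" assume "a \<in> {r / \<epsilon>..} \<times> UNIV" "b \<in> {0..q / \<epsilon>} \<times> UNIV"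
      then have "(r - q) / \<epsilon> \<le> dist (fst a) (fst b)"
        by (auto simp: dist_real_def diff_divide_distrib)
      then show "(r - q) / \<epsilon> \<le> dist a b" using dist_fst_le[of a b] by linarith
    qed (use qr eps in auto)
    have "0 \<le> r / \<epsilon>" using qr eps by simp
    then show "{r / \<epsilon>..} \<times> (UNIV :: real set) \<subseteq> {0..} \<times> UNIV" by auto
  qed (use qr eps S T in \<open>auto simp: sets_field_algebra\<close>)
qed (use eta A eps in auto)

text \<open>The building block of the coefficient \<open>D\<close>: for the sum of two paths,
  \<open>D\<close> splits into two terms of a path with itself and two cross terms. The order of
  \<open>y\<close> and \<open>z\<close> matters, because the first path is taken at the later
  time.\<close>

definition corr :: "real \<Rightarrow> (real \<Rightarrow> real) \<Rightarrow> (real \<Rightarrow> real) \<Rightarrow> real \<Rightarrow> real" where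
  "corr \<epsilon> y z r = (LINT q:{0..r}|lborel. \<Phi> ((r - q) / \<epsilon>) (y r - z q)) / \<epsilon>"

definition own :: "real \<Rightarrow> (real \<Rightarrow> real) \<Rightarrow> real \<Rightarrow> real" where
  "own \<epsilon> y t = (LINT r:{0..t}|lborel. \<bar>corr \<epsilon> y y r - \<sigma>\<bar>)"

definition cross :: "real \<Rightarrow> (real \<Rightarrow> real) \<Rightarrow> (real \<Rightarrow> real) \<Rightarrow> real \<Rightarrow> real" where
  "cross \<epsilon> y z t = (LINT r:{0..t}|lborel. \<bar>corr \<epsilon> y z r\<bar>)"

definition \<zeta> :: "real \<Rightarrow> (real \<Rightarrow> real) \<Rightarrow> real \<Rightarrow> 's \<Rightarrow> real" where
  "\<zeta> \<epsilon> y t s = \<epsilon> powr (- 1 / 2) * (LINT r:{0..t}|lborel. c (r / \<epsilon>) (y r) s)"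

lemma Phi_compose_meas [measurable (raw)]:
  assumes "f \<in> borel_measurable N" "g \<in> borel_measurable N"
  shows "(\<lambda>x. \<Phi> (f x) (g x)) \<in> borel_measurable N"
proof -
  have "(\<lambda>x. (f x, g x)) \<in> N \<rightarrow>\<^sub>M borel \<Otimes>\<^sub>M borel" using assms by measurable
  from measurable_compose[OF this Phi_meas] show ?thesis by simp
qed

lemma corr_meas [measurable]:
  assumes [measurable]: "y \<in> borel_measurable borel" "z \<in> borel_measurable borel"
  shows "corr \<epsilon> y z \<in> borel_measurable borel"
  unfolding corr_def[abs_def] by measurable

lemma Phi_abs_le: "0 \<le> u \<Longrightarrow> \<bar>\<Phi> u x\<bar> \<le> K\<^sup>2"
proof -
  have "\<bar>\<Phi> u x\<bar> \<le> (LINT s|M. K\<^sup>2)" unfolding \<Phi>_def by (rule abs_integral_le) (use cc_bound in auto)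
  then show ?thesis by (simp add: prob_space)
qed

lemma corr_bound:
  assumes "0 \<le> r" "0 < \<epsilon>"
  shows "\<bar>corr \<epsilon> y z r\<bar> \<le> 2 * K\<^sup>2 * A / \<eta>"
proof -
  have "\<bar>LINT q:{0..r}|lborel. \<Phi> ((r - q) / \<epsilon>) (y r - z q)\<bar> \<le> (LINT q:{0..r}|lborel. 2 * K\<^sup>2 * A * decay \<eta> ((r - q) / \<epsilon>))"
  proof (rule abs_set_integral_le)
    show "set_integrable lborel {0..r} (\<lambda>q. 2 * K\<^sup>2 * A * decay \<eta> ((r - q) / \<epsilon>))"
    proof (intro set_integrable_mult_right set_integrable_Icc_bounded[where K=1])
      fix q assume "q \<in> {0..r}"
      then have "0 \<le> (r - q) / \<epsilon>" using assms by simp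
      then show "\<bar>decay \<eta> ((r - q) / \<epsilon>)\<bar> \<le> 1" using decay_bounds(1,2)[OF eta, of "(r - q) / \<epsilon>"] by simp
    qed measurable
  qed (use Phi_decay assms in auto)
  also have "\<dots> = 2 * K\<^sup>2 * A * (LINT q:{0..r}|lborel. decay \<eta> ((r - q) / \<epsilon>))" by simp
  also have "\<dots> \<le> 2 * K\<^sup>2 * A * (\<epsilon> / \<eta>)"
    using decay_integral[OF eta assms(2,1)] A by (intro mult_left_mono) auto
  finally show ?thesis using assms by (simp add: corr_def divide_le_eq)
qed

lemma corr_integrable:
  assumes "y \<in> borel_measurable borel" "z \<in> borel_measurable borel" "0 < \<epsilon>"
  shows "set_integrable lborel {0..t} (corr \<epsilon> y z)"
  using assms corr_bound by (intro set_integrable_Icc_bounded[where K="2 * K\<^sup>2 * A / \<eta>"]) auto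

text \<open>The constant is uniform in \<epsilon> and in the paths because \<open>\<mu>\<close> and
  \<open>c\<^sub>0\<close> of \<open>mixing_process\<close> depend only on \<open>2 * K\<close>,
  \<open>A\<close> and \<open>\<eta>\<close>. Each path contributes \<sigma> to the exponent, while
  cross terms enter as errors.\<close>

lemma exp_moment_approx:
  assumes t: "0 \<le> t"
  obtains C where "0 \<le> C"
    and "\<And>\<epsilon> y z. 0 < \<epsilon> \<Longrightarrow> \<epsilon> \<le> 1 \<Longrightarrow> y \<in> borel_measurable borel \<Longrightarrow> z \<in> borel_measurable borel \<Longrightarrow>
      \<bar>(LINT s|M. exp (\<zeta> \<epsilon> y t s)) - exp (\<sigma> * t)\<bar> \<le> C * (\<epsilon> powr (1 / 8) + own \<epsilon> y t) \<and>
      \<bar>(LINT s|M. exp (\<zeta> \<epsilon> y t s + \<zeta> \<epsilon> z t s)) - exp (2 * \<sigma> * t)\<bar>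
        \<le> C * (\<epsilon> powr (1 / 8) + own \<epsilon> y t + own \<epsilon> z t + cross \<epsilon> y z t + cross \<epsilon> z y t) \<and>
      (LINT s|M. exp (\<zeta> \<epsilon> y t s)) \<le> C \<and> (LINT s|M. exp (\<zeta> \<epsilon> y t s + \<zeta> \<epsilon> z t s)) \<le> C"
proof -
  define m where "m = mixing_process.\<mu> (2 * K) A \<eta>"
  define c0 where "c0 = mixing_process.c\<^sub>0 (2 * K) A \<eta>"
  define C where "C = (c0 * t + 1) * (4 * exp ((m + 2 * \<bar>2 * \<sigma>\<bar> + 1) * t))"
  have c0: "0 \<le> c0"
  proof -
    \<comment> \<open>Any instance will do to read off the sign of the constant; here the path 0 at
      scale 1.\<close>
    interpret P: mixing_process M "\<lambda>r s. c (r / 1) 0 s + 0 * c (r / 1) 0 s" "\<lambda>r. field_algebra M c ({0..r / 1} \<times> UNIV)"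
      "\<lambda>r. field_algebra M c ({r / 1..} \<times> UNIV)" "2 * K" A \<eta> 1
      by (rule mixing_process_along_paths) auto
    show ?thesis unfolding c0_def P.c\<^sub>0_def using P.L0 K0 eta by simp
  qed
  have C0: "0 \<le> C" unfolding C_def using c0 t by simp
  have set_int_nonneg: "0 \<le> a" if "(a::real) = LINT x|lborel. indicator S x *\<^sub>R \<bar>f x\<bar>" for a S and f :: "real \<Rightarrow> real"
    unfolding that by (rule Bochner_Integration.integral_nonneg) (auto simp: indicator_def)
  have own0: "0 \<le> own \<epsilon> y t" and cross0: "0 \<le> cross \<epsilon> y z t" for \<epsilon> y z
    by (rule set_int_nonneg, simp only: own_def cross_def set_lebesgue_integral_def)+
  \<comment> \<open>One statement covers both moments, at \<theta> = 0 and \<theta> = 1: the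
    coefficient \<open>D\<close> is compared with (1 + \<theta>^2) \<sigma>.\<close>
  have main: "\<bar>(LINT s|M. exp (\<zeta> \<epsilon> y t s + \<theta> * \<zeta> \<epsilon> z t s)) - exp ((1 + \<theta>\<^sup>2) * \<sigma> * t)\<bar>
        \<le> C * (\<epsilon> powr (1 / 8) + own \<epsilon> y t + \<theta>\<^sup>2 * own \<epsilon> z t + \<theta> * (cross \<epsilon> y z t + cross \<epsilon> z y t)) \<and>
      (LINT s|M. exp (\<zeta> \<epsilon> y t s + \<theta> * \<zeta> \<epsilon> z t s)) \<le> C"
    if eps: "0 < \<epsilon>" "\<epsilon> \<le> 1" and [measurable]: "y \<in> borel_measurable borel" "z \<in> borel_measurable borel"
      and th: "0 \<le> \<theta>" "\<theta> \<le> 1" for \<epsilon> y z \<theta>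
  proof -
    interpret P: mixing_process M "\<lambda>r s. c (r / \<epsilon>) (y r) s + \<theta> * c (r / \<epsilon>) (z r) s"
      "\<lambda>r. field_algebra M c ({0..r / \<epsilon>} \<times> UNIV)" "\<lambda>r. field_algebra M c ({r / \<epsilon>..} \<times> UNIV)" "2 * K" A \<eta> \<epsilon>
      by (rule mixing_process_along_paths) (use that in auto)
    have ci: "set_integrable lborel {0..t} (\<lambda>r. c (r / \<epsilon>) (p r) s)"
      if "s \<in> space M" and [measurable]: "p \<in> borel_measurable borel" for s p
    proof (rule set_integrable_Icc_bounded[OF _ c_bound[OF that(1)]])
      show "(\<lambda>r. c (r / \<epsilon>) (p r) s) \<in> borel_measurable borel"
        using that(1) by measurable
    qed
    have Z_eq: "P.Z t s = \<zeta> \<epsilon> y t s + \<theta> * \<zeta> \<epsilon> z t s" if "s \<in> space M" for s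
      using ci[OF that, of y] ci[OF that, of z]
      by (simp add: P.Z_def \<zeta>_def set_integral_add distrib_left)
    have F_eq: "P.F t = (LINT s|M. exp (\<zeta> \<epsilon> y t s + \<theta> * \<zeta> \<epsilon> z t s))"
      unfolding P.F_def by (rule Bochner_Integration.integral_cong) (auto simp: Z_eq)
    have R_eq: "P.R r q = \<Phi> ((r - q) / \<epsilon>) (y r - y q) + \<theta> * (\<Phi> ((r - q) / \<epsilon>) (y r - z q) + \<Phi> ((r - q) / \<epsilon>) (z r - y q))
        + \<theta>\<^sup>2 * \<Phi> ((r - q) / \<epsilon>) (z r - z q)" if qr: "0 \<le> q" "q \<le> r" for q r
    proof -
      let ?r = "r / \<epsilon>" and ?q = "q / \<epsilon>"
      have i: "integrable M (\<lambda>s. c t x s * c t' x' s)" for t x t' x' by (rule integrable_bdd[OF _ cc_bound]) auto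
      have sh: "(LINT s|M. c ?r a s * c ?q b s) = \<Phi> ((r - q) / \<epsilon>) (a - b)" for a b
        using Phi_shift[of ?q ?r a b] qr eps by (simp add: divide_right_mono diff_divide_distrib)
      have "P.R r q = (LINT s|M. c ?r (y r) s * c ?q (y q) s + \<theta> * (c ?r (y r) s * c ?q (z q) s + c ?r (z r) s * c ?q (y q) s)
         + \<theta>\<^sup>2 * (c ?r (z r) s * c ?q (z q) s))"
        unfolding P.R_def by (intro Bochner_Integration.integral_cong) (auto simp: algebra_simps power2_eq_square)
      also have "\<dots> = (LINT s|M. c ?r (y r) s * c ?q (y q) s)
          + \<theta> * ((LINT s|M. c ?r (y r) s * c ?q (z q) s) + (LINT s|M. c ?r (z r) s * c ?q (y q) s))
          + \<theta>\<^sup>2 * (LINT s|M. c ?r (z r) s * c ?q (z q) s)"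
        using i by simp
      finally show ?thesis by (simp only: sh)
    qed
    have Pi: "set_integrable lborel {0..r} (\<lambda>q. \<Phi> ((r - q) / \<epsilon>) (a - p q))"
      if [measurable]: "p \<in> borel_measurable borel" for r a p
      by (rule set_integrable_Icc_bounded[where K="K\<^sup>2"]) (use eps Phi_abs_le in auto)
    have D_eq: "P.D r = corr \<epsilon> y y r + \<theta> * (corr \<epsilon> y z r + corr \<epsilon> z y r) + \<theta>\<^sup>2 * corr \<epsilon> z z r" if r: "0 \<le> r" for r
    proof -
      have "(LINT q:{0..r}|lborel. P.R r q) = (LINT q:{0..r}|lborel. \<Phi> ((r - q) / \<epsilon>) (y r - y q)
          + \<theta> * (\<Phi> ((r - q) / \<epsilon>) (y r - z q) + \<Phi> ((r - q) / \<epsilon>) (z r - y q)) + \<theta>\<^sup>2 * \<Phi> ((r - q) / \<epsilon>) (z r - z q))"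
        by (rule set_lebesgue_integral_cong) (auto simp: R_eq)
      also have "\<dots> = (LINT q:{0..r}|lborel. \<Phi> ((r - q) / \<epsilon>) (y r - y q))
          + \<theta> * ((LINT q:{0..r}|lborel. \<Phi> ((r - q) / \<epsilon>) (y r - z q)) + (LINT q:{0..r}|lborel. \<Phi> ((r - q) / \<epsilon>) (z r - y q)))
          + \<theta>\<^sup>2 * (LINT q:{0..r}|lborel. \<Phi> ((r - q) / \<epsilon>) (z r - z q))"
        by (simp add: set_integral_add Pi)
      finally show ?thesis by (simp add: P.D_def corr_def add_divide_distrib distrib_left)
    qed
    let ?e = "own \<epsilon> y t + \<theta>\<^sup>2 * own \<epsilon> z t + \<theta> * (cross \<epsilon> y z t + cross \<epsilon> z y t)"
    have e0: "0 \<le> ?e" using own0 cross0 th by simp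
    have ic: "set_integrable lborel {0..t} (\<lambda>r. \<bar>corr \<epsilon> p p r - \<sigma>\<bar>)" "set_integrable lborel {0..t} (\<lambda>r. \<bar>corr \<epsilon> p q r\<bar>)"
      if "p \<in> borel_measurable borel" "q \<in> borel_measurable borel" for p q
      using set_integrable_abs[OF set_integral_diff(1)[OF corr_integrable[OF that(1,1) eps(1), of t]
            set_integrable_Icc_bounded[of "\<lambda>_. \<sigma>" 0 t "\<bar>\<sigma>\<bar>"]]]
        set_integrable_abs[OF corr_integrable[OF that eps(1)]] by simp_all
    have "\<bar>LINT r:{0..t}|lborel. \<bar>P.D r - (1 + \<theta>\<^sup>2) * \<sigma>\<bar>\<bar> \<le> (LINT r:{0..t}|lborel. \<bar>corr \<epsilon> y y r - \<sigma>\<bar> + \<theta>\<^sup>2 * \<bar>corr \<epsilon> z z r - \<sigma>\<bar>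
        + \<theta> * (\<bar>corr \<epsilon> y z r\<bar> + \<bar>corr \<epsilon> z y r\<bar>))"
    proof (rule abs_set_integral_le)
      show "set_integrable lborel {0..t} (\<lambda>r. \<bar>corr \<epsilon> y y r - \<sigma>\<bar> + \<theta>\<^sup>2 * \<bar>corr \<epsilon> z z r - \<sigma>\<bar> + \<theta> * (\<bar>corr \<epsilon> y z r\<bar> + \<bar>corr \<epsilon> z y r\<bar>))"
        by (intro set_integral_add set_integrable_mult_right ic) measurable
      fix r assume "r \<in> {0..t}"
      then have "P.D r - (1 + \<theta>\<^sup>2) * \<sigma> = (corr \<epsilon> y y r - \<sigma>) + \<theta>\<^sup>2 * (corr \<epsilon> z z r - \<sigma>) + \<theta> * (corr \<epsilon> y z r + corr \<epsilon> z y r)"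
        by (simp add: D_eq algebra_simps)
      moreover have "\<bar>\<theta>\<^sup>2 * (corr \<epsilon> z z r - \<sigma>)\<bar> = \<theta>\<^sup>2 * \<bar>corr \<epsilon> z z r - \<sigma>\<bar>" by (simp add: abs_mult)
      moreover have "\<bar>\<theta> * (corr \<epsilon> y z r + corr \<epsilon> z y r)\<bar> \<le> \<theta> * (\<bar>corr \<epsilon> y z r\<bar> + \<bar>corr \<epsilon> z y r\<bar>)"
        using th by (simp add: abs_mult mult_left_mono)
      ultimately show "\<bar>\<bar>P.D r - (1 + \<theta>\<^sup>2) * \<sigma>\<bar>\<bar> \<le> \<bar>corr \<epsilon> y y r - \<sigma>\<bar> + \<theta>\<^sup>2 * \<bar>corr \<epsilon> z z r - \<sigma>\<bar> + \<theta> * (\<bar>corr \<epsilon> y z r\<bar> + \<bar>corr \<epsilon> z y r\<bar>)"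
        by linarith
    qed
    also have "\<dots> = ?e"
      using ic(1)[of y y] ic(1)[of z z] ic(2)[of y z] ic(2)[of z y] that(3,4)
      by (simp add: set_integral_add own_def cross_def)
    finally have D_le: "(LINT r:{0..t}|lborel. \<bar>P.D r - (1 + \<theta>\<^sup>2) * \<sigma>\<bar>) \<le> ?e" by linarith
    have m_eq: "m = P.\<mu>" "c0 = P.c\<^sub>0" by (simp_all add: m_def c0_def)
    have th2: "\<theta>\<^sup>2 \<le> 1" using th by (simp add: power_le_one)
    have "\<bar>P.F t - exp ((1 + \<theta>\<^sup>2) * \<sigma> * t)\<bar> \<le> 4 * exp ((m + 2 * \<bar>(1 + \<theta>\<^sup>2) * \<sigma>\<bar> + 1) * t) *
       (c0 * t * \<epsilon> powr (1 / 8) + (LINT r:{0..t}|lborel. \<bar>P.D r - (1 + \<theta>\<^sup>2) * \<sigma>\<bar>))"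
      unfolding m_eq by (rule P.F_approx[OF t])
    also have "\<dots> \<le> 4 * exp ((m + 2 * \<bar>2 * \<sigma>\<bar> + 1) * t) * ((c0 * t + 1) * (\<epsilon> powr (1 / 8) + ?e))"
    proof (rule mult_mono)
      have "\<bar>(1 + \<theta>\<^sup>2) * \<sigma>\<bar> \<le> \<bar>2 * \<sigma>\<bar>" unfolding abs_mult using th2 by (intro mult_right_mono) auto
      then show "4 * exp ((m + 2 * \<bar>(1 + \<theta>\<^sup>2) * \<sigma>\<bar> + 1) * t) \<le> 4 * exp ((m + 2 * \<bar>2 * \<sigma>\<bar> + 1) * t)"
        using t by (simp add: mult_right_mono)
      have "0 \<le> c0 * t * ?e" "0 \<le> \<epsilon> powr (1 / 8)" using c0 t e0 by simp_all
      then show "c0 * t * \<epsilon> powr (1 / 8) + (LINT r:{0..t}|lborel. \<bar>P.D r - (1 + \<theta>\<^sup>2) * \<sigma>\<bar>) \<le> (c0 * t + 1) * (\<epsilon> powr (1 / 8) + ?e)"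
        using D_le unfolding distrib_left distrib_right by linarith
      show "0 \<le> c0 * t * \<epsilon> powr (1 / 8) + (LINT r:{0..t}|lborel. \<bar>P.D r - (1 + \<theta>\<^sup>2) * \<sigma>\<bar>)"
        using c0 t set_int_nonneg[of "LINT r:{0..t}|lborel. \<bar>P.D r - (1 + \<theta>\<^sup>2) * \<sigma>\<bar>"]
        by (simp add: set_lebesgue_integral_def)
    qed simp
    also have "\<dots> = C * (\<epsilon> powr (1 / 8) + ?e)" by (simp add: C_def mult_ac)
    finally have 1: "\<bar>P.F t - exp ((1 + \<theta>\<^sup>2) * \<sigma> * t)\<bar> \<le> C * (\<epsilon> powr (1 / 8) + ?e)" .
    have "P.F t \<le> 2 * exp (m * t)" unfolding m_eq by (rule P.F_exp_bound[OF t])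
    also have "\<dots> \<le> 1 * (4 * exp ((m + 2 * \<bar>2 * \<sigma>\<bar> + 1) * t))"
    proof -
      have "exp (m * t) \<le> exp ((m + 2 * \<bar>2 * \<sigma>\<bar> + 1) * t)" using t by (simp add: mult_right_mono)
      then show ?thesis using exp_gt_zero[of "m * t"] by linarith
    qed
    also have "\<dots> \<le> C" unfolding C_def using c0 t by (intro mult_right_mono) auto
    finally show ?thesis using 1 unfolding F_eq by (simp only: add.assoc)
  qed
  show thesis
  proof (rule that[OF C0])
    fix \<epsilon> :: real and y z :: "real \<Rightarrow> real"
    assume a: "0 < \<epsilon>" "\<epsilon> \<le> 1" "y \<in> borel_measurable borel" "z \<in> borel_measurable borel"
    show "\<bar>(LINT s|M. exp (\<zeta> \<epsilon> y t s)) - exp (\<sigma> * t)\<bar> \<le> C * (\<epsilon> powr (1 / 8) + own \<epsilon> y t) \<and>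
      \<bar>(LINT s|M. exp (\<zeta> \<epsilon> y t s + \<zeta> \<epsilon> z t s)) - exp (2 * \<sigma> * t)\<bar>
        \<le> C * (\<epsilon> powr (1 / 8) + own \<epsilon> y t + own \<epsilon> z t + cross \<epsilon> y z t + cross \<epsilon> z y t) \<and>
      (LINT s|M. exp (\<zeta> \<epsilon> y t s)) \<le> C \<and> (LINT s|M. exp (\<zeta> \<epsilon> y t s + \<zeta> \<epsilon> z t s)) \<le> C"
      using main[OF a, of 0] main[OF a, of 1] by (simp add: add.assoc)
  qed
qed

text \<open>Substituting \<open>u = (r - q) / \<epsilon>\<close> absorbs the factor 1/\<epsilon> and
  gives a domain free of \<epsilon>, the form in which dominated convergence applies; the condition
  \<open>\<epsilon> * u \<le> r\<close> records \<open>q \<ge> 0\<close>.\<close>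

lemma corr_eq:
  assumes eps: "0 < \<epsilon>"
  shows "corr \<epsilon> y z r = (LINT u:{0..}|lborel. (if \<epsilon> * u \<le> r then \<Phi> u (y r - z (r - \<epsilon> * u)) else 0))"
proof -
  have "(LINT q:{0..r}|lborel. \<Phi> ((r - q) / \<epsilon>) (y r - z q)) =
    \<epsilon> * (LINT u|lborel. indicator {0..r} (r - \<epsilon> * u) * \<Phi> u (y r - z (r - \<epsilon> * u)))"
    unfolding set_lebesgue_integral_def
    by (subst lborel_integral_real_affine[where c="- \<epsilon>" and t=r]) (use eps in auto)
  also have "(LINT u|lborel. indicator {0..r} (r - \<epsilon> * u) * \<Phi> u (y r - z (r - \<epsilon> * u)))
    = (LINT u:{0..}|lborel. (if \<epsilon> * u \<le> r then \<Phi> u (y r - z (r - \<epsilon> * u)) else 0))"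
    unfolding set_lebesgue_integral_def
    by (intro Bochner_Integration.integral_cong) (use eps in \<open>auto simp: indicator_def zero_le_mult_iff\<close>)
  finally show ?thesis using eps by (simp add: corr_def)
qed

end

context mixing_field
begin

lemma corr_joint_meas:
  assumes [measurable]: "(\<lambda>(r, \<omega>). y r \<omega>) \<in> borel_measurable (borel \<Otimes>\<^sub>M N)"
    "(\<lambda>(r, \<omega>). z r \<omega>) \<in> borel_measurable (borel \<Otimes>\<^sub>M N)"
  shows "(\<lambda>(r, \<omega>). corr \<epsilon> (\<lambda>r. y r \<omega>) (\<lambda>r. z r \<omega>) r) \<in> borel_measurable (borel \<Otimes>\<^sub>M N)"
  unfolding corr_def by measurable

text \<open>\<tau> = 1 is meant for a path with itself and \<tau> = 0 for two independent paths.
  Convergence at fixed time and lag is lifted by dominated convergence twice: over the lag with a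
  multiple of \<open>decay\<close> as majorant, then over time with the uniform bound on
  \<open>corr\<close>.\<close>

lemma averaged_corr_tendsto:
  fixes y z :: "nat \<Rightarrow> real \<Rightarrow> 'n \<Rightarrow> real"
  assumes N: "prob_space N"
    and y[measurable]: "\<And>n. (\<lambda>(r, \<omega>). y n r \<omega>) \<in> borel_measurable (borel \<Otimes>\<^sub>M N)"
    and z[measurable]: "\<And>n. (\<lambda>(r, \<omega>). z n r \<omega>) \<in> borel_measurable (borel \<Otimes>\<^sub>M N)"
    and eps: "\<And>n. 0 < \<epsilon> n" "\<epsilon> \<longlonglongrightarrow> 0"
    and H: "\<And>r u. 0 < r \<Longrightarrow> 0 \<le> u \<Longrightarrow>
      (\<lambda>n. LINT \<omega>|N. \<bar>\<Phi> u (y n r \<omega> - z n (r - \<epsilon> n * u) \<omega>) - \<tau> * \<Phi> u 0\<bar>) \<longlonglongrightarrow> 0"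
    and t: "0 \<le> t"
  shows "(\<lambda>n. LINT \<omega>|N. (LINT r:{0..t}|lborel. \<bar>corr (\<epsilon> n) (\<lambda>r. y n r \<omega>) (\<lambda>r. z n r \<omega>) r - \<tau> * \<sigma>\<bar>)) \<longlonglongrightarrow> 0"
    and "integrable N (\<lambda>\<omega>. LINT r:{0..t}|lborel. \<bar>corr (\<epsilon> n) (\<lambda>r. y n r \<omega>) (\<lambda>r. z n r \<omega>) r - \<tau> * \<sigma>\<bar>)"
proof -
  interpret N: prob_space N by fact
  interpret LN: pair_sigma_finite lborel N ..
  define k where "k = (\<lambda>n r \<omega>. corr (\<epsilon> n) (\<lambda>r. y n r \<omega>) (\<lambda>r. z n r \<omega>) r)"
  have k_meas[measurable]: "(\<lambda>(r, \<omega>). k n r \<omega>) \<in> borel_measurable (borel \<Otimes>\<^sub>M N)" for n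
    unfolding k_def by (rule corr_joint_meas) measurable
  define b where "b = 2 * K\<^sup>2 * A / \<eta> + \<bar>\<tau> * \<sigma>\<bar>"
  have kb: "\<bar>\<bar>k n r \<omega> - \<tau> * \<sigma>\<bar>\<bar> \<le> b" if "0 \<le> r" for n r \<omega>
    using corr_bound[OF that eps(1)[of n], of "\<lambda>r. y n r \<omega>" "\<lambda>r. z n r \<omega>"] unfolding k_def b_def by linarith
  have b0: "0 \<le> b" unfolding b_def using A eta by simp
  show int: "integrable N (\<lambda>\<omega>. LINT r:{0..t}|lborel. \<bar>k n r \<omega> - \<tau> * \<sigma>\<bar>)" for n
  proof (rule N.integrable_const_bound[where B="b * (t - 0)"])
    show "(\<lambda>\<omega>. LINT r:{0..t}|lborel. \<bar>k n r \<omega> - \<tau> * \<sigma>\<bar>) \<in> borel_measurable N"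
      by (rule N.Fubini_Icc(2)[where k=b]) (use kb in auto)
    show "AE \<omega> in N. norm (LINT r:{0..t}|lborel. \<bar>k n r \<omega> - \<tau> * \<sigma>\<bar>) \<le> b * (t - 0)"
      unfolding real_norm_def by (intro AE_I2 abs_set_integral_Icc_bounded t) (use kb in auto)
  qed
  define M0 where "M0 = 2 * K\<^sup>2 * A"
  have M0: "0 \<le> M0" unfolding M0_def using A by simp
  have PM: "\<bar>\<Phi> u x\<bar> \<le> \<bar>M0 * decay \<eta> u\<bar>" if "0 \<le> u" for u x
    using Phi_decay[OF that, of x] unfolding M0_def by linarith
  have idecay: "integrable lborel (\<lambda>u. indicator {0..} u * ((1 + \<bar>\<tau>\<bar>) * M0 * decay \<eta> u))"
    using set_integrable_mult_right[OF decay_integrable, of "(1 + \<bar>\<tau>\<bar>) * M0"] by (simp add: set_integrable_def)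
  have step1: "(\<lambda>n. LINT \<omega>|N. \<bar>k n r \<omega> - \<tau> * \<sigma>\<bar>) \<longlonglongrightarrow> 0" if r: "0 < r" for r
  proof -
    \<comment> \<open>The absolute difference between the integrand of \<open>corr_eq\<close> and
      \<tau> times that of \<sigma>; its integral over the lag bounds
      \<open>\<bar>k n r \<omega> - \<tau> * \<sigma>\<bar>\<close>.\<close>
    define a where "a = (\<lambda>n u \<omega>. indicator {0..} u * \<bar>(if \<epsilon> n * u \<le> r then \<Phi> u (y n r \<omega> - z n (r - \<epsilon> n * u) \<omega>) else 0) - \<tau> * \<Phi> u 0\<bar> :: real)"
    have a_meas[measurable]: "(\<lambda>(u, \<omega>). a n u \<omega>) \<in> borel_measurable (borel \<Otimes>\<^sub>M N)" for n
      unfolding a_def by measurable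
    have ab: "\<bar>a n u \<omega>\<bar> \<le> indicator {0..} u * ((1 + \<bar>\<tau>\<bar>) * M0 * decay \<eta> u)" for n u \<omega>
    proof (cases "0 \<le> u")
      case True
      have d0: "0 \<le> decay \<eta> u" using decay_bounds[OF eta True] by simp
      have "\<bar>if \<epsilon> n * u \<le> r then \<Phi> u (y n r \<omega> - z n (r - \<epsilon> n * u) \<omega>) else 0\<bar> \<le> M0 * decay \<eta> u"
        using Phi_decay[OF True] M0 d0 by (simp add: M0_def)
      moreover have "\<bar>\<tau> * \<Phi> u 0\<bar> \<le> \<bar>\<tau>\<bar> * (M0 * decay \<eta> u)"
        unfolding abs_mult using Phi_decay[OF True, of 0] by (intro mult_left_mono) (auto simp: M0_def)
      ultimately show ?thesis using True unfolding a_def by (simp add: algebra_simps)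
    qed (simp add: a_def)
    have ia: "integrable (lborel \<Otimes>\<^sub>M N) (\<lambda>(u, \<omega>). a n u \<omega>)" for n
    proof (rule LN.Fubini_integrable)
      show "(\<lambda>(u, \<omega>). a n u \<omega>) \<in> borel_measurable (lborel \<Otimes>\<^sub>M N)" using a_meas by simp
      have iN: "integrable N (a n u)" for u
        by (rule N.integrable_const_bound[where B="indicator {0..} u * ((1 + \<bar>\<tau>\<bar>) * M0 * decay \<eta> u)"])
           (use ab in auto)
      then show "AE u in lborel. integrable N (\<lambda>\<omega>. case (u, \<omega>) of (u, \<omega>) \<Rightarrow> a n u \<omega>)" by simp
      show "integrable lborel (\<lambda>u. LINT \<omega>|N. norm (case (u, \<omega>) of (u, \<omega>) \<Rightarrow> a n u \<omega>))"
      proof (rule Bochner_Integration.integrable_bound[OF idecay])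
        show "AE u in lborel. norm (LINT \<omega>|N. norm (case (u, \<omega>) of (u, \<omega>) \<Rightarrow> a n u \<omega>)) \<le>
            norm (indicator {0..} u * ((1 + \<bar>\<tau>\<bar>) * M0 * decay \<eta> u))"
        proof (rule AE_I2)
          fix u
          have "\<bar>LINT \<omega>|N. \<bar>a n u \<omega>\<bar>\<bar> \<le> (LINT \<omega>|N. indicator {0..} u * ((1 + \<bar>\<tau>\<bar>) * M0 * decay \<eta> u))"
            by (rule abs_integral_le) (use ab in auto)
          then show "norm (LINT \<omega>|N. norm (case (u, \<omega>) of (u, \<omega>) \<Rightarrow> a n u \<omega>)) \<le>
            norm (indicator {0..} u * ((1 + \<bar>\<tau>\<bar>) * M0 * decay \<eta> u))" by (simp add: N.prob_space)
        qed
      qed measurable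
    qed
    have k_le: "\<bar>k n r \<omega> - \<tau> * \<sigma>\<bar> \<le> (LINT u|lborel. a n u \<omega>)" if \<omega>: "\<omega> \<in> space N" for n \<omega>
    proof -
      have [measurable]: "(\<lambda>r. z n r \<omega>) \<in> borel_measurable borel" using \<omega> by measurable
      have i1: "set_integrable lborel {0..} (\<lambda>u. if \<epsilon> n * u \<le> r then \<Phi> u (y n r \<omega> - z n (r - \<epsilon> n * u) \<omega>) else 0)"
        unfolding set_integrable_def
      proof (rule Bochner_Integration.integrable_bound[OF decay_integrable[THEN set_integrable_mult_right, of M0, unfolded set_integrable_def]])
        show "AE u in lborel. norm (indicator {0..} u *\<^sub>R (if \<epsilon> n * u \<le> r then \<Phi> u (y n r \<omega> - z n (r - \<epsilon> n * u) \<omega>) else 0)) \<le> norm (indicator {0..} u *\<^sub>R (M0 * decay \<eta> u))"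
          using PM by (intro AE_I2) (auto simp: indicator_def)
      qed measurable
      have i2: "set_integrable lborel {0..} (\<lambda>u. \<Phi> u 0)"
        unfolding set_integrable_def
      proof (rule Bochner_Integration.integrable_bound[OF decay_integrable[THEN set_integrable_mult_right, of M0, unfolded set_integrable_def]])
        show "AE u in lborel. norm (indicator {0..} u *\<^sub>R \<Phi> u 0) \<le> norm (indicator {0..} u *\<^sub>R (M0 * decay \<eta> u))"
          using PM by (intro AE_I2) (auto simp: indicator_def)
      qed measurable
      have "k n r \<omega> - \<tau> * \<sigma> = (LINT u:{0..}|lborel. (if \<epsilon> n * u \<le> r then \<Phi> u (y n r \<omega> - z n (r - \<epsilon> n * u) \<omega>) else 0) - \<tau> * \<Phi> u 0)"
        unfolding k_def corr_eq[OF eps(1)] \<sigma>_def using i1 i2 by (subst set_integral_diff(2)) auto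
      then have "\<bar>k n r \<omega> - \<tau> * \<sigma>\<bar> \<le> (LINT u|lborel. \<bar>indicator {0..} u *\<^sub>R ((if \<epsilon> n * u \<le> r then \<Phi> u (y n r \<omega> - z n (r - \<epsilon> n * u) \<omega>) else 0) - \<tau> * \<Phi> u 0)\<bar>)"
        unfolding set_lebesgue_integral_def by (simp only: integral_abs_bound)
      also have "\<dots> = (LINT u|lborel. a n u \<omega>)"
        unfolding a_def by (intro Bochner_Integration.integral_cong) (auto simp: indicator_def)
      finally show ?thesis .
    qed
    have "(\<lambda>n. LINT u|lborel. (LINT \<omega>|N. a n u \<omega>)) \<longlonglongrightarrow> (LINT u|(lborel :: real measure). (0::real))"
    proof (rule integral_dominated_convergence[where w="\<lambda>u. indicator {0..} u * ((1 + \<bar>\<tau>\<bar>) * M0 * decay \<eta> u)"])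
      show "integrable lborel (\<lambda>u. indicator {0..} u * ((1 + \<bar>\<tau>\<bar>) * M0 * decay \<eta> u))" by (rule idecay)
      show "AE u in lborel. norm (LINT \<omega>|N. a n u \<omega>) \<le> indicator {0..} u * ((1 + \<bar>\<tau>\<bar>) * M0 * decay \<eta> u)" for n
      proof (rule AE_I2)
        fix u
        have "\<bar>LINT \<omega>|N. a n u \<omega>\<bar> \<le> (LINT \<omega>|N. indicator {0..} u * ((1 + \<bar>\<tau>\<bar>) * M0 * decay \<eta> u))"
          by (rule abs_integral_le) (use ab in auto)
        then show "norm (LINT \<omega>|N. a n u \<omega>) \<le> indicator {0..} u * ((1 + \<bar>\<tau>\<bar>) * M0 * decay \<eta> u)" by (simp add: N.prob_space)
      qed
      show "AE u in lborel. (\<lambda>n. LINT \<omega>|N. a n u \<omega>) \<longlonglongrightarrow> 0"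
      proof (rule AE_I2)
        fix u :: real
        show "(\<lambda>n. LINT \<omega>|N. a n u \<omega>) \<longlonglongrightarrow> 0"
        proof (cases "0 \<le> u")
          case True
          have "(\<lambda>n. \<epsilon> n * u) \<longlonglongrightarrow> 0 * u" by (intro tendsto_intros eps)
          \<comment> \<open>For fixed \<open>u\<close> and \<open>r > 0\<close> the truncation of
            the lag is eventually inactive; the time \<open>r = 0\<close> is a null set.\<close>
          then have "\<forall>\<^sub>F n in sequentially. \<epsilon> n * u < r" using r by (simp add: order_tendstoD)
          then have "\<forall>\<^sub>F n in sequentially. (LINT \<omega>|N. \<bar>\<Phi> u (y n r \<omega> - z n (r - \<epsilon> n * u) \<omega>) - \<tau> * \<Phi> u 0\<bar>) = (LINT \<omega>|N. a n u \<omega>)"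
            by eventually_elim (simp add: a_def True)
          then show ?thesis by (rule Lim_transform_eventually[OF H[OF r True]])
        qed (simp add: a_def)
      qed
    qed measurable
    then have lim: "(\<lambda>n. LINT u|lborel. (LINT \<omega>|N. a n u \<omega>)) \<longlonglongrightarrow> 0" by simp
    show ?thesis
    proof (rule tendsto_sandwich[OF _ _ tendsto_const lim])
      show "\<forall>\<^sub>F n in sequentially. 0 \<le> (LINT \<omega>|N. \<bar>k n r \<omega> - \<tau> * \<sigma>\<bar>)" by simp
      show "\<forall>\<^sub>F n in sequentially. (LINT \<omega>|N. \<bar>k n r \<omega> - \<tau> * \<sigma>\<bar>) \<le> (LINT u|lborel. (LINT \<omega>|N. a n u \<omega>))"
      proof (rule always_eventually, rule allI)
        fix n
        have "(LINT \<omega>|N. \<bar>k n r \<omega> - \<tau> * \<sigma>\<bar>) \<le> (LINT \<omega>|N. (LINT u|lborel. a n u \<omega>))"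
        proof (rule integral_mono[OF _ _ k_le])
          show "integrable N (\<lambda>\<omega>. \<bar>k n r \<omega> - \<tau> * \<sigma>\<bar>)"
            by (rule N.integrable_const_bound[where B=b]) (use kb r in auto)
          show "integrable N (\<lambda>\<omega>. LINT u|lborel. a n u \<omega>)" using LN.integrable_snd[OF ia] by simp
        qed
        also have "\<dots> = (LINT u|lborel. (LINT \<omega>|N. a n u \<omega>))" by (rule LN.Fubini_integral[OF ia])
        finally show "(LINT \<omega>|N. \<bar>k n r \<omega> - \<tau> * \<sigma>\<bar>) \<le> (LINT u|lborel. (LINT \<omega>|N. a n u \<omega>))" .
      qed
    qed
  qed
  have fub: "(LINT \<omega>|N. (LINT r:{0..t}|lborel. \<bar>k n r \<omega> - \<tau> * \<sigma>\<bar>)) = (LINT r:{0..t}|lborel. (LINT \<omega>|N. \<bar>k n r \<omega> - \<tau> * \<sigma>\<bar>))" for n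
    by (rule N.Fubini_Icc(1)[where k=b]) (use kb in auto)
  have "(\<lambda>n. LINT r:{0..t}|lborel. (LINT \<omega>|N. \<bar>k n r \<omega> - \<tau> * \<sigma>\<bar>)) \<longlonglongrightarrow> (LINT r|(lborel :: real measure). (0::real))"
    unfolding set_lebesgue_integral_def
  proof (rule integral_dominated_convergence[where w="\<lambda>r. indicator {0..t} r * b"])
    show "integrable lborel (\<lambda>r. indicator {0..t} r * b)"
      by (intro integrable_mult_left integrable_real_indicator) (auto simp: emeasure_lborel_Icc_eq)
    show "AE r in lborel. (\<lambda>n. indicator {0..t} r *\<^sub>R (LINT \<omega>|N. \<bar>k n r \<omega> - \<tau> * \<sigma>\<bar>)) \<longlonglongrightarrow> 0"
      using AE_lborel_singleton[of "0::real"]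
    proof eventually_elim
      case (elim r)
      then show ?case
        using tendsto_scaleR[OF tendsto_const step1[of r], of "indicator {0..t} r"] by (cases "0 < r") auto
    qed
    show "AE r in lborel. norm (indicator {0..t} r *\<^sub>R (LINT \<omega>|N. \<bar>k n r \<omega> - \<tau> * \<sigma>\<bar>)) \<le> indicator {0..t} r * b" for n
    proof (rule AE_I2)
      fix r
      have "\<bar>LINT \<omega>|N. \<bar>k n r \<omega> - \<tau> * \<sigma>\<bar>\<bar> \<le> (LINT \<omega>|N. b)" if "0 \<le> r"
        by (rule abs_integral_le) (use kb that in auto)
      then show "norm (indicator {0..t} r *\<^sub>R (LINT \<omega>|N. \<bar>k n r \<omega> - \<tau> * \<sigma>\<bar>)) \<le> indicator {0..t} r * b"
        by (auto simp: indicator_def N.prob_space)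
    qed
  qed measurable
  then show "(\<lambda>n. LINT \<omega>|N. (LINT r:{0..t}|lborel. \<bar>k n r \<omega> - \<tau> * \<sigma>\<bar>)) \<longlonglongrightarrow> 0"
    unfolding fub by simp
qed

end

section \<open>Averaging over Brownian paths\<close>

lemma distr_pair_snd:
  assumes "prob_space M" "prob_space N"
  shows "distr (M \<Otimes>\<^sub>M N) N snd = N"
proof -
  interpret M: prob_space M by fact
  interpret N: prob_space N by fact
  interpret pair_sigma_finite M N ..
  show ?thesis
  proof (rule measure_eqI)
    fix A assume "A \<in> sets (distr (M \<Otimes>\<^sub>M N) N snd)"
    then have A: "A \<in> sets N" by simp
    have "snd -` A \<inter> space (M \<Otimes>\<^sub>M N) = space M \<times> A"
      using sets.sets_into_space[OF A] by (auto simp: space_pair_measure)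
    then show "emeasure (distr (M \<Otimes>\<^sub>M N) N snd) A = emeasure N A"
      using A by (simp add: emeasure_distr N.emeasure_pair_measure_Times M.emeasure_space_1)
  qed simp
qed

lemma prob_space_pair:
  assumes "prob_space M" "prob_space N"
  shows "prob_space (M \<Otimes>\<^sub>M N)"
proof -
  interpret M: prob_space M by fact
  interpret N: prob_space N by fact
  interpret pair_prob_space M N ..
  show ?thesis by unfold_locales
qed

lemma pair_marginals:
  fixes f :: "'a \<Rightarrow> real" and h :: "'b \<Rightarrow> real"
  assumes "prob_space M" "prob_space N"
  shows "f \<in> borel_measurable M \<Longrightarrow> (LINT p|(M \<Otimes>\<^sub>M N). f (fst p)) = integral\<^sup>L M f"
    and "h \<in> borel_measurable N \<Longrightarrow> (LINT p|(M \<Otimes>\<^sub>M N). h (snd p)) = integral\<^sup>L N h"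
    and "integrable M f \<Longrightarrow> integrable (M \<Otimes>\<^sub>M N) (\<lambda>p. f (fst p))"
    and "integrable N h \<Longrightarrow> integrable (M \<Otimes>\<^sub>M N) (\<lambda>p. h (snd p))"
proof -
  note d1 = prob_space.distr_pair_fst[OF assms(2), of M] and d2 = distr_pair_snd[OF assms]
  show "f \<in> borel_measurable M \<Longrightarrow> (LINT p|(M \<Otimes>\<^sub>M N). f (fst p)) = integral\<^sup>L M f"
    using integral_distr[of fst "M \<Otimes>\<^sub>M N" M f] by (simp add: d1)
  show "h \<in> borel_measurable N \<Longrightarrow> (LINT p|(M \<Otimes>\<^sub>M N). h (snd p)) = integral\<^sup>L N h"
    using integral_distr[of snd "M \<Otimes>\<^sub>M N" N h] by (simp add: d2)
  show "integrable M f \<Longrightarrow> integrable (M \<Otimes>\<^sub>M N) (\<lambda>p. f (fst p))"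
    using integrable_distr[of fst "M \<Otimes>\<^sub>M N" M f] by (simp add: d1)
  show "integrable N h \<Longrightarrow> integrable (M \<Otimes>\<^sub>M N) (\<lambda>p. h (snd p))"
    using integrable_distr[of snd "M \<Otimes>\<^sub>M N" N h] by (simp add: d2)
qed

text \<open>Rounding the time down to a multiple of 1/(n + 1) leaves countably many measurable
  pieces; path continuity gives the limit. Clamping at 0 extends the motion to all real
  times.\<close>

lemma brownian_joint_measurable:
  assumes B: "standard_brownian_motion W B"
  shows "(\<lambda>(r, \<omega>). B (max 0 r) \<omega>) \<in> borel_measurable (borel \<Otimes>\<^sub>M W)"
proof (rule borel_measurable_LIMSEQ_real)
  let ?f = "\<lambda>n p. B (real (nat \<lfloor>real (Suc n) * max 0 (fst p)\<rfloor>) / real (Suc n)) (snd p)"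
  have [measurable]: "0 \<le> r \<Longrightarrow> B r \<in> borel_measurable W" for r
    using B by (simp add: standard_brownian_motion_def)
  show "?f n \<in> borel_measurable (borel \<Otimes>\<^sub>M W)" for n
  proof (rule measurable_compose_countable[where f="\<lambda>i p. B (real i / real (Suc n)) (snd p)"])
    show "(\<lambda>p. B (real i / real (Suc n)) (snd p)) \<in> borel_measurable (borel \<Otimes>\<^sub>M W)" for i
      by (rule measurable_compose[OF measurable_snd]) measurable
    show "(\<lambda>p. nat \<lfloor>real (Suc n) * max 0 (fst p)\<rfloor>) \<in> borel \<Otimes>\<^sub>M W \<rightarrow>\<^sub>M count_space UNIV"
      by measurable
  qed
  fix p assume p: "p \<in> space (borel \<Otimes>\<^sub>M W :: (real \<times> _) measure)"
  define r where "r = max 0 (fst p)"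
  have r: "0 \<le> r" by (simp add: r_def)
  have cont: "continuous_on {0..} (\<lambda>t. B t (snd p))"
    using B p by (auto simp: standard_brownian_motion_def space_pair_measure)
  have "(\<lambda>n. real (nat \<lfloor>real (Suc n) * r\<rfloor>) / real (Suc n)) \<longlonglongrightarrow> r"
  proof (rule tendsto_sandwich)
    show "\<forall>\<^sub>F n in sequentially. r - 1 / real (Suc n) \<le> real (nat \<lfloor>real (Suc n) * r\<rfloor>) / real (Suc n)"
    proof (rule always_eventually, rule allI)
      fix n
      have "real (Suc n) * r - 1 \<le> real (nat \<lfloor>real (Suc n) * r\<rfloor>)" using r by linarith
      then show "r - 1 / real (Suc n) \<le> real (nat \<lfloor>real (Suc n) * r\<rfloor>) / real (Suc n)"
        using divide_right_mono[of "real (Suc n) * r - 1" _ "real (Suc n)"]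
        by (simp add: diff_divide_distrib del: of_nat_Suc)
    qed
    show "\<forall>\<^sub>F n in sequentially. real (nat \<lfloor>real (Suc n) * r\<rfloor>) / real (Suc n) \<le> r"
    proof (rule always_eventually, rule allI)
      fix n
      have "real (nat \<lfloor>real (Suc n) * r\<rfloor>) \<le> real (Suc n) * r" using r by simp
      then show "real (nat \<lfloor>real (Suc n) * r\<rfloor>) / real (Suc n) \<le> r"
        by (simp add: divide_le_eq mult.commute del: of_nat_Suc)
    qed
    have "(\<lambda>n. 1 / real (Suc n)) \<longlonglongrightarrow> 0" using LIMSEQ_inverse_real_of_nat by (simp add: inverse_eq_divide)
    then show "(\<lambda>n. r - 1 / real (Suc n)) \<longlonglongrightarrow> r" using tendsto_diff[OF tendsto_const[of r]] by fastforce
  qed simp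
  then have "(\<lambda>n. B (real (nat \<lfloor>real (Suc n) * r\<rfloor>) / real (Suc n)) (snd p)) \<longlonglongrightarrow> B r (snd p)"
    by (rule continuous_on_tendsto_compose[OF cont]) (use r in auto)
  then show "(\<lambda>n. ?f n p) \<longlonglongrightarrow> (case p of (r, \<omega>) \<Rightarrow> B (max 0 r) \<omega>)"
    by (simp add: r_def split_beta)
qed

locale field_and_motion = mixing_field M c K A \<eta> + W: prob_space W
  for M :: "'s measure" and c K A \<eta> and W :: "'w measure" +
  fixes B :: "real \<Rightarrow> 'w \<Rightarrow> real" and g :: "real \<Rightarrow> real" and \<beta> x :: real
  assumes B_meas [measurable]: "(\<lambda>(r, \<omega>). B r \<omega>) \<in> borel_measurable (borel \<Otimes>\<^sub>M W)"
    and B_0: "\<omega> \<in> space W \<Longrightarrow> B 0 \<omega> = 0"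
    and B_incr: "0 \<le> s \<Longrightarrow> s < t \<Longrightarrow>
      distributed W lborel (\<lambda>\<omega>. B t \<omega> - B s \<omega>) (normal_density 0 (sqrt (t - s)))"
    and g_meas [measurable]: "g \<in> borel_measurable borel"
    and beta: "0 < \<beta>" "\<beta> < 1 / 2"
begin

lemma B_compose_meas [measurable (raw)]:
  assumes "f \<in> borel_measurable N" "h \<in> N \<rightarrow>\<^sub>M W"
  shows "(\<lambda>x. B (f x) (h x)) \<in> borel_measurable N"
proof -
  have "(\<lambda>x. (f x, h x)) \<in> N \<rightarrow>\<^sub>M borel \<Otimes>\<^sub>M W" using assms by measurable
  from measurable_compose[OF this B_meas] show ?thesis by simp
qed

definition path :: "real \<Rightarrow> 'w \<Rightarrow> real \<Rightarrow> real" where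
  "path \<epsilon> \<omega> r = (x + B r \<omega>) / \<epsilon> powr \<beta>"

lemma path_compose_meas [measurable (raw)]:
  assumes [measurable]: "f \<in> borel_measurable N" "h \<in> N \<rightarrow>\<^sub>M W"
  shows "(\<lambda>x. path \<epsilon> (h x) (f x)) \<in> borel_measurable N"
  unfolding path_def by measurable

lemma expectation_normal:
  assumes [measurable]: "f \<in> borel_measurable borel" and "0 \<le> s" "s < t"
  shows "(LINT \<omega>|W. f (B t \<omega> - B s \<omega>)) = (LINT v|lborel. normal_density 0 (sqrt (t - s)) v * f v)"
  by (rule distributed_integral[OF B_incr, symmetric]) (use assms in auto)

text \<open>Rescaling to the standard density moves the time lag into the argument of
  \<open>f\<close>, so that the majorant in the limit below does not depend on \<epsilon>.\<close>

lemma expectation_std_normal: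
  fixes f :: "real \<Rightarrow> real"
  assumes [measurable]: "f \<in> borel_measurable borel" and "0 \<le> s" "s < t"
  shows "(LINT \<omega>|W. f (B t \<omega> - B s \<omega>)) = (LINT v|lborel. std_normal_density v * f (sqrt (t - s) * v))"
proof -
  have pos: "0 < sqrt (t - s)" using assms by simp
  have "(LINT \<omega>|W. f (B t \<omega> - B s \<omega>)) =
    sqrt (t - s) * (LINT v|lborel. normal_density 0 (sqrt (t - s)) (sqrt (t - s) * v) * f (sqrt (t - s) * v))"
    unfolding expectation_normal[OF assms]
    by (subst lborel_integral_real_affine[where c="sqrt (t - s)" and t=0]) (use pos in auto)
  also have "\<dots> = (LINT v|lborel. sqrt (t - s) * (normal_density 0 (sqrt (t - s)) (sqrt (t - s) * v) * f (sqrt (t - s) * v)))"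
    by simp
  also have "\<dots> = (LINT v|lborel. std_normal_density v * f (sqrt (t - s) * v))"
  proof (rule Bochner_Integration.integral_cong[OF refl])
    fix v
    have "a * normal_density 0 a (a * v) = std_normal_density v" if "0 < a" for a
      using that by (simp add: normal_density_def power_mult_distrib real_sqrt_mult)
    from this[OF pos] show "sqrt (t - s) * (normal_density 0 (sqrt (t - s)) (sqrt (t - s) * v) * f (sqrt (t - s) * v)) = std_normal_density v * f (sqrt (t - s) * v)"
      by (simp only: mult.assoc[symmetric])
  qed
  finally show ?thesis .
qed

text \<open>In units of \<epsilon>^\<beta> the increment over the lag
  \<open>\<epsilon> n * u\<close> is Gaussian with standard deviation \<open>s n\<close>, of order
  \<epsilon>^(1/2 - \<beta>); it tends to 0 because \<open>\<beta> < 1 / 2\<close>, and the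
  continuity of \<open>\<psi>\<close> at 0 takes over.\<close>

lemma own_pointwise:
  assumes eps: "\<And>n. 0 < \<epsilon> n" "\<epsilon> \<longlonglongrightarrow> 0" and r: "0 < r" "0 \<le> u"
  shows "(\<lambda>n. LINT \<omega>|W. \<bar>\<Phi> u (path (\<epsilon> n) \<omega> r - path (\<epsilon> n) \<omega> (r - \<epsilon> n * u)) - 1 * \<Phi> u 0\<bar>) \<longlonglongrightarrow> 0"
proof (cases "u = 0")
  case False
  then have u: "0 < u" using r by simp
  define s where "s = (\<lambda>n. sqrt u * \<epsilon> n powr (1 / 2 - \<beta>))"
  have "(\<lambda>n. \<epsilon> n powr (1 / 2 - \<beta>)) \<longlonglongrightarrow> 0 powr (1 / 2 - \<beta>)"
    by (rule tendsto_powr2) (use eps beta in \<open>auto intro!: less_imp_le always_eventually\<close>)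
  from tendsto_mult_left[OF this, of "sqrt u"] have s0: "s \<longlonglongrightarrow> 0" by (simp add: s_def)
  have lim: "(\<lambda>n. LINT v|lborel. std_normal_density v * (K * \<psi> (s n * v))) \<longlonglongrightarrow> (LINT v|(lborel :: real measure). 0)"
  proof (rule integral_dominated_convergence[where w="\<lambda>v. std_normal_density v * (K * (2 * K))"])
    show "integrable lborel (\<lambda>v. std_normal_density v * (K * (2 * K)))"
      by (rule integrable_mult_left) (simp add: integrable_normal_density)
    show "AE v in lborel. (\<lambda>n. std_normal_density v * (K * \<psi> (s n * v))) \<longlonglongrightarrow> 0"
    proof (rule AE_I2)
      fix v
      have "(\<lambda>n. s n * v) \<longlonglongrightarrow> 0" using tendsto_mult_right[OF s0, of v] by simp
      from tendsto_mult_left[OF tendsto_mult_left[OF psi_tendsto_0[OF this], of K], of "std_normal_density v"]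
      show "(\<lambda>n. std_normal_density v * (K * \<psi> (s n * v))) \<longlonglongrightarrow> 0" by simp
    qed
    show "AE v in lborel. norm (std_normal_density v * (K * \<psi> (s n * v))) \<le> std_normal_density v * (K * (2 * K))" for n
      using psi_bounds K0 by (intro AE_I2) (auto simp: abs_mult intro!: mult_left_mono)
  qed measurable
  show ?thesis
  proof (rule tendsto_sandwich[OF _ _ tendsto_const lim[simplified]])
    have "(\<lambda>n. \<epsilon> n * u) \<longlonglongrightarrow> 0 * u" by (intro tendsto_intros eps)
    then have "\<forall>\<^sub>F n in sequentially. \<epsilon> n * u < r" using r by (simp add: order_tendstoD)
    then show "\<forall>\<^sub>F n in sequentially. (LINT \<omega>|W. \<bar>\<Phi> u (path (\<epsilon> n) \<omega> r - path (\<epsilon> n) \<omega> (r - \<epsilon> n * u)) - 1 * \<Phi> u 0\<bar>)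
        \<le> (LINT v|lborel. std_normal_density v * (K * \<psi> (s n * v)))"
    proof eventually_elim
      case (elim n)
      have en: "0 < \<epsilon> n * u" using eps u by simp
      have b: "\<bar>K * \<psi> v\<bar> \<le> K * (2 * K)" for v using psi_bounds[of v] K0 by (auto simp: abs_mult intro!: mult_left_mono)
      have "\<bar>LINT \<omega>|W. \<bar>\<Phi> u (path (\<epsilon> n) \<omega> r - path (\<epsilon> n) \<omega> (r - \<epsilon> n * u)) - 1 * \<Phi> u 0\<bar>\<bar>
        \<le> (LINT \<omega>|W. K * \<psi> ((B r \<omega> - B (r - \<epsilon> n * u) \<omega>) / \<epsilon> n powr \<beta>))"
      proof (rule abs_integral_le)
        show "integrable W (\<lambda>\<omega>. K * \<psi> ((B r \<omega> - B (r - \<epsilon> n * u) \<omega>) / \<epsilon> n powr \<beta>))"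
          by (rule W.integrable_const_bound[where B="K * (2 * K)"]) (use b in \<open>auto simp del: abs_mult\<close>)
        fix \<omega>
        have "path (\<epsilon> n) \<omega> r - path (\<epsilon> n) \<omega> (r - \<epsilon> n * u) = (B r \<omega> - B (r - \<epsilon> n * u) \<omega>) / \<epsilon> n powr \<beta>"
          by (simp add: path_def flip: diff_divide_distrib)
        then show "\<bar>\<bar>\<Phi> u (path (\<epsilon> n) \<omega> r - path (\<epsilon> n) \<omega> (r - \<epsilon> n * u)) - 1 * \<Phi> u 0\<bar>\<bar> \<le> K * \<psi> ((B r \<omega> - B (r - \<epsilon> n * u) \<omega>) / \<epsilon> n powr \<beta>)"
          using Phi_psi[OF r(2)] by simp
      qed
      also have "\<dots> = (LINT v|lborel. std_normal_density v * (K * \<psi> (sqrt (r - (r - \<epsilon> n * u)) * v / \<epsilon> n powr \<beta>)))"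
        by (rule expectation_std_normal[where f="\<lambda>v. K * \<psi> (v / \<epsilon> n powr \<beta>)"]) (use elim en in auto)
      also have "(\<lambda>v. sqrt (r - (r - \<epsilon> n * u)) * v / \<epsilon> n powr \<beta>) = (\<lambda>v. s n * v)"
        using eps(1)[of n] by (simp add: s_def powr_diff real_sqrt_mult powr_half_sqrt mult_ac)
      finally show ?case by linarith
    qed
  qed simp
qed simp

section \<open>Decorrelation of two independent paths\<close>

definition J :: real where "J = (LINT v|lborel. decay \<eta> \<bar>v\<bar>)"

lemma decay_abs_integrable: "integrable lborel (\<lambda>v. decay \<eta> \<bar>v\<bar>)"
proof -
  have i: "integrable lborel (\<lambda>v. indicator {0..} v * decay \<eta> v)"
    using decay_integrable by (simp add: set_integrable_def)
  from lborel_integrable_real_affine[OF this, of "-1" 0]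
  have "integrable lborel (\<lambda>v. indicator {0..} (- v) * decay \<eta> (- v))" by simp
  from Bochner_Integration.integrable_add[OF i this] show ?thesis
  proof (rule Bochner_Integration.integrable_bound)
    show "AE v in lborel. norm (decay \<eta> \<bar>v\<bar>) \<le> norm (indicator {0..} v * decay \<eta> v + indicator {0..} (- v) * decay \<eta> (- v))"
      using decay_bounds(1)[OF eta] by (intro AE_I2) (auto simp: indicator_def abs_if not_le)
  qed measurable
qed

text \<open>The Gaussian density at time \<open>r\<close> is at most 1/sqrt(2 pi r), and the window
  around \<open>b\<close> has width of order \<epsilon>^\<beta>. The bound is uniform in
  \<open>b\<close>, which will be the position of the other path.\<close>

lemma expectation_decay:
  assumes e: "0 < \<epsilon>" and r: "0 < r"
  shows "(LINT \<omega>|W. decay \<eta> \<bar>(B r \<omega> - b) / \<epsilon> powr \<beta>\<bar>) \<le> \<epsilon> powr \<beta> * J / sqrt (2 * pi * r)"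
proof -
  have ep: "0 < \<epsilon> powr \<beta>" using e by simp
  have i: "integrable lborel (\<lambda>v. decay \<eta> \<bar>- b / \<epsilon> powr \<beta> + 1 / \<epsilon> powr \<beta> * v\<bar>)"
    by (rule lborel_integrable_real_affine[OF decay_abs_integrable]) (use ep in simp)
  have eq: "- b / \<epsilon> powr \<beta> + 1 / \<epsilon> powr \<beta> * v = (v - b) / \<epsilon> powr \<beta>" for v by (simp add: diff_divide_distrib)
  have "(LINT \<omega>|W. decay \<eta> \<bar>(B r \<omega> - b) / \<epsilon> powr \<beta>\<bar>) = (LINT \<omega>|W. decay \<eta> \<bar>(B r \<omega> - B 0 \<omega> - b) / \<epsilon> powr \<beta>\<bar>)"
    by (rule Bochner_Integration.integral_cong) (auto simp: B_0)
  also have "\<dots> = (LINT v|lborel. normal_density 0 (sqrt (r - 0)) v * decay \<eta> \<bar>(v - b) / \<epsilon> powr \<beta>\<bar>)"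
    by (rule expectation_normal[where f="\<lambda>v. decay \<eta> \<bar>(v - b) / \<epsilon> powr \<beta>\<bar>"]) (use r in auto)
  also have "\<dots> \<le> \<bar>\<dots>\<bar>" by (rule abs_ge_self)
  also have "\<dots> \<le> (LINT v|lborel. 1 / sqrt (2 * pi * r) * decay \<eta> \<bar>(v - b) / \<epsilon> powr \<beta>\<bar>)"
  proof (rule abs_integral_le)
    show "integrable lborel (\<lambda>v. 1 / sqrt (2 * pi * r) * decay \<eta> \<bar>(v - b) / \<epsilon> powr \<beta>\<bar>)"
      using i unfolding eq by (rule integrable_mult_right)
    fix v
    have "normal_density 0 (sqrt (r - 0)) v \<le> 1 / sqrt (2 * pi * r)"
      using r by (simp add: normal_density_def divide_right_mono)
    then show "\<bar>normal_density 0 (sqrt (r - 0)) v * decay \<eta> \<bar>(v - b) / \<epsilon> powr \<beta>\<bar>\<bar> \<le> 1 / sqrt (2 * pi * r) * decay \<eta> \<bar>(v - b) / \<epsilon> powr \<beta>\<bar>"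
      using decay_bounds(1)[OF eta, of "\<bar>(v - b) / \<epsilon> powr \<beta>\<bar>"] r
      by (simp only: abs_mult) (intro mult_mono, auto)
  qed
  also have "\<dots> = 1 / sqrt (2 * pi * r) * (LINT v|lborel. decay \<eta> \<bar>- b / \<epsilon> powr \<beta> + 1 / \<epsilon> powr \<beta> * v\<bar>)"
    unfolding eq by simp
  also have "(LINT v|lborel. decay \<eta> \<bar>- b / \<epsilon> powr \<beta> + 1 / \<epsilon> powr \<beta> * v\<bar>) = \<epsilon> powr \<beta> * J"
    unfolding J_def using ep by (subst (2) lborel_integral_real_affine[where c="1 / \<epsilon> powr \<beta>" and t="- b / \<epsilon> powr \<beta>"]) auto
  finally show ?thesis by simp
qed

text \<open>Fubini with one path frozen: in both versions the inner integral is over the path taken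
  at the fixed time \<open>r > 0\<close>, since the other time \<open>r - \<epsilon> n * u\<close>
  may be close to 0 or negative. The rate \<epsilon>^\<beta> tends to 0 as
  \<open>\<beta> > 0\<close>. Both orders occur because \<open>corr\<close> is not
  symmetric.\<close>

lemma cross_pointwise:
  assumes eps: "\<And>n. 0 < \<epsilon> n" "\<epsilon> \<longlonglongrightarrow> 0" and r: "0 < r" "0 \<le> u"
  shows "(\<lambda>n. LINT p|(W \<Otimes>\<^sub>M W). \<bar>\<Phi> u (path (\<epsilon> n) (fst p) r - path (\<epsilon> n) (snd p) (r - \<epsilon> n * u)) - 0 * \<Phi> u 0\<bar>) \<longlonglongrightarrow> 0" (is ?A)
    and "(\<lambda>n. LINT p|(W \<Otimes>\<^sub>M W). \<bar>\<Phi> u (path (\<epsilon> n) (snd p) r - path (\<epsilon> n) (fst p) (r - \<epsilon> n * u)) - 0 * \<Phi> u 0\<bar>) \<longlonglongrightarrow> 0" (is ?B)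
proof -
  interpret WW: pair_sigma_finite W W ..
  interpret WWp: prob_space "W \<Otimes>\<^sub>M W" by (rule prob_space_pair) unfold_locales
  define M0 where "M0 = 2 * K\<^sup>2 * A"
  have M0: "0 \<le> M0" unfolding M0_def using A by simp
  have Phi_le: "\<bar>\<Phi> u v\<bar> \<le> M0 * decay \<eta> \<bar>v\<bar>" for v
    using Phi_bound_space[OF r(2), of v] decay_sq_le[of "\<bar>v\<bar>"] M0 mult_left_mono[of "(decay \<eta> \<bar>v\<bar>)\<^sup>2" "decay \<eta> \<bar>v\<bar>" M0]
    unfolding M0_def by auto
  define e where "e = (\<lambda>n. M0 * (\<epsilon> n powr \<beta> * J / sqrt (2 * pi * r)))"
  have "(\<lambda>n. \<epsilon> n powr \<beta>) \<longlonglongrightarrow> 0 powr \<beta>"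
    by (rule tendsto_powr2) (use eps beta in \<open>auto intro!: less_imp_le always_eventually\<close>)
  from tendsto_mult_left[OF this, of "M0 * (J / sqrt (2 * pi * r))"] have e0: "e \<longlonglongrightarrow> 0"
    unfolding e_def by (simp add: mult_ac)
  have inner: "(LINT \<omega>|W. \<bar>\<Phi> u (path (\<epsilon> n) \<omega> r - path (\<epsilon> n) \<omega>' q)\<bar>) \<le> e n" if "\<omega>' \<in> space W" for \<omega>' n q
  proof -
    have "\<bar>LINT \<omega>|W. \<bar>\<Phi> u (path (\<epsilon> n) \<omega> r - path (\<epsilon> n) \<omega>' q)\<bar>\<bar> \<le> (LINT \<omega>|W. M0 * decay \<eta> \<bar>(B r \<omega> - B q \<omega>') / \<epsilon> n powr \<beta>\<bar>)"
    proof (rule abs_integral_le)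
      show "integrable W (\<lambda>\<omega>. M0 * decay \<eta> \<bar>(B r \<omega> - B q \<omega>') / \<epsilon> n powr \<beta>\<bar>)"
      proof (rule integrable_mult_right, rule W.integrable_const_bound[where B=1])
        show "AE \<omega> in W. norm (decay \<eta> \<bar>(B r \<omega> - B q \<omega>') / \<epsilon> n powr \<beta>\<bar>) \<le> 1"
          using decay_bounds(1,2)[OF eta] by (intro AE_I2) (simp add: abs_of_pos del: abs_divide)
      qed measurable
      fix \<omega>
      have "path (\<epsilon> n) \<omega> r - path (\<epsilon> n) \<omega>' q = (B r \<omega> - B q \<omega>') / \<epsilon> n powr \<beta>"
        by (simp add: path_def flip: diff_divide_distrib)
      then show "\<bar>\<bar>\<Phi> u (path (\<epsilon> n) \<omega> r - path (\<epsilon> n) \<omega>' q)\<bar>\<bar> \<le> M0 * decay \<eta> \<bar>(B r \<omega> - B q \<omega>') / \<epsilon> n powr \<beta>\<bar>"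
        by (simp only: abs_idempotent) (rule Phi_le)
    qed
    also have "\<dots> = M0 * (LINT \<omega>|W. decay \<eta> \<bar>(B r \<omega> - B q \<omega>') / \<epsilon> n powr \<beta>\<bar>)" by simp
    also have "\<dots> \<le> e n" unfolding e_def using expectation_decay[OF eps(1) r(1)] M0 by (intro mult_left_mono)
    finally show ?thesis by linarith
  qed
  have int: "integrable (W \<Otimes>\<^sub>M W) (\<lambda>p. \<bar>\<Phi> u (f p)\<bar>)" if [measurable]: "f \<in> borel_measurable (W \<Otimes>\<^sub>M W)" for f
    by (rule WWp.integrable_const_bound[where B="K\<^sup>2"]) (use Phi_abs_le[OF r(2)] in auto)
  have "(LINT p|(W \<Otimes>\<^sub>M W). \<bar>\<Phi> u (path (\<epsilon> n) (fst p) r - path (\<epsilon> n) (snd p) (r - \<epsilon> n * u))\<bar>) \<le> e n" for n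
  proof -
    have i: "integrable (W \<Otimes>\<^sub>M W) (\<lambda>(\<omega>, \<omega>'). \<bar>\<Phi> u (path (\<epsilon> n) \<omega> r - path (\<epsilon> n) \<omega>' (r - \<epsilon> n * u))\<bar>)"
      using int[of "\<lambda>p. path (\<epsilon> n) (fst p) r - path (\<epsilon> n) (snd p) (r - \<epsilon> n * u)"] by (simp add: case_prod_beta')
    have "(LINT p|(W \<Otimes>\<^sub>M W). \<bar>\<Phi> u (path (\<epsilon> n) (fst p) r - path (\<epsilon> n) (snd p) (r - \<epsilon> n * u))\<bar>)
        = (LINT \<omega>'|W. (LINT \<omega>|W. \<bar>\<Phi> u (path (\<epsilon> n) \<omega> r - path (\<epsilon> n) \<omega>' (r - \<epsilon> n * u))\<bar>))"
      using WW.integral_snd[OF i] by (simp add: case_prod_beta')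
    also have "\<dots> \<le> (LINT \<omega>'|W. e n)"
      using WW.integrable_snd[OF i] inner by (intro integral_mono) auto
    finally show ?thesis by (simp add: W.prob_space)
  qed
  then show ?A
    by (intro tendsto_sandwich[OF _ _ tendsto_const e0]) auto
  have "(LINT p|(W \<Otimes>\<^sub>M W). \<bar>\<Phi> u (path (\<epsilon> n) (snd p) r - path (\<epsilon> n) (fst p) (r - \<epsilon> n * u))\<bar>) \<le> e n" for n
  proof -
    have i: "integrable (W \<Otimes>\<^sub>M W) (\<lambda>(\<omega>, \<omega>'). \<bar>\<Phi> u (path (\<epsilon> n) \<omega>' r - path (\<epsilon> n) \<omega> (r - \<epsilon> n * u))\<bar>)"
      using int[of "\<lambda>p. path (\<epsilon> n) (snd p) r - path (\<epsilon> n) (fst p) (r - \<epsilon> n * u)"] by (simp add: case_prod_beta')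
    have "(LINT p|(W \<Otimes>\<^sub>M W). \<bar>\<Phi> u (path (\<epsilon> n) (snd p) r - path (\<epsilon> n) (fst p) (r - \<epsilon> n * u))\<bar>)
        = (LINT \<omega>|W. (LINT \<omega>'|W. \<bar>\<Phi> u (path (\<epsilon> n) \<omega>' r - path (\<epsilon> n) \<omega> (r - \<epsilon> n * u))\<bar>))"
      using WW.integral_fst[OF i] by (simp add: case_prod_beta')
    also have "\<dots> \<le> (LINT \<omega>'|W. e n)"
      using WW.integrable_fst[OF i] inner by (intro integral_mono) auto
    finally show ?thesis by (simp add: W.prob_space)
  qed
  then show ?B
    by (intro tendsto_sandwich[OF _ _ tendsto_const e0]) auto
qed

lemma averaged_own:
  assumes eps: "\<And>n. 0 < \<epsilon> n" "\<epsilon> \<longlonglongrightarrow> 0" and t: "0 \<le> t"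
  shows "(\<lambda>n. LINT \<omega>|W. own (\<epsilon> n) (path (\<epsilon> n) \<omega>) t) \<longlonglongrightarrow> 0"
    and "integrable W (\<lambda>\<omega>. own (\<epsilon> n) (path (\<epsilon> n) \<omega>) t)"
proof -
  have m: "(\<lambda>(r, \<omega>). path (\<epsilon> n) \<omega> r) \<in> borel_measurable (borel \<Otimes>\<^sub>M W)" for n by measurable
  note * = averaged_corr_tendsto[of W "\<lambda>n r \<omega>. path (\<epsilon> n) \<omega> r" "\<lambda>n r \<omega>. path (\<epsilon> n) \<omega> r", OF W.prob_space_axioms m m eps own_pointwise[OF eps] t]
  show "(\<lambda>n. LINT \<omega>|W. own (\<epsilon> n) (path (\<epsilon> n) \<omega>) t) \<longlonglongrightarrow> 0" using *(1) by (simp add: own_def)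
  show "integrable W (\<lambda>\<omega>. own (\<epsilon> n) (path (\<epsilon> n) \<omega>) t)" using *(2)[of n] by (simp add: own_def)
qed

lemma averaged_cross:
  assumes eps: "\<And>n. 0 < \<epsilon> n" "\<epsilon> \<longlonglongrightarrow> 0" and t: "0 \<le> t"
  shows "(\<lambda>n. LINT p|(W \<Otimes>\<^sub>M W). cross (\<epsilon> n) (path (\<epsilon> n) (fst p)) (path (\<epsilon> n) (snd p)) t) \<longlonglongrightarrow> 0"
    and "integrable (W \<Otimes>\<^sub>M W) (\<lambda>p. cross (\<epsilon> n) (path (\<epsilon> n) (fst p)) (path (\<epsilon> n) (snd p)) t)"
    and "(\<lambda>n. LINT p|(W \<Otimes>\<^sub>M W). cross (\<epsilon> n) (path (\<epsilon> n) (snd p)) (path (\<epsilon> n) (fst p)) t) \<longlonglongrightarrow> 0"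
    and "integrable (W \<Otimes>\<^sub>M W) (\<lambda>p. cross (\<epsilon> n) (path (\<epsilon> n) (snd p)) (path (\<epsilon> n) (fst p)) t)"
proof -
  have P: "prob_space (W \<Otimes>\<^sub>M W)" by (rule prob_space_pair) unfold_locales
  have m: "(\<lambda>(r, p). path (\<epsilon> n) (fst p) r) \<in> borel_measurable (borel \<Otimes>\<^sub>M (W \<Otimes>\<^sub>M W))"
    "(\<lambda>(r, p). path (\<epsilon> n) (snd p) r) \<in> borel_measurable (borel \<Otimes>\<^sub>M (W \<Otimes>\<^sub>M W))" for n by measurable
  note 1 = averaged_corr_tendsto[of "W \<Otimes>\<^sub>M W" "\<lambda>n r p. path (\<epsilon> n) (fst p) r" "\<lambda>n r p. path (\<epsilon> n) (snd p) r",
      OF P m(1) m(2) eps cross_pointwise(1)[OF eps] t]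
  note 2 = averaged_corr_tendsto[of "W \<Otimes>\<^sub>M W" "\<lambda>n r p. path (\<epsilon> n) (snd p) r" "\<lambda>n r p. path (\<epsilon> n) (fst p) r",
      OF P m(2) m(1) eps cross_pointwise(2)[OF eps] t]
  show "(\<lambda>n. LINT p|(W \<Otimes>\<^sub>M W). cross (\<epsilon> n) (path (\<epsilon> n) (fst p)) (path (\<epsilon> n) (snd p)) t) \<longlonglongrightarrow> 0"
    using 1(1) by (simp add: cross_def)
  show "integrable (W \<Otimes>\<^sub>M W) (\<lambda>p. cross (\<epsilon> n) (path (\<epsilon> n) (fst p)) (path (\<epsilon> n) (snd p)) t)"
    using 1(2)[of n] by (simp add: cross_def)
  show "(\<lambda>n. LINT p|(W \<Otimes>\<^sub>M W). cross (\<epsilon> n) (path (\<epsilon> n) (snd p)) (path (\<epsilon> n) (fst p)) t) \<longlonglongrightarrow> 0"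
    using 2(1) by (simp add: cross_def)
  show "integrable (W \<Otimes>\<^sub>M W) (\<lambda>p. cross (\<epsilon> n) (path (\<epsilon> n) (snd p)) (path (\<epsilon> n) (fst p)) t)"
    using 2(2)[of n] by (simp add: cross_def)
qed

end

section \<open>Mean-square convergence\<close>

text \<open>First \<open>l\<close> is fixed so that \<open>l * a\<close> is below half the
  tolerance, then \<open>n\<close> grows. The weight \<open>l\<close> makes up for a factor that is
  square integrable but not small.\<close>

lemma tendsto_0_by_Young:
  fixes X y :: "nat \<Rightarrow> real"
  assumes X: "\<And>n. 0 \<le> X n" "\<And>n l. 0 < l \<Longrightarrow> X n \<le> l * a + k / l * y n"
    and y: "y \<longlonglongrightarrow> 0"
  shows "X \<longlonglongrightarrow> 0"
proof (rule LIMSEQ_I)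
  fix e :: real assume e: "0 < e"
  define l where "l = e / 2 / (\<bar>a\<bar> + 1)"
  have l: "0 < l" using e by (simp add: l_def add_nonneg_pos)
  have "\<bar>a\<bar> + 1 \<noteq> 0" by linarith
  then have "(\<bar>a\<bar> + 1) * l = e / 2"
    unfolding l_def by (metis nonzero_mult_div_cancel_left times_divide_eq_right)
  then have "l * \<bar>a\<bar> + l = e / 2" by (simp only: mult.commute[of _ l] distrib_left mult_1_right)
  moreover have "l * a \<le> l * \<bar>a\<bar>" using l by (intro mult_left_mono) auto
  ultimately have la: "l * a < e / 2" using l by linarith
  have "(\<lambda>n. k / l * y n) \<longlonglongrightarrow> k / l * 0" by (intro tendsto_intros y)
  from order_tendstoD(2)[OF this, of "e / 2"]
  have "\<forall>\<^sub>F n in sequentially. k / l * y n < e / 2" using e by simp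
  then obtain N where N: "\<And>n. N \<le> n \<Longrightarrow> k / l * y n < e / 2" by (auto simp: eventually_sequentially)
  show "\<exists>N. \<forall>n\<ge>N. norm (X n - 0) < e"
  proof (intro exI allI impI)
    fix n assume "N \<le> n"
    from N[OF this] show "norm (X n - 0) < e"
      using X(1)[of n] X(2)[OF l, of n] la unfolding real_norm_def diff_zero by linarith
  qed
qed

lemma integral_pair_product:
  fixes f h :: "_ \<Rightarrow> real"
  assumes "prob_space M" "prob_space N" and f: "integrable M f" and h: "integrable N h"
  shows "integrable (M \<Otimes>\<^sub>M N) (\<lambda>p. f (fst p) * h (snd p))"
    and "(LINT p|(M \<Otimes>\<^sub>M N). f (fst p) * h (snd p)) = integral\<^sup>L M f * integral\<^sup>L N h"
proof -
  interpret M: prob_space M by fact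
  interpret N: prob_space N by fact
  interpret pair_sigma_finite M N ..
  have [measurable]: "f \<in> borel_measurable M" "h \<in> borel_measurable N" using f h by auto
  show i: "integrable (M \<Otimes>\<^sub>M N) (\<lambda>p. f (fst p) * h (snd p))"
  proof (rule Fubini_integrable)
    show "integrable M (\<lambda>x. LINT y|N. norm (f (fst (x, y)) * h (snd (x, y))))"
      using f by (simp add: abs_mult)
    show "AE x in M. integrable N (\<lambda>y. f (fst (x, y)) * h (snd (x, y)))" using h by simp
  qed measurable
  show "(LINT p|(M \<Otimes>\<^sub>M N). f (fst p) * h (snd p)) = integral\<^sup>L M f * integral\<^sup>L N h"
    using integral_fst'[OF i] by simp
qed

context field_and_motion
begin

lemma zeta_meas [measurable]: "(\<lambda>(\<omega>, s). \<zeta> \<epsilon> (path \<epsilon> \<omega>) t s) \<in> borel_measurable (W \<Otimes>\<^sub>M M)"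
  unfolding \<zeta>_def by measurable

lemma zeta_compose_meas [measurable (raw)]:
  assumes "f \<in> N \<rightarrow>\<^sub>M W" "h \<in> N \<rightarrow>\<^sub>M M"
  shows "(\<lambda>v. \<zeta> \<epsilon> (path \<epsilon> (f v)) t (h v)) \<in> borel_measurable N"
proof -
  have "(\<lambda>v. (f v, h v)) \<in> N \<rightarrow>\<^sub>M W \<Otimes>\<^sub>M M" using assms by measurable
  from measurable_compose[OF this zeta_meas] show ?thesis by simp
qed

lemma zeta_bound:
  assumes "0 \<le> t" "s \<in> space M"
  shows "\<bar>\<zeta> \<epsilon> y t s\<bar> \<le> \<epsilon> powr (- 1 / 2) * (K * t)"
proof -
  have "\<bar>LINT r:{0..t}|lborel. c (r / \<epsilon>) (y r) s\<bar> \<le> K * (t - 0)"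
    by (rule abs_set_integral_Icc_bounded) (use assms c_bound in auto)
  then show ?thesis by (simp add: \<zeta>_def abs_mult mult_left_mono)
qed

lemma feynman_kac_eq:
  "feynman_kac W B c g \<beta> \<epsilon> t x s = (LINT \<omega>|W. g (x + B t \<omega>) * exp (\<zeta> \<epsilon> (path \<epsilon> \<omega>) t s))"
  by (simp add: feynman_kac_def \<zeta>_def path_def)

lemma g_integrable:
  assumes "integrable W (\<lambda>\<omega>. (g (x + B t \<omega>))\<^sup>2)"
  shows "integrable W (\<lambda>\<omega>. g (x + B t \<omega>))"
proof (rule Bochner_Integration.integrable_bound)
  show "integrable W (\<lambda>\<omega>. 1 + (g (x + B t \<omega>))\<^sup>2)" using assms by simp
  have "\<bar>v\<bar> \<le> \<bar>1 + v\<^sup>2\<bar>" for v :: real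
  proof -
    have "0 \<le> (\<bar>v\<bar> - 1)\<^sup>2" by simp
    also have "\<dots> = v\<^sup>2 - 2 * \<bar>v\<bar> + 1" by (simp add: power2_diff)
    finally show ?thesis by (simp add: abs_if split: if_splits)
  qed
  then show "AE \<omega> in W. norm (g (x + B t \<omega>)) \<le> norm (1 + (g (x + B t \<omega>))\<^sup>2)" by simp
qed measurable

text \<open>For fixed \<epsilon> the exponent is bounded, so the solution is even bounded in
  \<open>s\<close>; only uniformity in \<epsilon> is delicate.\<close>

lemma feynman_kac_square_integrable:
  assumes t: "0 \<le> t" and g2: "integrable W (\<lambda>\<omega>. (g (x + B t \<omega>))\<^sup>2)"
  shows "square_integrable M (feynman_kac W B c g \<beta> \<epsilon> t x)"
proof -
  define b where "b = (LINT \<omega>|W. \<bar>g (x + B t \<omega>)\<bar> * exp (\<epsilon> powr (- 1 / 2) * (K * t)))"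
  have [measurable]: "feynman_kac W B c g \<beta> \<epsilon> t x \<in> borel_measurable M"
    unfolding feynman_kac_eq[abs_def] by measurable
  have b: "\<bar>feynman_kac W B c g \<beta> \<epsilon> t x s\<bar> \<le> b" if s: "s \<in> space M" for s
    unfolding feynman_kac_eq b_def
  proof (rule abs_integral_le)
    show "integrable W (\<lambda>\<omega>. \<bar>g (x + B t \<omega>)\<bar> * exp (\<epsilon> powr (- 1 / 2) * (K * t)))"
      using g_integrable[OF g2] by simp
    show "\<bar>g (x + B t \<omega>) * exp (\<zeta> \<epsilon> (path \<epsilon> \<omega>) t s)\<bar> \<le> \<bar>g (x + B t \<omega>)\<bar> * exp (\<epsilon> powr (- 1 / 2) * (K * t))" for \<omega>
      using zeta_bound[OF t s, of \<epsilon> "path \<epsilon> \<omega>"] by (auto simp: abs_mult intro!: mult_left_mono)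
  qed
  have "integrable M (\<lambda>s. (feynman_kac W B c g \<beta> \<epsilon> t x s)\<^sup>2)"
  proof (rule integrable_bdd)
    show "\<bar>(feynman_kac W B c g \<beta> \<epsilon> t x s)\<^sup>2\<bar> \<le> b\<^sup>2" if "s \<in> space M" for s
      using power_mono[OF b[OF that], of 2] by simp
  qed measurable
  then show ?thesis by (simp add: square_integrable_def)
qed

text \<open>Expanding the square with two independent copies of the Brownian motion turns the
  \<open>L\<^sup>2\<close> error into exponential moments along pairs of paths.\<close>

lemma L2_error:
  assumes t: "0 \<le> t" and g2: "integrable W (\<lambda>\<omega>. (g (x + B t \<omega>))\<^sup>2)"
  defines "Q \<equiv> \<lambda>p. g (x + B t (fst p)) * g (x + B t (snd p))"
    and "H \<equiv> \<lambda>\<epsilon> p. LINT s|M. (exp (\<zeta> \<epsilon> (path \<epsilon> (fst p)) t s) - exp (\<sigma> * t)) * (exp (\<zeta> \<epsilon> (path \<epsilon> (snd p)) t s) - exp (\<sigma> * t))"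
  shows "(LINT s|M. (feynman_kac W B c g \<beta> \<epsilon> t x s - (LINT \<omega>|W. g (x + B t \<omega>)) * exp (t * \<sigma>))\<^sup>2)
    = (LINT p|(W \<Otimes>\<^sub>M W). Q p * H \<epsilon> p)"
    and "integrable (W \<Otimes>\<^sub>M W) (\<lambda>p. Q p * H \<epsilon> p)"
proof -
  have P: "prob_space (W \<Otimes>\<^sub>M W)" by (rule prob_space_pair) unfold_locales
  interpret WW: prob_space "W \<Otimes>\<^sub>M W" by (rule P)
  interpret MW: pair_sigma_finite M "W \<Otimes>\<^sub>M W" ..
  define E where "E = (\<lambda>\<omega> s. exp (\<zeta> \<epsilon> (path \<epsilon> \<omega>) t s) - exp (\<sigma> * t))"
  have E_meas[measurable (raw)]: "(\<lambda>v. E (f v) (h v)) \<in> borel_measurable N"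
    if [measurable]: "f \<in> N \<rightarrow>\<^sub>M W" "h \<in> N \<rightarrow>\<^sub>M M" for f h and N :: "'z measure"
    unfolding E_def by measurable
  define be where "be = exp (\<epsilon> powr (- 1 / 2) * (K * t)) + exp (\<sigma> * t)"
  have Eb: "\<bar>E \<omega> s\<bar> \<le> be" if "s \<in> space M" for \<omega> s
  proof -
    have "exp (\<zeta> \<epsilon> (path \<epsilon> \<omega>) t s) \<le> exp (\<epsilon> powr (- 1 / 2) * (K * t))"
      using zeta_bound[OF t that, of \<epsilon> "path \<epsilon> \<omega>"] by simp
    then show ?thesis unfolding E_def be_def
      using exp_gt_zero[of "\<zeta> \<epsilon> (path \<epsilon> \<omega>) t s"] exp_gt_zero[of "\<sigma> * t"] by linarith
  qed
  note gi = g_integrable[OF g2]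
  have [measurable]: "Q \<in> borel_measurable (W \<Otimes>\<^sub>M W)" unfolding Q_def by measurable
  have iQ: "integrable (W \<Otimes>\<^sub>M W) Q"
    unfolding Q_def by (rule integral_pair_product(1)[OF W.prob_space_axioms W.prob_space_axioms gi gi])
  have EE: "\<bar>E \<omega> s * E \<omega>' s\<bar> \<le> be * be" if "s \<in> space M" for \<omega> \<omega>' s
    unfolding abs_mult using Eb[OF that, of \<omega>] Eb[OF that, of \<omega>'] by (intro mult_mono) auto
  have igE: "integrable W (\<lambda>\<omega>. g (x + B t \<omega>) * E \<omega> s)" if s: "s \<in> space M" for s
  proof (rule Bochner_Integration.integrable_bound)
    show "integrable W (\<lambda>\<omega>. \<bar>g (x + B t \<omega>)\<bar> * be)" using gi by simp
    show "(\<lambda>\<omega>. g (x + B t \<omega>) * E \<omega> s) \<in> borel_measurable W" using s by measurable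
    show "AE \<omega> in W. norm (g (x + B t \<omega>) * E \<omega> s) \<le> norm (\<bar>g (x + B t \<omega>)\<bar> * be)"
      using order_trans[OF Eb[OF s] abs_ge_self] by (intro AE_I2) (auto simp: abs_mult intro!: mult_left_mono)
  qed
  have D_eq: "(feynman_kac W B c g \<beta> \<epsilon> t x s - (LINT \<omega>|W. g (x + B t \<omega>)) * exp (t * \<sigma>))\<^sup>2
      = (LINT p|(W \<Otimes>\<^sub>M W). Q p * (E (fst p) s * E (snd p) s))" if s: "s \<in> space M" for s
  proof -
    have "integrable W (\<lambda>\<omega>. g (x + B t \<omega>) * E \<omega> s + g (x + B t \<omega>) * exp (\<sigma> * t))"
      using igE[OF s] gi by simp
    then have "integrable W (\<lambda>\<omega>. g (x + B t \<omega>) * exp (\<zeta> \<epsilon> (path \<epsilon> \<omega>) t s))"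
      unfolding E_def by (simp add: algebra_simps)
    then have "feynman_kac W B c g \<beta> \<epsilon> t x s - (LINT \<omega>|W. g (x + B t \<omega>)) * exp (t * \<sigma>) = (LINT \<omega>|W. g (x + B t \<omega>) * E \<omega> s)"
      unfolding feynman_kac_eq E_def using gi by (simp add: right_diff_distrib mult.commute[of t])
    then show ?thesis
      using integral_pair_product(2)[OF W.prob_space_axioms W.prob_space_axioms igE[OF s] igE[OF s]]
      by (simp add: power2_eq_square Q_def mult_ac)
  qed
  have i: "integrable (M \<Otimes>\<^sub>M (W \<Otimes>\<^sub>M W)) (\<lambda>(s, p). Q p * (E (fst p) s * E (snd p) s))"
  proof (rule Bochner_Integration.integrable_bound)
    show "integrable (M \<Otimes>\<^sub>M (W \<Otimes>\<^sub>M W)) (\<lambda>q. \<bar>Q (snd q)\<bar> * (be * be))"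
      using pair_marginals(4)[OF prob_space_axioms P iQ] by simp
    show "AE q in M \<Otimes>\<^sub>M (W \<Otimes>\<^sub>M W). norm (case q of (s, p) \<Rightarrow> Q p * (E (fst p) s * E (snd p) s)) \<le> norm (\<bar>Q (snd q)\<bar> * (be * be))"
      using EE by (intro AE_I2) (auto simp: abs_mult space_pair_measure intro!: mult_left_mono intro: order_trans[OF _ abs_ge_self])
  qed measurable
  have "(LINT s|M. (feynman_kac W B c g \<beta> \<epsilon> t x s - (LINT \<omega>|W. g (x + B t \<omega>)) * exp (t * \<sigma>))\<^sup>2)
    = (LINT s|M. (LINT p|(W \<Otimes>\<^sub>M W). Q p * (E (fst p) s * E (snd p) s)))"
    by (rule Bochner_Integration.integral_cong) (use D_eq in auto)
  also have "\<dots> = (LINT p|(W \<Otimes>\<^sub>M W). (LINT s|M. Q p * (E (fst p) s * E (snd p) s)))"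
    by (rule MW.Fubini_integral[OF i, symmetric])
  finally show "(LINT s|M. (feynman_kac W B c g \<beta> \<epsilon> t x s - (LINT \<omega>|W. g (x + B t \<omega>)) * exp (t * \<sigma>))\<^sup>2)
    = (LINT p|(W \<Otimes>\<^sub>M W). Q p * H \<epsilon> p)" by (simp add: H_def E_def)
  show "integrable (W \<Otimes>\<^sub>M W) (\<lambda>p. Q p * H \<epsilon> p)"
    using MW.integrable_snd[OF i] by (simp add: H_def E_def)
qed

text \<open>\<open>H\<close> is bounded and small in L1 over pairs of paths, while \<open>Q\<close>
  is only square integrable. From \<open>(H n p)\<^sup>2 \<le> b * \<bar>H n p\<bar>\<close> and
  Young's inequality with weight \<open>l\<close> the integral of the product tends to 0.\<close>

theorem L2_convergence:
  assumes eps: "\<And>n. 0 < \<epsilon> n" "\<And>n. \<epsilon> n \<le> 1" "\<epsilon> \<longlonglongrightarrow> 0"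
    and t: "0 \<le> t" and g2: "integrable W (\<lambda>\<omega>. (g (x + B t \<omega>))\<^sup>2)"
  shows "(\<lambda>n. LINT s|M. (feynman_kac W B c g \<beta> (\<epsilon> n) t x s - (LINT \<omega>|W. g (x + B t \<omega>)) * exp (t * \<sigma>))\<^sup>2) \<longlonglongrightarrow> 0"
proof -
  have P: "prob_space (W \<Otimes>\<^sub>M W)" by (rule prob_space_pair) unfold_locales
  interpret WW: prob_space "W \<Otimes>\<^sub>M W" by (rule P)
  obtain C where C0: "0 \<le> C" and C: "\<And>\<epsilon> y z. 0 < \<epsilon> \<Longrightarrow> \<epsilon> \<le> 1 \<Longrightarrow> y \<in> borel_measurable borel \<Longrightarrow> z \<in> borel_measurable borel \<Longrightarrow>
      \<bar>(LINT s|M. exp (\<zeta> \<epsilon> y t s)) - exp (\<sigma> * t)\<bar> \<le> C * (\<epsilon> powr (1 / 8) + own \<epsilon> y t) \<and>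
      \<bar>(LINT s|M. exp (\<zeta> \<epsilon> y t s + \<zeta> \<epsilon> z t s)) - exp (2 * \<sigma> * t)\<bar>
        \<le> C * (\<epsilon> powr (1 / 8) + own \<epsilon> y t + own \<epsilon> z t + cross \<epsilon> y z t + cross \<epsilon> z y t) \<and>
      (LINT s|M. exp (\<zeta> \<epsilon> y t s)) \<le> C \<and> (LINT s|M. exp (\<zeta> \<epsilon> y t s + \<zeta> \<epsilon> z t s)) \<le> C"
    by (rule exp_moment_approx[OF t]) blast
  define Q where "Q = (\<lambda>p. g (x + B t (fst p)) * g (x + B t (snd p)))"
  define H where "H = (\<lambda>n p. LINT s|M. (exp (\<zeta> (\<epsilon> n) (path (\<epsilon> n) (fst p)) t s) - exp (\<sigma> * t)) * (exp (\<zeta> (\<epsilon> n) (path (\<epsilon> n) (snd p)) t s) - exp (\<sigma> * t)))"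
  define e where "e = exp (\<sigma> * t)"
  have e: "0 < e" "e * e = exp (2 * \<sigma> * t)" by (simp_all add: e_def flip: exp_add)
  \<comment> \<open>Collects the errors of \<open>exp_moment_approx\<close> for the pair of paths;
    what tends to 0 is its mean over the paths.\<close>
  define \<Xi> where "\<Xi> = (\<lambda>n p. \<epsilon> n powr (1 / 8) + own (\<epsilon> n) (path (\<epsilon> n) (fst p)) t + own (\<epsilon> n) (path (\<epsilon> n) (snd p)) t
      + cross (\<epsilon> n) (path (\<epsilon> n) (fst p)) (path (\<epsilon> n) (snd p)) t + cross (\<epsilon> n) (path (\<epsilon> n) (snd p)) (path (\<epsilon> n) (fst p)) t)"
  define b where "b = C + 2 * e * C + e * e"
  have b0: "0 \<le> b" using C0 e by (simp add: b_def)
  have own0: "0 \<le> own \<epsilon> y t" and cross0: "0 \<le> cross \<epsilon> y z t" for \<epsilon> y z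
    unfolding own_def cross_def set_lebesgue_integral_def
    by (rule Bochner_Integration.integral_nonneg, simp)+
  have H: "\<bar>H n p\<bar> \<le> (C + 2 * e * C) * \<Xi> n p" "\<bar>H n p\<bar> \<le> b" if p: "p \<in> space (W \<Otimes>\<^sub>M W)" for n p
  proof -
    let ?y = "path (\<epsilon> n) (fst p)" and ?z = "path (\<epsilon> n) (snd p)"
    have sp: "fst p \<in> space W" "snd p \<in> space W" using p by (auto simp: space_pair_measure)
    have y[measurable]: "?y \<in> borel_measurable borel" and z[measurable]: "?z \<in> borel_measurable borel"
      using sp by measurable
    have zm[measurable]: "\<zeta> (\<epsilon> n) ?y t \<in> borel_measurable M" "\<zeta> (\<epsilon> n) ?z t \<in> borel_measurable M"
      using sp by measurable
    define k where "k = \<epsilon> n powr (- 1 / 2) * (K * t)"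
    have kb: "\<zeta> (\<epsilon> n) y t s \<le> k" if "s \<in> space M" for s y
      using zeta_bound[OF t that, of "\<epsilon> n" y] unfolding k_def by linarith
    have i1: "integrable M (\<lambda>s. exp (\<zeta> (\<epsilon> n) ?y t s))" "integrable M (\<lambda>s. exp (\<zeta> (\<epsilon> n) ?z t s))"
      by (rule integrable_bdd[where b="exp k"]; use kb in simp)+
    have i2: "integrable M (\<lambda>s. exp (\<zeta> (\<epsilon> n) ?y t s + \<zeta> (\<epsilon> n) ?z t s))"
      by (rule integrable_bdd[where b="exp (k + k)"]) (use add_mono[OF kb kb] in auto)
    define F1 F1' F2 where "F1 = (LINT s|M. exp (\<zeta> (\<epsilon> n) ?y t s))" and "F1' = (LINT s|M. exp (\<zeta> (\<epsilon> n) ?z t s))"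
      and "F2 = (LINT s|M. exp (\<zeta> (\<epsilon> n) ?y t s + \<zeta> (\<epsilon> n) ?z t s))"
    have "H n p = (LINT s|M. exp (\<zeta> (\<epsilon> n) ?y t s + \<zeta> (\<epsilon> n) ?z t s) - e * exp (\<zeta> (\<epsilon> n) ?y t s) - e * exp (\<zeta> (\<epsilon> n) ?z t s) + e * e)"
      unfolding H_def e_def by (intro Bochner_Integration.integral_cong) (auto simp: algebra_simps exp_add)
    also have "\<dots> = F2 - e * F1 - e * F1' + e * e"
      unfolding F1_def F1'_def F2_def using i1 i2 by (simp add: prob_space)
    finally have H_eq: "H n p = F2 - e * F1 - e * F1' + e * e" .
    have Fpos: "0 \<le> F1" "0 \<le> F1'" "0 \<le> F2" unfolding F1_def F1'_def F2_def by simp_all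
    note Cy = C[OF eps(1) eps(2) y z, of n] and Cz = C[OF eps(1) eps(2) z y, of n]
    have Fb: "F1 \<le> C" "F1' \<le> C" "F2 \<le> C" unfolding F1_def F1'_def F2_def using Cy Cz by blast+
    have "e * F1 \<le> e * C" "e * F1' \<le> e * C" "0 \<le> e * F1" "0 \<le> e * F1'"
      using Fb Fpos e by (auto intro!: mult_left_mono)
    then show "\<bar>H n p\<bar> \<le> b" unfolding H_eq b_def using Fb Fpos e(1) mult_pos_pos[OF e(1) e(1)] by linarith
    have X: "\<epsilon> n powr (1 / 8) + own (\<epsilon> n) ?y t \<le> \<Xi> n p" "\<epsilon> n powr (1 / 8) + own (\<epsilon> n) ?z t \<le> \<Xi> n p"
      unfolding \<Xi>_def using own0[of "\<epsilon> n" ?y] own0[of "\<epsilon> n" ?z] cross0[of "\<epsilon> n" ?y ?z] cross0[of "\<epsilon> n" ?z ?y] by linarith+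
    have "\<bar>F1 - e\<bar> \<le> C * \<Xi> n p" "\<bar>F1' - e\<bar> \<le> C * \<Xi> n p"
      unfolding F1_def F1'_def e_def using Cy Cz mult_left_mono[OF X(1) C0] mult_left_mono[OF X(2) C0] by linarith+
    then have "\<bar>e * (F1 - e)\<bar> \<le> e * (C * \<Xi> n p)" "\<bar>e * (F1' - e)\<bar> \<le> e * (C * \<Xi> n p)"
      using e by (auto simp: abs_mult)
    moreover have "\<bar>F2 - e * e\<bar> \<le> C * \<Xi> n p" unfolding F2_def e(2) \<Xi>_def using Cy by blast
    \<comment> \<open>The limits \<open>e * e\<close>, \<open>e\<close> and \<open>e\<close> of the
      three moments cancel exactly in \<open>H\<close>.\<close>
    moreover have "H n p = (F2 - e * e) - e * (F1 - e) - e * (F1' - e)" unfolding H_eq by (simp add: algebra_simps)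
    ultimately have "\<bar>H n p\<bar> \<le> C * \<Xi> n p + e * (C * \<Xi> n p) + e * (C * \<Xi> n p)" by linarith
    then show "\<bar>H n p\<bar> \<le> (C + 2 * e * C) * \<Xi> n p" by (simp add: algebra_simps)
  qed
  note ao = averaged_own[OF eps(1) eps(3) t] and ac = averaged_cross[OF eps(1) eps(3) t]
  note ow = pair_marginals[OF W.prob_space_axioms W.prob_space_axioms]
  have own_m: "(\<lambda>\<omega>. own (\<epsilon> n) (path (\<epsilon> n) \<omega>) t) \<in> borel_measurable W" for n using ao(2)[of n] by auto
  have iX: "integrable (W \<Otimes>\<^sub>M W) (\<Xi> n)" for n
    unfolding \<Xi>_def using ow(3)[OF ao(2)[of n]] ow(4)[OF ao(2)[of n]] ac(2)[of n] ac(4)[of n] by simp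
  have X_eq: "integral\<^sup>L (W \<Otimes>\<^sub>M W) (\<Xi> n) = \<epsilon> n powr (1 / 8) + (LINT \<omega>|W. own (\<epsilon> n) (path (\<epsilon> n) \<omega>) t) + (LINT \<omega>|W. own (\<epsilon> n) (path (\<epsilon> n) \<omega>) t)
      + (LINT p|(W \<Otimes>\<^sub>M W). cross (\<epsilon> n) (path (\<epsilon> n) (fst p)) (path (\<epsilon> n) (snd p)) t) + (LINT p|(W \<Otimes>\<^sub>M W). cross (\<epsilon> n) (path (\<epsilon> n) (snd p)) (path (\<epsilon> n) (fst p)) t)" for n
    unfolding \<Xi>_def using ow(3)[OF ao(2)[of n]] ow(4)[OF ao(2)[of n]] ac(2)[of n] ac(4)[of n]
    by (simp add: ow(1)[OF own_m] ow(2)[OF own_m] WW.prob_space)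
  have "(\<lambda>n. \<epsilon> n powr (1 / 8)) \<longlonglongrightarrow> 0 powr (1 / 8)"
    by (rule tendsto_powr2) (use eps in \<open>auto intro!: less_imp_le always_eventually\<close>)
  then have "(\<lambda>n. \<epsilon> n powr (1 / 8)) \<longlonglongrightarrow> 0" by simp
  from tendsto_add[OF tendsto_add[OF tendsto_add[OF tendsto_add[OF this ao(1)] ao(1)] ac(1)] ac(3)]
  have X_lim: "(\<lambda>n. integral\<^sup>L (W \<Otimes>\<^sub>M W) (\<Xi> n)) \<longlonglongrightarrow> 0" unfolding X_eq by simp
  have iQ2: "integrable (W \<Otimes>\<^sub>M W) (\<lambda>p. (Q p)\<^sup>2)"
    unfolding Q_def power_mult_distrib
    by (rule integral_pair_product(1)[OF W.prob_space_axioms W.prob_space_axioms g2 g2])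
  have X_nonneg: "0 \<le> \<Xi> n p" for n p unfolding \<Xi>_def using own0 cross0 by simp
  show ?thesis
  proof (rule tendsto_0_by_Young[OF _ _ X_lim])
    fix n and l :: real assume l: "0 < l"
    have "(LINT s|M. (feynman_kac W B c g \<beta> (\<epsilon> n) t x s - (LINT \<omega>|W. g (x + B t \<omega>)) * exp (t * \<sigma>))\<^sup>2) = (LINT p|(W \<Otimes>\<^sub>M W). Q p * H n p)"
      unfolding Q_def H_def by (rule L2_error(1)[OF t g2])
    also have "\<dots> \<le> (LINT p|(W \<Otimes>\<^sub>M W). l * (Q p)\<^sup>2 + (b * (C + 2 * e * C)) / l * \<Xi> n p)"
    proof (rule integral_mono)
      show "integrable (W \<Otimes>\<^sub>M W) (\<lambda>p. Q p * H n p)" unfolding Q_def H_def by (rule L2_error(2)[OF t g2])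
      show "integrable (W \<Otimes>\<^sub>M W) (\<lambda>p. l * (Q p)\<^sup>2 + (b * (C + 2 * e * C)) / l * \<Xi> n p)" using iQ2 iX by simp
      fix p assume p: "p \<in> space (W \<Otimes>\<^sub>M W)"
      \<comment> \<open>Young's inequality multiplied by \<open>l\<close>: this sum of squares
        expands to twice the claimed difference.\<close>
      have "0 \<le> (l * Q p - H n p)\<^sup>2 + l\<^sup>2 * (Q p)\<^sup>2 + (H n p)\<^sup>2" by simp
      then have "Q p * H n p * l \<le> (l * (Q p)\<^sup>2) * l + (H n p)\<^sup>2"
        by (simp add: power2_eq_square algebra_simps)
      also have "(H n p)\<^sup>2 = \<bar>H n p\<bar> * \<bar>H n p\<bar>" by (simp add: power2_eq_square)
      also have "\<bar>H n p\<bar> * \<bar>H n p\<bar> \<le> b * ((C + 2 * e * C) * \<Xi> n p)"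
        using H[OF p, of n] b0 by (intro mult_mono) auto
      finally have "Q p * H n p * l \<le> (l * (Q p)\<^sup>2) * l + b * ((C + 2 * e * C) * \<Xi> n p)" by simp
      moreover have "((b * (C + 2 * e * C)) / l * \<Xi> n p) * l = b * ((C + 2 * e * C) * \<Xi> n p)" using l by simp
      ultimately have "Q p * H n p * l \<le> (l * (Q p)\<^sup>2 + (b * (C + 2 * e * C)) / l * \<Xi> n p) * l"
        unfolding distrib_right by linarith
      then show "Q p * H n p \<le> l * (Q p)\<^sup>2 + (b * (C + 2 * e * C)) / l * \<Xi> n p" 
        using l by (rule mult_right_le_imp_le)
    qed
    also have "\<dots> = l * (LINT p|(W \<Otimes>\<^sub>M W). (Q p)\<^sup>2) + (b * (C + 2 * e * C)) / l * integral\<^sup>L (W \<Otimes>\<^sub>M W) (\<Xi> n)"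
      using iQ2 iX by simp
    finally show "(LINT s|M. (feynman_kac W B c g \<beta> (\<epsilon> n) t x s - (LINT \<omega>|W. g (x + B t \<omega>)) * exp (t * \<sigma>))\<^sup>2)
      \<le> l * (LINT p|(W \<Otimes>\<^sub>M W). (Q p)\<^sup>2) + (b * (C + 2 * e * C)) / l * integral\<^sup>L (W \<Otimes>\<^sub>M W) (\<Xi> n)" .
  qed simp
qed

end

section \<open>The heat equation\<close>

text \<open>The mean value theorem bounds the difference quotients by \<open>w\<close>, and
  dominated convergence along sequences gives the derivative; hence the majorant has to hold on a
  whole interval around \<open>x0\<close>.\<close>

lemma has_real_derivative_integral:
  fixes f f' :: "real \<Rightarrow> 'a \<Rightarrow> real"
  assumes x0: "x0 \<in> {a<..<b}"
    and deriv: "\<And>x y. x \<in> {a<..<b} \<Longrightarrow> y \<in> space M \<Longrightarrow> ((\<lambda>x. f x y) has_real_derivative f' x y) (at x)"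
    and int: "\<And>x. x \<in> {a<..<b} \<Longrightarrow> integrable M (f x)"
    and meas: "f' x0 \<in> borel_measurable M"
    and bound: "\<And>x y. x \<in> {a<..<b} \<Longrightarrow> y \<in> space M \<Longrightarrow> \<bar>f' x y\<bar> \<le> w y"
    and w: "integrable M w"
  shows "((\<lambda>x. LINT y|M. f x y) has_real_derivative (LINT y|M. f' x0 y)) (at x0)"
proof -
  have "((\<lambda>x. ((LINT y|M. f x y) - (LINT y|M. f x0 y)) / (x - x0)) \<longlongrightarrow> (LINT y|M. f' x0 y)) (at x0 within {a<..<b})"
    unfolding tendsto_at_iff_sequentially
  proof (intro allI impI)
    fix X :: "nat \<Rightarrow> real" assume X: "\<forall>i. X i \<in> {a<..<b} - {x0}" "X \<longlonglongrightarrow> x0"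
    have lim: "(\<lambda>i. LINT y|M. (f (X i) y - f x0 y) / (X i - x0)) \<longlonglongrightarrow> (LINT y|M. f' x0 y)"
    proof (rule integral_dominated_convergence[OF meas _ w])
      show "(\<lambda>y. (f (X i) y - f x0 y) / (X i - x0)) \<in> borel_measurable M" for i
        using int[of "X i"] int[OF x0] X by auto
      show "AE y in M. (\<lambda>i. (f (X i) y - f x0 y) / (X i - x0)) \<longlonglongrightarrow> f' x0 y"
      proof (rule AE_I2)
        fix y assume y: "y \<in> space M"
        have "((\<lambda>x. (f x y - f x0 y) / (x - x0)) \<longlongrightarrow> f' x0 y) (at x0)"
          using deriv[OF x0 y] by (simp add: has_field_derivative_iff)
        then show "(\<lambda>i. (f (X i) y - f x0 y) / (X i - x0)) \<longlonglongrightarrow> f' x0 y"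
          using X unfolding tendsto_at_iff_sequentially comp_def by auto
      qed
      show "AE y in M. norm ((f (X i) y - f x0 y) / (X i - x0)) \<le> w y" for i
      proof (rule AE_I2)
        fix y assume y: "y \<in> space M"
        have Xi: "X i \<in> {a<..<b}" "X i \<noteq> x0" using X by auto
        have "\<exists>z\<in>{a<..<b}. f (X i) y - f x0 y = (X i - x0) * f' z y"
        proof (cases "X i < x0")
          case True
          have "\<exists>z>X i. z < x0 \<and> f x0 y - f (X i) y = (x0 - X i) * f' z y"
            by (rule MVT2[OF True]) (use deriv y Xi x0 in auto)
          then obtain z where z: "X i < z" "z < x0" "f x0 y - f (X i) y = (x0 - X i) * f' z y" by blast
          then have "f (X i) y - f x0 y = (X i - x0) * f' z y" by (simp add: algebra_simps)
          then show ?thesis using z Xi x0 by (intro bexI[of _ z]) auto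
        next
          case False
          then have "x0 < X i" using Xi by auto
          then have "\<exists>z>x0. z < X i \<and> f (X i) y - f x0 y = (X i - x0) * f' z y"
            by (rule MVT2) (use deriv y Xi x0 in auto)
          then show ?thesis using Xi x0 by auto
        qed
        then obtain z where "z \<in> {a<..<b}" "f (X i) y - f x0 y = (X i - x0) * f' z y" by blast
        then show "norm ((f (X i) y - f x0 y) / (X i - x0)) \<le> w y"
          using bound[of z y] y Xi by simp
      qed
    qed
    have eq: "(LINT y|M. (f (X i) y - f x0 y) / (X i - x0)) = ((LINT y|M. f (X i) y) - (LINT y|M. f x0 y)) / (X i - x0)" for i
      using int[of "X i"] int[OF x0] X by (subst Bochner_Integration.integral_divide_zero, subst Bochner_Integration.integral_diff) auto
    show "((\<lambda>x. ((LINT y|M. f x y) - (LINT y|M. f x0 y)) / (x - x0)) \<circ> X) \<longlonglongrightarrow> (LINT y|M. f' x0 y)"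
      using lim unfolding comp_def eq .
  qed
  moreover have "at x0 within {a<..<b} = at x0" using x0 by (intro at_within_open) auto
  ultimately show ?thesis unfolding has_field_derivative_iff by metis
qed

text \<open>\<open>heat_kernel 0\<close> is the Gaussian density with variance \<open>t\<close>; with \<open>z = y - x\<close>, the indices
  \<open>1\<close> and \<open>2\<close> are its first and second derivatives in \<open>x\<close>.\<close>

definition heat_kernel :: "nat \<Rightarrow> real \<Rightarrow> real \<Rightarrow> real" where
  "heat_kernel j t z = (if j = 0 then 1 else if j = 1 then z / t else z\<^sup>2 / t\<^sup>2 - 1 / t) *
     exp (- z\<^sup>2 / (2 * t) - ln (2 * pi * t) / 2)"

lemma heat_kernel_measurable [measurable]: "heat_kernel j t \<in> borel_measurable borel"
  unfolding heat_kernel_def[abs_def] by measurable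

text \<open>The normalizing factor stands inside the exponential so that differentiation in
  \<open>t\<close> is one chain rule; here it is turned back into 1/sqrt(2 pi t).\<close>

lemma heat_kernel_density:
  assumes "0 < t"
  shows "heat_kernel 0 t z = normal_density 0 (sqrt t) z"
proof -
  have "exp (ln (2 * pi * t) / 2) = sqrt (2 * pi * t)"
    using assms by (simp add: powr_half_sqrt[symmetric] powr_def)
  then have "exp (- ln (2 * pi * t) / 2) = 1 / sqrt (2 * pi * t)"
    by (simp add: exp_minus inverse_eq_divide)
  moreover have "exp (- z\<^sup>2 / (2 * t) - ln (2 * pi * t) / 2) = exp (- z\<^sup>2 / (2 * t)) * exp (- ln (2 * pi * t) / 2)"
    by (simp flip: exp_add)
  ultimately show ?thesis using assms by (simp add: heat_kernel_def normal_density_def)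
qed

text \<open>By the third identity the kernel itself solves the heat equation; convolutions with it
  inherit this by differentiation under the integral.\<close>

lemma heat_kernel_derivatives:
  assumes t: "0 < t"
  shows "((\<lambda>x. heat_kernel 0 t (y - x)) has_real_derivative heat_kernel 1 t (y - x)) (at x)"
    and "((\<lambda>x. heat_kernel 1 t (y - x)) has_real_derivative heat_kernel 2 t (y - x)) (at x)"
    and "((\<lambda>t. heat_kernel 0 t z) has_real_derivative 1 / 2 * heat_kernel 2 t z) (at t)"
proof -
  have e: "((\<lambda>x. - (y - x)\<^sup>2 / (2 * t) - ln (2 * pi * t) / 2) has_real_derivative (y - x) / t) (at x)"
    using t by (auto intro!: derivative_eq_intros simp: field_simps)
  have hk: "heat_kernel 1 t z = z / t * heat_kernel 0 t z" "heat_kernel 2 t z = (z\<^sup>2 / t\<^sup>2 - 1 / t) * heat_kernel 0 t z" for z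
    by (simp_all add: heat_kernel_def)
  show 0: "((\<lambda>x. heat_kernel 0 t (y - x)) has_real_derivative heat_kernel 1 t (y - x)) (at x)"
    using DERIV_fun_exp[OF e] by (simp add: heat_kernel_def mult.commute)
  have lin: "((\<lambda>x. (y - x) / t) has_real_derivative - 1 / t) (at x)"
    using t by (auto intro!: derivative_eq_intros simp: field_simps)
  have "- 1 / t * h + (z / t * h) * (z / t) = (z\<^sup>2 / t\<^sup>2 - 1 / t) * h" for z h :: real
    by (simp add: power2_eq_square left_diff_distrib)
  from this[of "heat_kernel 0 t (y - x)" "y - x"]
  have "- 1 / t * heat_kernel 0 t (y - x) + heat_kernel 1 t (y - x) * ((y - x) / t) = heat_kernel 2 t (y - x)"
    unfolding hk .
  with DERIV_mult[OF lin 0]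
  have "((\<lambda>x. (y - x) / t * heat_kernel 0 t (y - x)) has_real_derivative heat_kernel 2 t (y - x)) (at x)"
    by (simp only:)
  then show "((\<lambda>x. heat_kernel 1 t (y - x)) has_real_derivative heat_kernel 2 t (y - x)) (at x)"
    unfolding hk(1) .
  have "((\<lambda>t. - z\<^sup>2 / (2 * t) - ln (2 * pi * t) / 2) has_real_derivative 1 / 2 * (z\<^sup>2 / t\<^sup>2 - 1 / t)) (at t)"
    using t by (auto intro!: derivative_eq_intros simp: field_simps power2_eq_square)
  from DERIV_fun_exp[OF this]
  show "((\<lambda>t. heat_kernel 0 t z) has_real_derivative 1 / 2 * heat_kernel 2 t z) (at t)"
    by (simp add: heat_kernel_def mult_ac)
qed

lemma mult_exp_le:
  fixes s b :: real
  assumes "0 \<le> s" "0 < b"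
  shows "s * exp (- (s / b)) \<le> b"
proof -
  have "s / b \<le> exp (s / b)" using exp_ge_add_one_self[of "s / b"] by linarith
  then have "s / b * exp (- (s / b)) \<le> exp (s / b) * exp (- (s / b))" by (intro mult_right_mono) auto
  also have "\<dots> = 1" by (simp flip: exp_add)
  finally show ?thesis using assms by (simp add: field_simps)
qed

text \<open>A single polynomial majorant for all three prefactors, so that one dominating function
  serves the kernel and its derivatives.\<close>

lemma heat_factor_bound:
  fixes z :: real
  assumes ab: "0 < a" "a \<le> t"
  shows "\<bar>if (j :: nat) = 0 then 1 else if j = 1 then z / t else z\<^sup>2 / t\<^sup>2 - 1 / t\<bar> \<le> (1 + 1 / a + 1 / a\<^sup>2) * (1 + z\<^sup>2)"
proof -
  have z: "\<bar>z\<bar> \<le> 1 + z\<^sup>2"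
  proof -
    have "0 \<le> (\<bar>z\<bar> - 1)\<^sup>2" by simp
    also have "\<dots> = z\<^sup>2 - 2 * \<bar>z\<bar> + 1" by (simp add: power2_diff)
    finally show ?thesis by (simp add: abs_if split: if_splits)
  qed
  have t: "0 < t" using ab by linarith
  have ia: "1 / t \<le> 1 / a" "1 / t\<^sup>2 \<le> 1 / a\<^sup>2" using ab t by (auto intro!: divide_left_mono power_mono)
  have p: "0 \<le> 1 / a" "0 \<le> 1 / a\<^sup>2" "0 \<le> z\<^sup>2" "0 \<le> 1 / t" using ab t by auto
  have q: "0 \<le> 1 / a * z\<^sup>2" "0 \<le> 1 / a\<^sup>2 * z\<^sup>2" using p by (auto intro!: mult_nonneg_nonneg)
  have e: "(1 + 1 / a + 1 / a\<^sup>2) * (1 + z\<^sup>2) = 1 + 1 / a + 1 / a\<^sup>2 + z\<^sup>2 + 1 / a * z\<^sup>2 + 1 / a\<^sup>2 * z\<^sup>2"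
    by (simp add: distrib_left distrib_right)
  have "\<bar>z / t\<bar> = \<bar>z\<bar> * (1 / t)" using t by simp
  also have "\<dots> \<le> (1 + z\<^sup>2) * (1 / a)" using z ia p by (intro mult_mono) auto
  also have "\<dots> = 1 / a + 1 / a * z\<^sup>2" by (simp add: add_divide_distrib)
  finally have 1: "\<bar>z / t\<bar> \<le> 1 / a + 1 / a * z\<^sup>2" .
  have 2: "z\<^sup>2 / t\<^sup>2 \<le> 1 / a\<^sup>2 * z\<^sup>2" "0 \<le> z\<^sup>2 / t\<^sup>2"
    using mult_right_mono[OF ia(2) p(3)] by auto
  then have "\<bar>z\<^sup>2 / t\<^sup>2 - 1 / t\<bar> \<le> 1 / a + 1 / a\<^sup>2 * z\<^sup>2"
    using ia(1) p by (intro abs_leI) linarith+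
  then show ?thesis unfolding e using 1 p q by (simp only: split: if_split) (intro conjI impI; linarith)
qed

text \<open>With z = y - x the Gaussian exponent is split in two halves: one absorbs the factor
  \<open>1 + z\<^sup>2\<close>, the other is recentred from \<open>x\<close> to \<open>x0\<close> by
  \<open>(y - x0)\<^sup>2 \<le> 2 * z\<^sup>2 + 2 * (x - x0)\<^sup>2\<close>, at the price
  \<open>exp (1 / (4 * b))\<close>. The majorant thus depends on neither \<open>t\<close> nor
  \<open>x\<close>.\<close>

lemma heat_kernel_bound:
  assumes ab: "0 < a" "a \<le> t" "t \<le> b" and x: "\<bar>x - x0\<bar> \<le> 1"
  shows "\<bar>heat_kernel j t (y - x)\<bar> \<le>
    (1 + 1 / a + 1 / a\<^sup>2) * exp (- ln (2 * pi * a) / 2) * (1 + 4 * b) * exp (1 / (4 * b)) * exp (- (y - x0)\<^sup>2 / (8 * b))"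
proof -
  let ?z = "y - x"
  define E where "E = exp (- ln (2 * pi * a) / 2)"
  have b: "0 < b" "0 < t" using ab by linarith+
  have "\<bar>if j = 0 then 1 else if j = 1 then ?z / t else ?z\<^sup>2 / t\<^sup>2 - 1 / t\<bar> \<le> (1 + 1 / a + 1 / a\<^sup>2) * (1 + ?z\<^sup>2)"
    by (rule heat_factor_bound[OF ab(1,2)])
  moreover have "exp (- ?z\<^sup>2 / (2 * t) - ln (2 * pi * t) / 2) \<le> exp (- (?z\<^sup>2 / (2 * b))) * E"
  proof -
    have "ln (2 * pi * a) \<le> ln (2 * pi * t)" using ab b by (intro ln_mono) auto
    moreover have "?z\<^sup>2 / (2 * b) \<le> ?z\<^sup>2 / (2 * t)" using ab b by (intro divide_left_mono) auto
    ultimately show ?thesis unfolding E_def by (simp flip: exp_add)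
  qed
  ultimately have "\<bar>heat_kernel j t ?z\<bar> \<le> ((1 + 1 / a + 1 / a\<^sup>2) * (1 + ?z\<^sup>2)) * (exp (- (?z\<^sup>2 / (2 * b))) * E)"
    unfolding heat_kernel_def abs_mult by (intro mult_mono) (use ab in auto)
  also have "\<dots> = (1 + 1 / a + 1 / a\<^sup>2) * E * ((1 + ?z\<^sup>2) * exp (- (?z\<^sup>2 / (2 * b))))" by simp
  also have "\<dots> \<le> (1 + 1 / a + 1 / a\<^sup>2) * E * ((1 + 4 * b) * (exp (1 / (4 * b)) * exp (- (y - x0)\<^sup>2 / (8 * b))))"
  proof (rule mult_left_mono)
    have "exp (- (?z\<^sup>2 / (2 * b))) = exp (- (?z\<^sup>2 / (4 * b))) * exp (- (?z\<^sup>2 / (4 * b)))"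
      by (simp flip: exp_add)
    then have "(1 + ?z\<^sup>2) * exp (- (?z\<^sup>2 / (2 * b))) = ((1 + ?z\<^sup>2) * exp (- (?z\<^sup>2 / (4 * b)))) * exp (- (?z\<^sup>2 / (4 * b)))"
      by simp
    also have "\<dots> \<le> (1 + 4 * b) * (exp (1 / (4 * b)) * exp (- (y - x0)\<^sup>2 / (8 * b)))"
    proof (intro mult_mono)
      have "exp (- (?z\<^sup>2 / (4 * b))) \<le> 1" using b by simp
      moreover have "?z\<^sup>2 * exp (- (?z\<^sup>2 / (4 * b))) \<le> 4 * b" by (rule mult_exp_le) (use b in auto)
      ultimately show "(1 + ?z\<^sup>2) * exp (- (?z\<^sup>2 / (4 * b))) \<le> 1 + 4 * b"
        unfolding distrib_right mult_1_left by (rule add_mono)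
      have "(y - x0)\<^sup>2 \<le> 2 * ?z\<^sup>2 + 2 * (x - x0)\<^sup>2"
      proof -
        have "0 \<le> (?z - (x - x0))\<^sup>2" by simp
        then show ?thesis by (simp add: power2_eq_square algebra_simps)
      qed
      moreover have "(x - x0)\<^sup>2 \<le> 1" using x by (simp add: abs_square_le_1)
      ultimately have "(y - x0)\<^sup>2 / (8 * b) \<le> (2 * ?z\<^sup>2 + 2) / (8 * b)" using b by (intro divide_right_mono) auto
      also have "\<dots> = ?z\<^sup>2 / (4 * b) + 1 / (4 * b)" using b by (simp add: field_simps)
      finally have "- (?z\<^sup>2 / (4 * b)) \<le> 1 / (4 * b) + - (y - x0)\<^sup>2 / (8 * b)" by simp
      then show "exp (- (?z\<^sup>2 / (4 * b))) \<le> exp (1 / (4 * b)) * exp (- (y - x0)\<^sup>2 / (8 * b))"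
        unfolding exp_add[symmetric] by simp
    qed (use b in auto)
    finally show "(1 + ?z\<^sup>2) * exp (- (?z\<^sup>2 / (2 * b))) \<le> (1 + 4 * b) * (exp (1 / (4 * b)) * exp (- (y - x0)\<^sup>2 / (8 * b)))" .
  qed (use ab in \<open>auto simp: E_def\<close>)
  finally show ?thesis by (simp add: E_def mult_ac)
qed

lemma mult_le_sum_squares: "p * q \<le> p\<^sup>2 + q\<^sup>2" for p q :: real
proof -
  have "0 \<le> (p - q)\<^sup>2 + p\<^sup>2 + q\<^sup>2" by simp
  then show ?thesis by (simp add: power2_diff)
qed

lemma integrable_gauss:
  fixes b m :: real
  assumes "0 < b"
  shows "integrable lborel (\<lambda>y. exp (- (y - m)\<^sup>2 / b))"
proof -
  have s: "0 < sqrt (b / 2)" using assms by simp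
  have "integrable lborel (normal_density m (sqrt (b / 2)))" by (rule integrable_normal_density[OF s])
  then have "integrable lborel (\<lambda>y. sqrt (2 * pi * (sqrt (b / 2))\<^sup>2) * normal_density m (sqrt (b / 2)) y)"
    by (rule integrable_mult_right)
  moreover have "sqrt (2 * pi * (sqrt (b / 2))\<^sup>2) * normal_density m (sqrt (b / 2)) y = exp (- (y - m)\<^sup>2 / b)" for y
    using assms by (simp add: normal_density_def)
  ultimately show ?thesis by simp
qed

section \<open>Gaussian convolution of continuous square integrable data\<close>

locale heat_initial =
  fixes g :: "real \<Rightarrow> real"
  assumes g_cont: "continuous_on UNIV g" and g_sq: "integrable lborel (\<lambda>y. (g y)\<^sup>2)"
begin

lemma g_meas [measurable]: "g \<in> borel_measurable borel"
  using g_cont by (rule borel_measurable_continuous_onI)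

text \<open>Pointwise \<open>\<bar>g y\<bar> * e \<le> (g y)\<^sup>2 + e * e\<close>, and the square
  of a Gaussian is again a Gaussian, with \<open>b / 2\<close> in place of \<open>b\<close>.\<close>

lemma integrable_g_gauss:
  assumes "0 < b"
  shows "integrable lborel (\<lambda>y. \<bar>g y\<bar> * exp (- (y - m)\<^sup>2 / b))"
proof (rule Bochner_Integration.integrable_bound)
  have "integrable lborel (\<lambda>y. exp (- (y - m)\<^sup>2 / (b / 2)))" using assms by (intro integrable_gauss) simp
  then show "integrable lborel (\<lambda>y. (g y)\<^sup>2 + exp (- (y - m)\<^sup>2 / (b / 2)))" using g_sq by simp
  show "AE y in lborel. norm (\<bar>g y\<bar> * exp (- (y - m)\<^sup>2 / b)) \<le> norm ((g y)\<^sup>2 + exp (- (y - m)\<^sup>2 / (b / 2)))"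
  proof (rule AE_I2)
    fix y
    let ?e = "exp (- (y - m)\<^sup>2 / b)"
    have "?e * ?e = exp (- (y - m)\<^sup>2 / (b / 2))" by (simp flip: exp_add)
    moreover have "\<bar>g y\<bar> * ?e \<le> (g y)\<^sup>2 + ?e * ?e"
      using mult_le_sum_squares[of "\<bar>g y\<bar>" ?e] by (simp only: power2_abs power2_eq_square[of ?e])
    ultimately show "norm (\<bar>g y\<bar> * ?e) \<le> norm ((g y)\<^sup>2 + exp (- (y - m)\<^sup>2 / (b / 2)))" by simp
  qed
qed measurable

text \<open>\<open>V 0\<close> is the heat semigroup applied to \<open>g\<close>; \<open>V 1\<close>
  and \<open>V 2\<close> are the candidates for its spatial derivatives.\<close>

definition V :: "nat \<Rightarrow> real \<Rightarrow> real \<Rightarrow> real" where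
  "V j t x = (LINT y|lborel. g y * heat_kernel j t (y - x))"

text \<open>One majorant for all \<open>j\<close>, for \<open>t\<close> in a compact interval and
  \<open>x\<close> near \<open>x0\<close>; integrability, continuity and all derivatives rest on
  it.\<close>

lemma V_dominated:
  assumes "0 < a" "a \<le> b"
  obtains w where "integrable lborel w"
    "\<And>j t x y. a \<le> t \<Longrightarrow> t \<le> b \<Longrightarrow> \<bar>x - x0\<bar> \<le> 1 \<Longrightarrow> \<bar>g y * heat_kernel j t (y - x)\<bar> \<le> w y"
proof -
  define C where "C = (1 + 1 / a + 1 / a\<^sup>2) * exp (- ln (2 * pi * a) / 2) * (1 + 4 * b) * exp (1 / (4 * b))"
  show ?thesis
  proof (rule that)
    show "integrable lborel (\<lambda>y. C * (\<bar>g y\<bar> * exp (- (y - x0)\<^sup>2 / (8 * b))))"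
      using assms by (intro integrable_mult_right integrable_g_gauss) simp
    fix j t x y assume "a \<le> t" "t \<le> b" "\<bar>x - x0\<bar> \<le> 1"
    then have "\<bar>heat_kernel j t (y - x)\<bar> \<le> C * exp (- (y - x0)\<^sup>2 / (8 * b))"
      unfolding C_def using assms by (intro heat_kernel_bound) auto
    then have "\<bar>g y\<bar> * \<bar>heat_kernel j t (y - x)\<bar> \<le> \<bar>g y\<bar> * (C * exp (- (y - x0)\<^sup>2 / (8 * b)))" by (intro mult_left_mono) auto
    then show "\<bar>g y * heat_kernel j t (y - x)\<bar> \<le> C * (\<bar>g y\<bar> * exp (- (y - x0)\<^sup>2 / (8 * b)))"
      by (simp add: abs_mult mult_ac)
  qed
qed

lemma V_integrable:
  assumes "0 < t" shows "integrable lborel (\<lambda>y. g y * heat_kernel j t (y - x))"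
proof -
  obtain w where w: "integrable lborel w" "\<And>j t' x' y. t \<le> t' \<Longrightarrow> t' \<le> t \<Longrightarrow> \<bar>x' - x\<bar> \<le> 1 \<Longrightarrow> \<bar>g y * heat_kernel j t' (y - x')\<bar> \<le> w y"
    by (rule V_dominated[of t t x]) (use assms in auto)
  show ?thesis
    by (rule Bochner_Integration.integrable_bound[OF w(1)])
       (use order_trans[OF w(2) abs_ge_self, of t x] in \<open>auto intro!: AE_I2\<close>)
qed

lemma V_tendsto:
  assumes t0: "0 < t0" and T: "T \<longlonglongrightarrow> t0" and X: "X \<longlonglongrightarrow> x0"
  shows "(\<lambda>n. V j (T n) (X n)) \<longlonglongrightarrow> V j t0 x0"
proof -
  obtain w where w: "integrable lborel w" "\<And>j t' x' y. t0 / 2 \<le> t' \<Longrightarrow> t' \<le> 2 * t0 \<Longrightarrow> \<bar>x' - x0\<bar> \<le> 1 \<Longrightarrow> \<bar>g y * heat_kernel j t' (y - x')\<bar> \<le> w y"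
    by (rule V_dominated[of "t0 / 2" "2 * t0" x0]) (use t0 in auto)
  have "\<forall>\<^sub>F n in sequentially. t0 / 2 < T n \<and> T n < 2 * t0 \<and> x0 - 1 < X n \<and> X n < x0 + 1"
    by (intro eventually_conj order_tendstoD[OF T] order_tendstoD[OF X]) (use t0 in auto)
  then obtain N where N: "\<And>n. n \<ge> N \<Longrightarrow> t0 / 2 < T n \<and> T n < 2 * t0 \<and> x0 - 1 < X n \<and> X n < x0 + 1"
    by (auto simp: eventually_sequentially)
  \<comment> \<open>Domination holds only once \<open>T n\<close> and \<open>X n\<close> are near
    \<open>t0\<close> and \<open>x0\<close>, hence the shift by \<open>N\<close>.\<close>
  have "(\<lambda>n. V j (T (n + N)) (X (n + N))) \<longlonglongrightarrow> V j t0 x0"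
    unfolding V_def
  proof (rule integral_dominated_convergence[where w=w])
    show "AE y in lborel. (\<lambda>n. g y * heat_kernel j (T (n + N)) (y - X (n + N))) \<longlonglongrightarrow> g y * heat_kernel j t0 (y - x0)"
    proof (rule AE_I2)
      fix y
      note T' = LIMSEQ_ignore_initial_segment[OF T, of N] and X' = LIMSEQ_ignore_initial_segment[OF X, of N]
      have "(\<lambda>n. if j = 0 then 1 else if j = 1 then (y - X (n + N)) / T (n + N) else (y - X (n + N))\<^sup>2 / (T (n + N))\<^sup>2 - 1 / T (n + N))
        \<longlonglongrightarrow> (if j = 0 then 1 else if j = 1 then (y - x0) / t0 else (y - x0)\<^sup>2 / t0\<^sup>2 - 1 / t0)"
        using t0 by (auto intro!: tendsto_intros T' X')
      moreover have "(\<lambda>n. exp (- (y - X (n + N))\<^sup>2 / (2 * T (n + N)) - ln (2 * pi * T (n + N)) / 2))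
        \<longlonglongrightarrow> exp (- (y - x0)\<^sup>2 / (2 * t0) - ln (2 * pi * t0) / 2)"
        using t0 by (auto intro!: tendsto_intros T' X')
      ultimately show "(\<lambda>n. g y * heat_kernel j (T (n + N)) (y - X (n + N))) \<longlonglongrightarrow> g y * heat_kernel j t0 (y - x0)"
        unfolding heat_kernel_def by (intro tendsto_mult tendsto_const)
    qed
    show "AE y in lborel. norm (g y * heat_kernel j (T (n + N)) (y - X (n + N))) \<le> w y" for n
      unfolding real_norm_def by (intro AE_I2 w(2)) (use N[of "n + N"] in auto)
  qed (use w in measurable)
  then show ?thesis by (rule LIMSEQ_offset)
qed

lemma V_derivatives:
  assumes t: "0 < t"
  shows "((\<lambda>y. V 0 t y) has_real_derivative V 1 t x) (at x)"
    and "((\<lambda>y. V 1 t y) has_real_derivative V 2 t x) (at x)"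
    and "((\<lambda>r. V 0 r x) has_real_derivative 1 / 2 * V 2 t x) (at t)"
proof -
  obtain w where w: "integrable lborel w" "\<And>j t' x' y. t / 2 \<le> t' \<Longrightarrow> t' \<le> 2 * t \<Longrightarrow> \<bar>x' - x\<bar> \<le> 1 \<Longrightarrow> \<bar>g y * heat_kernel j t' (y - x')\<bar> \<le> w y"
    by (rule V_dominated[of "t / 2" "2 * t" x]) (use t in auto)
  have ineq: "t / 2 \<le> t" "t \<le> 2 * t" using t by auto
  show "((\<lambda>y. V 0 t y) has_real_derivative V 1 t x) (at x)"
    unfolding V_def
  proof (rule has_real_derivative_integral[where a="x - 1" and b="x + 1" and w=w])
    show "\<bar>g y * heat_kernel 1 t (y - x')\<bar> \<le> w y" if "x' \<in> {x - 1<..<x + 1}" for x' y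
      using that ineq by (intro w(2)) auto
  qed (use w(1) t V_integrable in \<open>auto intro!: DERIV_cmult heat_kernel_derivatives simp del: One_nat_def\<close>)
  show "((\<lambda>y. V 1 t y) has_real_derivative V 2 t x) (at x)"
    unfolding V_def
  proof (rule has_real_derivative_integral[where a="x - 1" and b="x + 1" and w=w])
    show "\<bar>g y * heat_kernel 2 t (y - x')\<bar> \<le> w y" if "x' \<in> {x - 1<..<x + 1}" for x' y
      using that ineq by (intro w(2)) auto
  qed (use w(1) t V_integrable in \<open>auto intro!: DERIV_cmult heat_kernel_derivatives simp del: One_nat_def\<close>)
  have "((\<lambda>r. V 0 r x) has_real_derivative (LINT y|lborel. g y * (1 / 2 * heat_kernel 2 t (y - x)))) (at t)"
    unfolding V_def
  proof (rule has_real_derivative_integral[where a="t / 2" and b="2 * t" and w=w])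
    show "\<bar>g y * (1 / 2 * heat_kernel 2 t' (y - x))\<bar> \<le> w y" if "t' \<in> {t / 2<..<2 * t}" for t' y
      
    proof -
      have "\<bar>g y * heat_kernel 2 t' (y - x)\<bar> \<le> w y" by (rule w(2)) (use that in auto)
      then show ?thesis using abs_ge_zero[of "g y * heat_kernel 2 t' (y - x)"] by simp
    qed
    show "((\<lambda>r. g y * heat_kernel 0 r (y - x)) has_real_derivative g y * (1 / 2 * heat_kernel 2 t' (y - x))) (at t')"
      if "t' \<in> {t / 2<..<2 * t}" for t' y
      using that t by (intro DERIV_cmult heat_kernel_derivatives) auto
    show "integrable lborel (\<lambda>y. g y * heat_kernel 0 t' (y - x))" if "t' \<in> {t / 2<..<2 * t}" for t'
      using that t by (intro V_integrable) auto
  qed (use w(1) t in auto)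
  moreover have "(LINT y|lborel. g y * (1 / 2 * heat_kernel 2 t (y - x))) = 1 / 2 * V 2 t x"
    unfolding V_def by (subst Bochner_Integration.integral_mult_right_zero[symmetric]) (simp only: mult.left_commute)
  ultimately show "((\<lambda>r. V 0 r x) has_real_derivative 1 / 2 * V 2 t x) (at t)" by simp
qed

text \<open>Near \<open>x0\<close> continuity of \<open>g\<close> is used. Far away \<open>g\<close>
  may be unbounded, but there the kernel is at most \<open>4 * sqrt t / r\<^sup>2\<close> times a
  Gaussian of fixed width, which is integrable against \<open>\<bar>g\<bar>\<close>. Uniformity in
  \<open>x\<close> gives joint continuity at time 0.\<close>

lemma V_initial:
  assumes e: "0 < e"
  shows "\<exists>\<delta>>0. \<forall>t x. 0 < t \<and> t < \<delta> \<and> \<bar>x - x0\<bar> < \<delta> \<longrightarrow> \<bar>V 0 t x - g x0\<bar> < e"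
proof -
  obtain \<rho> where \<rho>: "0 < \<rho>" "\<And>y. \<bar>y - x0\<bar> < \<rho> \<Longrightarrow> \<bar>g y - g x0\<bar> < e / 2"
  proof -
    have "isCont g x0" using g_cont by (simp add: continuous_on_eq_continuous_at)
    then show ?thesis using that e unfolding continuous_at_eps_delta dist_real_def
      by (metis half_gt_zero)
  qed
  \<comment> \<open>Half of \<rho>: for \<open>x\<close> within \<open>r\<close> of
    \<open>x0\<close>, every \<open>y\<close> with \<open>\<bar>y - x0\<bar> \<ge> \<rho>\<close> is
    at distance at least \<open>r\<close> from \<open>x\<close>.\<close>
  define r where "r = \<rho> / 2"
  have r: "0 < r" using \<rho> by (simp add: r_def)
  define S where "S = (LINT y|lborel. (g y)\<^sup>2) + (LINT z|lborel. exp (- z\<^sup>2 / 2)) + \<bar>g x0\<bar> * (LINT z|lborel. exp (- z\<^sup>2 / 4)) + 1"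
  have i2: "integrable lborel (\<lambda>z::real. exp (- z\<^sup>2 / 2))" "integrable lborel (\<lambda>z::real. exp (- z\<^sup>2 / 4))"
    using integrable_gauss[of 2 0] integrable_gauss[of 4 0] by simp_all
  have S0: "0 < S" unfolding S_def
    by (intro add_nonneg_pos add_nonneg_nonneg mult_nonneg_nonneg Bochner_Integration.integral_nonneg) auto
  \<comment> \<open>The last entry solves \<open>4 * sqrt t / r\<^sup>2 * S = e / 2\<close> for
    \<open>t\<close>; the entry 1 ensures \<open>t < 1\<close>, used to replace \<open>4 * t\<close>
    by 4 in an exponent.\<close>
  define \<delta> where "\<delta> = min (min 1 r) ((e / 2 / (4 / r\<^sup>2 * S))\<^sup>2)"
  have d: "0 < \<delta>" using e r S0 by (auto simp: \<delta>_def)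
  show ?thesis
  proof (intro exI[of _ \<delta>] conjI d allI impI)
    fix t x assume a: "0 < t \<and> t < \<delta> \<and> \<bar>x - x0\<bar> < \<delta>"
    then have t: "0 < t" "t < 1" and x: "\<bar>x - x0\<bar> < r" by (auto simp: \<delta>_def)
    have tS: "4 * sqrt t / r\<^sup>2 * S < e / 2"
    proof -
      have pos: "0 < 4 / r\<^sup>2 * S" using r S0 by simp
      have "sqrt t < sqrt ((e / 2 / (4 / r\<^sup>2 * S))\<^sup>2)" using a by (simp only: real_sqrt_less_iff) (simp add: \<delta>_def)
      also have "\<dots> = e / 2 / (4 / r\<^sup>2 * S)" 
        by (rule real_sqrt_unique[OF refl divide_nonneg_pos]) (use e pos in auto)
      finally have "sqrt t * (4 / r\<^sup>2 * S) < e / 2" using pos by (simp only: pos_less_divide_eq)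
      then show ?thesis by (simp add: mult_ac)
    qed
    let ?p = "\<lambda>y. heat_kernel 0 t (y - x)"
    have pd: "?p y = normal_density x (sqrt t) y" for y
      using t by (simp add: heat_kernel_density normal_density_def)
    have st: "0 < sqrt t" using t by simp
    have ip: "integrable lborel ?p" and p1: "(LINT y|lborel. ?p y) = 1"
      unfolding pd using integrable_normal_density[OF st, of x] integral_normal_density[OF st, of x] by auto
    have p0: "0 \<le> ?p y" for y by (simp add: heat_kernel_def)
    let ?w = "\<lambda>y. e / 2 * ?p y + 4 * sqrt t / r\<^sup>2 * ((g y)\<^sup>2 + exp (- (y - x)\<^sup>2 / 2) + \<bar>g x0\<bar> * exp (- (y - x)\<^sup>2 / 4))"
    have iw: "integrable lborel ?w"
      using ip g_sq integrable_gauss[of 2 x] integrable_gauss[of 4 x] by simp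
    have "V 0 t x - g x0 = (LINT y|lborel. g y * ?p y - g x0 * ?p y)"
      unfolding V_def using V_integrable[OF t(1), of 0 x] ip p1 by (subst Bochner_Integration.integral_diff) auto
    then have "\<bar>V 0 t x - g x0\<bar> = \<bar>LINT y|lborel. g y * ?p y - g x0 * ?p y\<bar>" by (rule arg_cong)
    also have "\<dots> \<le> (LINT y|lborel. \<bar>g y * ?p y - g x0 * ?p y\<bar>)"
      by (rule integral_abs_bound)
    also have "\<dots> \<le> (LINT y|lborel. ?w y)"
    proof (rule integral_mono[OF _ iw])
      show "integrable lborel (\<lambda>y. \<bar>g y * ?p y - g x0 * ?p y\<bar>)"
        using V_integrable[OF t(1), of 0 x] ip by simp
      fix y
      have eq: "\<bar>g y * ?p y - g x0 * ?p y\<bar> = ?p y * \<bar>g y - g x0\<bar>"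
        using p0[of y] by (simp add: abs_mult mult.commute flip: left_diff_distrib)
      let ?rest = "(g y)\<^sup>2 + exp (- (y - x)\<^sup>2 / 2) + \<bar>g x0\<bar> * exp (- (y - x)\<^sup>2 / 4)"
      have rest: "0 \<le> 4 * sqrt t / r\<^sup>2 * ?rest" using t by simp
      show "\<bar>g y * ?p y - g x0 * ?p y\<bar> \<le> ?w y"
      proof (cases "\<bar>y - x0\<bar> < \<rho>")
        case True
        have "?p y * \<bar>g y - g x0\<bar> \<le> ?p y * (e / 2)" using \<rho>(2)[OF True] p0 by (intro mult_left_mono) auto
        then show ?thesis unfolding eq using rest by (simp add: mult.commute)
      next
        case False
        define z where "z = y - x"
        have "r \<le> \<bar>z\<bar>" using False x unfolding z_def r_def by linarith
        then have z: "r\<^sup>2 \<le> z\<^sup>2" using r by (simp add: abs_le_square_iff[symmetric])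
        have "?p y \<le> 4 * sqrt t / r\<^sup>2 * exp (- z\<^sup>2 / 4)"
        proof -
          have "?p y = 1 / sqrt (2 * pi * t) * exp (- z\<^sup>2 / (2 * t))"
            using t by (simp add: heat_kernel_density normal_density_def z_def)
          \<comment> \<open>One half of the exponent yields the factor
            \<open>4 * t / r\<^sup>2\<close>, which beats the singularity 1/sqrt(t) of the density;
            the other half keeps a fixed Gaussian.\<close>
          also have "exp (- z\<^sup>2 / (2 * t)) = exp (- (z\<^sup>2 / (4 * t))) * exp (- (z\<^sup>2 / (4 * t)))"
            by (simp flip: exp_add)
          also have "1 / sqrt (2 * pi * t) * (exp (- (z\<^sup>2 / (4 * t))) * exp (- (z\<^sup>2 / (4 * t))))
            \<le> 1 / sqrt t * ((4 * t / r\<^sup>2) * exp (- z\<^sup>2 / 4))"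
          proof (intro mult_mono)
            have "t * 1 \<le> t * (2 * pi)" using t pi_gt3 by (intro mult_left_mono) auto
            then show "1 / sqrt (2 * pi * t) \<le> 1 / sqrt t" using t
              by (intro divide_left_mono) (auto simp: mult_ac)
            have "exp (- (z\<^sup>2 / (4 * t))) \<le> exp (- (r\<^sup>2 / (4 * t)))" using z t by (simp add: divide_right_mono)
            also have "\<dots> \<le> 4 * t / r\<^sup>2"
              using mult_exp_le[of "r\<^sup>2" "4 * t"] r t by (simp add: pos_le_divide_eq mult.commute)
            finally show "exp (- (z\<^sup>2 / (4 * t))) \<le> 4 * t / r\<^sup>2" .
            have "z\<^sup>2 / 4 \<le> z\<^sup>2 / (4 * t)" using t by (intro divide_left_mono) auto
            then show "exp (- (z\<^sup>2 / (4 * t))) \<le> exp (- z\<^sup>2 / 4)" by simp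
          qed (use t r in auto)
          also have "\<dots> = 4 * (t / sqrt t) / r\<^sup>2 * exp (- z\<^sup>2 / 4)" by simp
          also have "t / sqrt t = sqrt t" using t by (simp add: real_div_sqrt)
          finally show ?thesis .
        qed
        then have "?p y * \<bar>g y - g x0\<bar> \<le> (4 * sqrt t / r\<^sup>2 * exp (- z\<^sup>2 / 4)) * (\<bar>g y\<bar> + \<bar>g x0\<bar>)"
          using p0[of y] t by (intro mult_mono) auto
        also have "\<dots> = 4 * sqrt t / r\<^sup>2 * (\<bar>g y\<bar> * exp (- z\<^sup>2 / 4) + \<bar>g x0\<bar> * exp (- z\<^sup>2 / 4))"
          by (simp only: distrib_left mult.assoc mult.commute[of "exp _"])
        also have "\<dots> \<le> 4 * sqrt t / r\<^sup>2 * ?rest"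
        proof (intro mult_left_mono add_mono)
          have "exp (- z\<^sup>2 / 4) * exp (- z\<^sup>2 / 4) = exp (- z\<^sup>2 / 2)" by (simp flip: exp_add)
          moreover have "\<bar>g y\<bar> * exp (- z\<^sup>2 / 4) \<le> (g y)\<^sup>2 + exp (- z\<^sup>2 / 4) * exp (- z\<^sup>2 / 4)"
            using mult_le_sum_squares[of "\<bar>g y\<bar>" "exp (- z\<^sup>2 / 4)"]
            by (simp only: power2_abs power2_eq_square[of "exp _"])
          ultimately show "\<bar>g y\<bar> * exp (- z\<^sup>2 / 4) \<le> (g y)\<^sup>2 + exp (- (y - x)\<^sup>2 / 2)" by (simp add: z_def)
        qed (use t in \<open>auto simp: z_def\<close>)
        finally show ?thesis unfolding eq using e p0[of y] by (simp add: add_increasing)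
      qed
    qed
    also have "\<dots> = e / 2 + 4 * sqrt t / r\<^sup>2 * ((LINT y|lborel. (g y)\<^sup>2) + (LINT y|lborel. exp (- (y - x)\<^sup>2 / 2)) + \<bar>g x0\<bar> * (LINT y|lborel. exp (- (y - x)\<^sup>2 / 4)))"
      using ip g_sq integrable_gauss[of 2 x] integrable_gauss[of 4 x] by (simp add: p1)
    also have "(LINT y|lborel. exp (- (y - x)\<^sup>2 / 2)) = (LINT z|lborel. exp (- z\<^sup>2 / 2))"
      by (subst lborel_integral_real_affine[where c=1 and t=x]) auto
    also have "(LINT y|lborel. exp (- (y - x)\<^sup>2 / 4)) = (LINT z|lborel. exp (- z\<^sup>2 / 4))"
      by (subst lborel_integral_real_affine[where c=1 and t=x]) auto
    also have "e / 2 + 4 * sqrt t / r\<^sup>2 * ((LINT y|lborel. (g y)\<^sup>2) + (LINT z|lborel. exp (- z\<^sup>2 / 2)) + \<bar>g x0\<bar> * (LINT z|lborel. exp (- z\<^sup>2 / 4)))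
      \<le> e / 2 + 4 * sqrt t / r\<^sup>2 * S"
      unfolding S_def using t by (intro add_left_mono mult_left_mono) auto
    finally show "\<bar>V 0 t x - g x0\<bar> < e" using tS by linarith
  qed
qed

theorem classical_solution_heat:
  assumes u: "\<And>t x. 0 < t \<Longrightarrow> u t x = V 0 t x * exp (\<sigma> * t)" and u0: "\<And>x. u 0 x = g x"
  shows "classical_solution \<sigma> g u"
proof -
  have V_cont: "continuous_on ({0<..} \<times> UNIV) (\<lambda>(t, x). V j t x * exp (\<sigma> * t))" for j
    unfolding continuous_on_sequentially
  proof (intro allI ballI impI, elim conjE)
    fix a :: "real \<times> real" and X assume a: "a \<in> {0<..} \<times> UNIV" and X: "X \<longlonglongrightarrow> a"
    have "(\<lambda>n. V j (fst (X n)) (snd (X n)) * exp (\<sigma> * fst (X n))) \<longlonglongrightarrow> V j (fst a) (snd a) * exp (\<sigma> * fst a)"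
      by (intro tendsto_intros V_tendsto tendsto_fst[OF X] tendsto_snd[OF X]) (use a in auto)
    then show "((\<lambda>(t, x). V j t x * exp (\<sigma> * t)) \<circ> X) \<longlonglongrightarrow> (case a of (t, x) \<Rightarrow> V j t x * exp (\<sigma> * t))"
      by (simp add: comp_def case_prod_beta')
  qed
  have u_cont: "continuous_on ({0..} \<times> UNIV) (\<lambda>(t, x). u t x)"
    unfolding continuous_on_sequentially
  proof (intro allI ballI impI, elim conjE)
    fix a :: "real \<times> real" and X assume a: "a \<in> {0..} \<times> UNIV" and Xin: "\<forall>n. X n \<in> {0..} \<times> UNIV" and X: "X \<longlonglongrightarrow> a"
    obtain t0 x0 where a_eq: "a = (t0, x0)" by (cases a)
    define T Y where "T = (\<lambda>n. fst (X n))" and "Y = (\<lambda>n. snd (X n))"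
    have TY: "T \<longlonglongrightarrow> t0" "Y \<longlonglongrightarrow> x0" using tendsto_fst[OF X] tendsto_snd[OF X] by (auto simp: T_def Y_def a_eq)
    have T0: "0 \<le> T n" for n using Xin by (auto simp: T_def dest!: spec[of _ n])
    have "(\<lambda>n. u (T n) (Y n)) \<longlonglongrightarrow> u t0 x0"
    proof (cases "0 < t0")
      case True
      have "\<forall>\<^sub>F n in sequentially. 0 < T n" using order_tendstoD(1)[OF TY(1) True] .
      then have ev: "\<forall>\<^sub>F n in sequentially. V 0 (T n) (Y n) * exp (\<sigma> * T n) = u (T n) (Y n)"
        by eventually_elim (simp add: u)
      have "(\<lambda>n. V 0 (T n) (Y n) * exp (\<sigma> * T n)) \<longlonglongrightarrow> u t0 x0"
        unfolding u[OF True] by (intro tendsto_intros V_tendsto TY True)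
      then show ?thesis by (rule Lim_transform_eventually[OF _ ev])
    next
      case False
      then have t0: "t0 = 0" using a by (auto simp: a_eq)
      \<comment> \<open>A sequence approaching the boundary may mix time 0 with positive times;
        \<open>h\<close> treats both at once.\<close>
      define h where "h = (\<lambda>n. if T n = 0 then g (Y n) else V 0 (T n) (Y n))"
      have "h \<longlonglongrightarrow> g x0"
      proof (rule LIMSEQ_I)
        fix e :: real assume e: "0 < e"
        obtain d where d: "0 < d" "\<And>t x. 0 < t \<Longrightarrow> t < d \<Longrightarrow> \<bar>x - x0\<bar> < d \<Longrightarrow> \<bar>V 0 t x - g x0\<bar> < e"
          using V_initial[OF e, of x0] by blast
        have "isCont g x0" using g_cont by (simp add: continuous_on_eq_continuous_at)
        then obtain d' where d': "0 < d'" "\<And>x. \<bar>x - x0\<bar> < d' \<Longrightarrow> \<bar>g x - g x0\<bar> < e"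
          using e unfolding continuous_at_eps_delta dist_real_def by blast
        have "\<forall>\<^sub>F n in sequentially. dist (T n) t0 < d \<and> dist (Y n) x0 < min d d'"
          by (intro eventually_conj tendstoD TY) (use d d' in auto)
        then obtain N where N: "\<And>n. n \<ge> N \<Longrightarrow> dist (T n) t0 < d \<and> dist (Y n) x0 < min d d'"
          by (auto simp: eventually_sequentially)
        show "\<exists>N. \<forall>n\<ge>N. norm (h n - g x0) < e"
        proof (intro exI allI impI)
          fix n assume "N \<le> n"
          then show "norm (h n - g x0) < e"
            using N[of n] T0[of n] d(2)[of "T n" "Y n"] d'(2)[of "Y n"] by (auto simp: h_def dist_real_def t0)
        qed
      qed
      then have "(\<lambda>n. h n * exp (\<sigma> * T n)) \<longlonglongrightarrow> g x0 * exp (\<sigma> * t0)" by (intro tendsto_intros TY)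
      moreover have "h n * exp (\<sigma> * T n) = u (T n) (Y n)" for n
        using T0[of n] u[of "T n" "Y n"] u0 by (auto simp: h_def)
      ultimately show ?thesis by (simp add: t0 u0)
    qed
    then show "((\<lambda>(t, x). u t x) \<circ> X) \<longlonglongrightarrow> (case a of (t, x) \<Rightarrow> u t x)"
      by (simp add: comp_def case_prod_beta' T_def Y_def a_eq)
  qed
  show ?thesis
    unfolding classical_solution_def
  proof (rule conjI[OF u_cont], rule conjI, rule allI, rule u0, rule exI[of _ "\<lambda>t x. V 1 t x * exp (\<sigma> * t)"],
      rule exI[of _ "\<lambda>t x. V 2 t x * exp (\<sigma> * t)"], intro conjI V_cont allI impI)
    fix t x :: real assume t: "0 < t"
    have eq: "(\<lambda>y. u t y) = (\<lambda>y. V 0 t y * exp (\<sigma> * t))" using u[OF t] by auto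
    show "((\<lambda>y. u t y) has_real_derivative V 1 t x * exp (\<sigma> * t)) (at x)"
      unfolding eq by (rule DERIV_cmult_right[OF V_derivatives(1)[OF t]])
    show "((\<lambda>y. V 1 t y * exp (\<sigma> * t)) has_real_derivative V 2 t x * exp (\<sigma> * t)) (at x)"
      by (rule DERIV_cmult_right[OF V_derivatives(2)[OF t]])
    have "((\<lambda>r. exp (\<sigma> * r)) has_real_derivative exp (\<sigma> * t) * \<sigma>) (at t)"
      by (auto intro!: derivative_eq_intros)
    from DERIV_mult[OF V_derivatives(3)[OF t] this]
    have "((\<lambda>r. V 0 r x * exp (\<sigma> * r)) has_real_derivative (1 / 2 * (V 2 t x * exp (\<sigma> * t)) + \<sigma> * u t x)) (at t)"
      by (simp add: u[OF t] mult_ac)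
    then show "((\<lambda>r. u r x) has_real_derivative (1 / 2 * (V 2 t x * exp (\<sigma> * t)) + \<sigma> * u t x)) (at t)"
    proof (rule has_field_derivative_transform_within_open[where S="{0<..}"])
      show "V 0 r x * exp (\<sigma> * r) = u r x" if "r \<in> {0<..}" for r using that u[of r x] by simp
    qed (use t in auto)
  qed
qed

end

section \<open>The homogenization theorem\<close>

lemma field_events_subset_sets:
  assumes "\<And>t x. 0 \<le> t \<Longrightarrow> c t x \<in> borel_measurable M" "A \<subseteq> {0..} \<times> UNIV"
  shows "field_events M c A \<subseteq> sets M"
  unfolding field_events_def using assms by (intro sets.sigma_sets_subset) (auto intro!: measurable_sets[OF assms(1)])

text \<open>The definition of \<open>alpha_um\<close> multiplied by \<open>measure M T\<close>; null
  events \<open>T\<close> are excluded there and trivial here. The supremum can be used because all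
  its members are at most 1.\<close>

lemma alpha_um_mixing:
  assumes M: "prob_space M" and c: "\<And>t x. 0 \<le> t \<Longrightarrow> c t x \<in> borel_measurable M"
    and A: "A1 \<subseteq> {0..} \<times> UNIV" "A2 \<subseteq> {0..} \<times> UNIV" "r \<le> setdist A1 A2"
    and S: "S \<in> field_events M c A1" and T: "T \<in> field_events M c A2"
  shows "\<bar>measure M (S \<inter> T) - measure M S * measure M T\<bar> \<le> alpha_um M c r * measure M T"
proof -
  interpret prob_space M by fact
  have sets: "S \<in> sets M" "T \<in> sets M"
    using subsetD[OF field_events_subset_sets[OF c A(1)] S] subsetD[OF field_events_subset_sets[OF c A(2)] T] by auto
  show ?thesis
  proof (cases "measure M T = 0")
    case True
    have "measure M (S \<inter> T) \<le> measure M T" using sets by (intro finite_measure_mono) auto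
    then have "measure M (S \<inter> T) = 0" using True measure_nonneg[of M "S \<inter> T"] by linarith
    then show ?thesis using True by simp
  next
    case False
    define Q where "Q = {\<bar>\<P>(s in M. s \<in> S1 \<bar> s \<in> S2) - measure M S1\<bar> |S1 S2 A1 A2.
        A1 \<subseteq> {0..} \<times> UNIV \<and> A2 \<subseteq> {0..} \<times> UNIV \<and> setdist A1 A2 \<ge> r \<and>
        S1 \<in> field_events M c A1 \<and> S2 \<in> field_events M c A2 \<and> measure M S2 \<noteq> 0}"
    have "bdd_above Q"
    proof (rule bdd_aboveI[where M=1])
      fix q assume "q \<in> Q"
      then obtain S1 S2 A1 A2 where q: "q = \<bar>\<P>(s in M. s \<in> S1 \<bar> s \<in> S2) - measure M S1\<bar>"
        and h: "A1 \<subseteq> {0..} \<times> UNIV" "A2 \<subseteq> {0..} \<times> UNIV" "S1 \<in> field_events M c A1" "S2 \<in> field_events M c A2"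
        unfolding Q_def by blast
      have s: "S1 \<in> sets M" "S2 \<in> sets M"
        using subsetD[OF field_events_subset_sets[OF c h(1)] h(3)] subsetD[OF field_events_subset_sets[OF c h(2)] h(4)] by auto
      have "measure M {s \<in> space M. s \<in> S1 \<and> s \<in> S2} \<le> measure M {s \<in> space M. s \<in> S2}"
        using s by (intro finite_measure_mono) auto
      then have "0 \<le> \<P>(s in M. s \<in> S1 \<bar> s \<in> S2)" "\<P>(s in M. s \<in> S1 \<bar> s \<in> S2) \<le> 1"
        by (auto simp: cond_prob_def divide_le_eq_1 zero_less_measure_iff measure_nonneg less_le)
      then show "q \<le> 1" unfolding q using prob_le_1[of S1] measure_nonneg[of M S1] by linarith
    qed
    moreover have "\<bar>\<P>(s in M. s \<in> S \<bar> s \<in> T) - measure M S\<bar> \<in> Q"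
      unfolding Q_def using A S T False by blast
    ultimately have "\<bar>\<P>(s in M. s \<in> S \<bar> s \<in> T) - measure M S\<bar> \<le> alpha_um M c r"
      unfolding alpha_um_def Q_def by (intro cSup_upper)
    moreover have "{s \<in> space M. s \<in> S \<and> s \<in> T} = S \<inter> T" "{s \<in> space M. s \<in> T} = T"
      using sets.sets_into_space[OF sets(1)] sets.sets_into_space[OF sets(2)] by auto
    then have "\<P>(s in M. s \<in> S \<bar> s \<in> T) = measure M (S \<inter> T) / measure M T"
      by (simp add: cond_prob_def)
    ultimately have "\<bar>measure M (S \<inter> T) / measure M T - measure M S\<bar> * measure M T \<le> alpha_um M c r * measure M T"
      by (intro mult_right_mono) auto
    moreover have "measure M (S \<inter> T) - measure M S * measure M T = (measure M (S \<inter> T) / measure M T - measure M S) * measure M T"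
      using False by (simp add: left_diff_distrib)
    ultimately show ?thesis by (simp add: abs_mult)
  qed
qed

text \<open>The two points may coincide, so that \<open>J\<close> is a singleton; reading
  \<open>f\<close> through the coordinates of a function on \<open>J\<close> covers both
  cases.\<close>

lemma stationary_two_points:
  fixes f :: "real \<times> real \<Rightarrow> real"
  assumes c: "\<And>t x. 0 \<le> t \<Longrightarrow> c t x \<in> borel_measurable M" and st: "stationary_field M c"
    and f: "f \<in> borel_measurable (borel \<Otimes>\<^sub>M borel)" and h: "0 \<le> h" "0 \<le> t1" "0 \<le> t2"
  shows "(LINT s|M. f (c (t1 + h) (x1 + k) s, c (t2 + h) (x2 + k) s)) = (LINT s|M. f (c t1 x1 s, c t2 x2 s))"
proof -
  define J where "J = {(t1, x1), (t2, x2)}"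
  define F where "F = (\<lambda>v :: real \<times> real \<Rightarrow> real. f (v (t1, x1), v (t2, x2)))"
  have J: "finite J" "J \<subseteq> {0..} \<times> UNIV" using h by (auto simp: J_def)
  have F: "F \<in> borel_measurable (\<Pi>\<^sub>M p\<in>J. borel)"
    unfolding F_def
    by (rule measurable_compose[OF _ f], intro measurable_Pair measurable_component_singleton) (auto simp: J_def)
  have eq: "(LINT s|M. f (c (t1 + h) (x1 + k) s, c (t2 + h) (x2 + k) s))
      = integral\<^sup>L (distr M (\<Pi>\<^sub>M p\<in>J. borel) (\<lambda>s. \<lambda>p\<in>J. c (fst p + h) (snd p + k) s)) F" if "0 \<le> h" for h k
  proof (subst integral_distr[OF _ F])
    show "(\<lambda>s. \<lambda>p\<in>J. c (fst p + h) (snd p + k) s) \<in> M \<rightarrow>\<^sub>M (\<Pi>\<^sub>M p\<in>J. borel)"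
      by (rule measurable_restrict, rule c) (use J that in auto)
  qed (simp add: F_def J_def)
  have "distr M (\<Pi>\<^sub>M p\<in>J. borel) (\<lambda>s. \<lambda>p\<in>J. c (fst p + h) (snd p + k) s) = distr M (\<Pi>\<^sub>M p\<in>J. borel) (\<lambda>s. \<lambda>p\<in>J. c (fst p) (snd p) s)"
    using st J h unfolding stationary_field_def by blast
  then show ?thesis using eq[OF h(1), of k] eq[of 0 0] by simp
qed

theorem proposition5p9:
  fixes M :: "'s measure" and W :: "'w measure"
    and B :: "real \<Rightarrow> 'w \<Rightarrow> real" and c :: "real \<Rightarrow> real \<Rightarrow> 's \<Rightarrow> real"
    and g :: "real \<Rightarrow> real" and \<beta> \<Sigma>' :: real and u :: "real \<Rightarrow> real \<Rightarrow> real"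
  defines "\<Sigma>' \<equiv> (LINT r:{0..}|lborel. covariance M c r 0)"
    and "u \<equiv> (\<lambda>t x. (LINT \<omega>|W. g (x + B t \<omega>)) * exp (t * \<Sigma>'))"
  assumes "prob_space M" and "prob_space W"
    and "standard_brownian_motion W B"
    and "measurable_field M c"
    and "stationary_field M c"
    and "\<And>t x. t \<ge> 0 \<Longrightarrow> (LINT s|M. c t x s) = 0"
    and "\<exists>K. \<forall>t\<ge>0. \<forall>x. \<forall>s\<in>space M. \<bar>c t x s\<bar> \<le> K"
    and "integrable lborel (\<lambda>(t, x). covariance M c t x)"
    and "\<exists>C>0. \<exists>\<delta>>0. \<forall>r\<ge>0. alpha_um M c r \<le> C * (1 + r) powr (- (2 + \<delta>))"
    and "continuous_on UNIV g" and "square_integrable lborel g"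
    and "0 < \<beta>" and "\<beta> < 1 / 2"
  shows "set_integrable lborel {0..} (\<lambda>r. covariance M c r 0) \<and>
    (\<forall>t\<ge>0. \<forall>x.
      tendsto_L2 M (\<lambda>\<epsilon>. feynman_kac W B c g \<beta> \<epsilon> t x) (\<lambda>_. u t x) (at_right 0)) \<and>
    classical_solution \<Sigma>' g u"
proof -
  interpret W: prob_space W by fact
  note M = assms(3) and brown = assms(5)
  \<comment> \<open>Freezing the field and the motion at negative times yields measurable objects on
    the whole line without changing any value at nonnegative times.\<close>
  define c' where "c' = (\<lambda>t. c (max 0 t))"
  define B' where "B' = (\<lambda>t. B (max 0 t))"
  have c'_eq: "c' t = c t" if "0 \<le> t" for t using that by (simp add: c'_def max_def)
  have B'_eq: "B' t = B t" if "0 \<le> t" for t using that by (simp add: B'_def max_def)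
  obtain K where K: "\<And>t x s. 0 \<le> t \<Longrightarrow> s \<in> space M \<Longrightarrow> \<bar>c t x s\<bar> \<le> K" using assms(9) by blast
  obtain C \<delta> where C: "0 < C" "0 < \<delta>" "\<And>r. 0 \<le> r \<Longrightarrow> alpha_um M c r \<le> C * (1 + r) powr (- (2 + \<delta>))"
    using assms(11) by blast
  have c'_meas: "(\<lambda>(t, x, s). c' t x s) \<in> borel_measurable (borel \<Otimes>\<^sub>M borel \<Otimes>\<^sub>M M)"
  proof -
    have "(\<lambda>p. max 0 (fst p)) \<in> borel \<Otimes>\<^sub>M borel \<Otimes>\<^sub>M M \<rightarrow>\<^sub>M restrict_space borel {0::real..}"
      by (rule measurable_restrict_space2) auto
    then have "(\<lambda>p. (max 0 (fst p), snd p)) \<in> borel \<Otimes>\<^sub>M borel \<Otimes>\<^sub>M M \<rightarrow>\<^sub>M restrict_space borel {0::real..} \<Otimes>\<^sub>M borel \<Otimes>\<^sub>M M"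
      by (intro measurable_Pair measurable_snd)
    from measurable_compose[OF this assms(6)[unfolded measurable_field_def]] show ?thesis
      by (simp add: c'_def case_prod_beta')
  qed
  have c_meas: "c t x \<in> borel_measurable M" if "0 \<le> t" for t x
  proof -
    have "(\<lambda>s. (t, x, s)) \<in> M \<rightarrow>\<^sub>M borel \<Otimes>\<^sub>M borel \<Otimes>\<^sub>M M" by measurable
    from measurable_compose[OF this c'_meas] show ?thesis using c'_eq[OF that] by simp
  qed
  have field: "mixing_field M c' K C (\<delta> / 2)"
  proof (intro mixing_field.intro mixing_field_axioms.intro M c'_meas)
    show "\<bar>c' t x s\<bar> \<le> K" if "s \<in> space M" for s t x using K[of "max 0 t" s x] that by (simp add: c'_def)
    show "(LINT s|M. c' t x s) = 0" if "0 \<le> t" for t x using assms(8)[OF that] by (simp add: c'_eq[OF that])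
    show "(LINT s|M. f (c' (t1 + h) (x1 + k) s, c' (t2 + h) (x2 + k) s)) = (LINT s|M. f (c' t1 x1 s, c' t2 x2 s))"
      if "f \<in> borel_measurable (borel \<Otimes>\<^sub>M borel)" "0 \<le> h" "0 \<le> t1" "0 \<le> t2" for h t1 t2 x1 k x2 and f :: "real \<times> real \<Rightarrow> real"
      using stationary_two_points[OF c_meas assms(7) that] that by (simp add: c'_eq)
    show "\<bar>measure M (S \<inter> T) - measure M S * measure M T\<bar> \<le> C * (decay (\<delta> / 2) r)\<^sup>2 * measure M T"
      if A: "A1 \<subseteq> {0..} \<times> UNIV" "A2 \<subseteq> {0..} \<times> UNIV" and r: "0 \<le> r" "r \<le> setdist A1 A2"
        and ST: "S \<in> field_events M c' A1" "T \<in> field_events M c' A2" for A1 A2 r S T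
    proof -
      have fe: "field_events M c' A' = field_events M c A'" if "A' \<subseteq> {0..} \<times> UNIV" for A'
      proof -
        have "(\<Union>(t, x)\<in>A'. {c' t x -` U \<inter> space M |U. U \<in> sets borel}) = (\<Union>(t, x)\<in>A'. {c t x -` U \<inter> space M |U. U \<in> sets borel})"
        proof (rule SUP_cong[OF refl])
          fix p assume "p \<in> A'"
          then have "0 \<le> fst p" using that by auto
          then show "(case p of (t, x) \<Rightarrow> {c' t x -` U \<inter> space M |U. U \<in> sets borel}) = (case p of (t, x) \<Rightarrow> {c t x -` U \<inter> space M |U. U \<in> sets borel})"
            by (simp add: case_prod_beta' c'_eq)
        qed
        then show ?thesis by (simp add: field_events_def)
      qed
      have "\<bar>measure M (S \<inter> T) - measure M S * measure M T\<bar> \<le> alpha_um M c r * measure M T"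
        using ST unfolding fe[OF A(1)] fe[OF A(2)] by (intro alpha_um_mixing[OF M c_meas A r(2)])
      also have "\<dots> \<le> (C * (1 + r) powr (- (2 + \<delta>))) * measure M T"
        by (intro mult_right_mono C r) simp
      \<comment> \<open>This is where the parameter \<open>\<delta> / 2\<close> comes from: twice
        \<open>1 + \<delta> / 2\<close> is \<open>2 + \<delta>\<close>.\<close>
      also have "(1 + r) powr (- (2 + \<delta>)) = (decay (\<delta> / 2) r)\<^sup>2"
        by (simp add: decay_def power2_eq_square flip: powr_add)
      finally show ?thesis .
    qed
  qed (use C in auto)
  interpret F: mixing_field M c' K C "\<delta> / 2" by (rule field)
  have cov: "covariance M c t x = F.\<Phi> t x" if "0 \<le> t" for t x
    using that c'_eq[OF that] c'_eq[of 0] by (simp add: covariance_def F.\<Phi>_def max_def)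
  have S_eq: "\<Sigma>' = F.\<sigma>"
    unfolding assms(1) F.\<sigma>_def by (rule set_lebesgue_integral_cong) (auto simp: cov)
  have goal1: "set_integrable lborel {0..} (\<lambda>r. covariance M c r 0)"
  proof -
    have "set_integrable lborel {0..} (\<lambda>r. F.\<Phi> r 0)"
      unfolding set_integrable_def
    proof (rule Bochner_Integration.integrable_bound[OF F.decay_integrable[THEN set_integrable_mult_right, of "2 * K\<^sup>2 * C", unfolded set_integrable_def]])
      show "AE r in lborel. norm (indicator {0..} r *\<^sub>R F.\<Phi> r 0) \<le> norm (indicator {0..} r *\<^sub>R (2 * K\<^sup>2 * C * decay (\<delta> / 2) r))"
        using order_trans[OF F.Phi_decay abs_ge_self] by (intro AE_I2) (auto simp: indicator_def)
    qed measurable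
    then show ?thesis by (rule set_integrable_cong[THEN iffD1, rotated -1]) (auto simp: cov)
  qed
  have g_meas[measurable]: "g \<in> borel_measurable borel" and g2: "integrable lborel (\<lambda>y. (g y)\<^sup>2)"
    using assms(13) by (auto simp: square_integrable_def)
  have motion: "field_and_motion M c' K C (\<delta> / 2) W B' g \<beta>"
  proof (intro field_and_motion.intro field_and_motion_axioms.intro field assms(4) g_meas)
    show "(\<lambda>(r, \<omega>). B' r \<omega>) \<in> borel_measurable (borel \<Otimes>\<^sub>M W)"
      unfolding B'_def by (rule brownian_joint_measurable[OF brown])
    show "B' 0 \<omega> = 0" if "\<omega> \<in> space W" for \<omega>
      using brown that by (simp add: standard_brownian_motion_def B'_def)
    show "distributed W lborel (\<lambda>\<omega>. B' t \<omega> - B' s \<omega>) (normal_density 0 (sqrt (t - s)))" if "0 \<le> s" "s < t" for s t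
      using brown that by (simp add: standard_brownian_motion_def B'_eq)
  qed (use assms(14,15) in auto)
  interpret N: field_and_motion M c' K C "\<delta> / 2" W B' g \<beta> x for x by (rule motion)
  interpret H: heat_initial g by unfold_locales (use assms(12) g2 in auto)
  have B0: "B 0 \<omega> = 0" if "\<omega> \<in> space W" for \<omega> using N.B_0[OF that] by (simp add: B'_eq)
  \<comment> \<open>For \<open>t > 0\<close> the Gaussian density is bounded, so the L2 norm of
    \<open>g\<close> on the line controls the second moment; at \<open>t = 0\<close> there is no
    density, but the motion starts at 0.\<close>
  have g2W: "integrable W (\<lambda>\<omega>. (g (x + B' t \<omega>))\<^sup>2)" if t: "0 \<le> t" for t x
  proof (cases "t = 0")
    case True
    have "integrable W (\<lambda>\<omega>. (g (x + B' t \<omega>))\<^sup>2) \<longleftrightarrow> integrable W (\<lambda>\<omega>. (g x)\<^sup>2)"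
      by (rule Bochner_Integration.integrable_cong) (auto simp: True N.B_0)
    then show ?thesis by simp
  next
    case False
    then have t: "0 < t" using t by simp
    have D: "distributed W lborel (\<lambda>\<omega>. B' t \<omega> - B' 0 \<omega>) (normal_density 0 (sqrt (t - 0)))"
      by (rule N.B_incr) (use t in auto)
    have i: "integrable lborel (\<lambda>v. 1 / sqrt (2 * pi * t) * (g (x + 1 * v))\<^sup>2)"
      by (intro integrable_mult_right lborel_integrable_real_affine[OF g2]) simp
    have "integrable lborel (\<lambda>v. normal_density 0 (sqrt (t - 0)) v * (g (x + v))\<^sup>2)"
    proof (rule Bochner_Integration.integrable_bound[OF i])
      have "normal_density 0 (sqrt (t - 0)) v \<le> 1 / sqrt (2 * pi * t)" for v
        using t by (simp add: normal_density_def divide_right_mono)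
      then show "AE v in lborel. norm (normal_density 0 (sqrt (t - 0)) v * (g (x + v))\<^sup>2) \<le> norm (1 / sqrt (2 * pi * t) * (g (x + 1 * v))\<^sup>2)"
        using t mult_right_mono[of _ "1 / sqrt (2 * pi * t)" "(g (x + _))\<^sup>2"] by (intro AE_I2) (simp add: abs_mult)
    qed measurable
    then have "integrable W (\<lambda>\<omega>. (g (x + (B' t \<omega> - B' 0 \<omega>)))\<^sup>2)"
      by (subst (asm) distributed_integrable[OF D]) auto
    moreover have "integrable W (\<lambda>\<omega>. (g (x + (B' t \<omega> - B' 0 \<omega>)))\<^sup>2) \<longleftrightarrow> integrable W (\<lambda>\<omega>. (g (x + B' t \<omega>))\<^sup>2)"
      by (rule Bochner_Integration.integrable_cong) (auto simp: N.B_0)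
    ultimately show ?thesis by simp
  qed
  have fk: "feynman_kac W B c g \<beta> \<epsilon> t x = feynman_kac W B' c' g \<beta> \<epsilon> t x" if "0 < \<epsilon>" "0 \<le> t" for \<epsilon> t x
  proof
    fix s
    have "(LINT r:{0..t}|lborel. c (r / \<epsilon>) ((x + B r \<omega>) / \<epsilon> powr \<beta>) s) = (LINT r:{0..t}|lborel. c' (r / \<epsilon>) ((x + B' r \<omega>) / \<epsilon> powr \<beta>) s)" for \<omega>
      by (rule set_lebesgue_integral_cong) (use that in \<open>auto simp: c'_eq B'_eq\<close>)
    then show "feynman_kac W B c g \<beta> \<epsilon> t x s = feynman_kac W B' c' g \<beta> \<epsilon> t x s"
      by (simp add: feynman_kac_def B'_eq[OF that(2)])
  qed
  have goal2: "tendsto_L2 M (\<lambda>\<epsilon>. feynman_kac W B c g \<beta> \<epsilon> t x) (\<lambda>_. u t x) (at_right 0)" if t: "0 \<le> t" for t x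
    unfolding tendsto_L2_def
  proof (intro conjI)
    show "\<forall>\<^sub>F \<epsilon> in at_right 0. square_integrable M (feynman_kac W B c g \<beta> \<epsilon> t x)"
      using eventually_at_right_less[of "0::real"]
      by eventually_elim (simp add: fk t N.feynman_kac_square_integrable g2W)
    show "square_integrable M (\<lambda>_. u t x)" by (simp add: square_integrable_def)
    have u_eq: "u t x = (LINT \<omega>|W. g (x + B' t \<omega>)) * exp (t * F.\<sigma>)" by (simp add: assms(2) S_eq B'_eq[OF t])
    show "((\<lambda>\<epsilon>. LINT a|M. (feynman_kac W B c g \<beta> \<epsilon> t x a - u t x)\<^sup>2) \<longlongrightarrow> 0) (at_right 0)"
    \<comment> \<open>Sequences in the interval from 0 to 1 suffice, which matches the restriction
      \<open>\<epsilon> n \<le> 1\<close> in \<open>L2_convergence\<close>.\<close>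
    proof (rule tendsto_at_right_sequentially[of 0 1])
      fix S :: "nat \<Rightarrow> real" assume S: "\<And>n. 0 < S n" "\<And>n. S n < 1" "decseq S" "S \<longlonglongrightarrow> 0"
      have "(\<lambda>n. LINT s|M. (feynman_kac W B' c' g \<beta> (S n) t x s - u t x)\<^sup>2) \<longlonglongrightarrow> 0"
        unfolding u_eq by (rule N.L2_convergence[OF S(1) less_imp_le[OF S(2)] S(4) t g2W[OF t]])
      then show "(\<lambda>n. LINT a|M. (feynman_kac W B c g \<beta> (S n) t x a - u t x)\<^sup>2) \<longlonglongrightarrow> 0"
        by (simp add: fk[OF S(1) t])
    qed simp
  qed
  have goal3: "classical_solution \<Sigma>' g u"
  proof (rule H.classical_solution_heat)
    fix t x :: real assume t: "0 < t"
    have "(LINT \<omega>|W. g (x + B t \<omega>)) = (LINT \<omega>|W. g (x + (B' t \<omega> - B' 0 \<omega>)))"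
      by (rule Bochner_Integration.integral_cong) (use t in \<open>auto simp: B0 B'_eq\<close>)
    also have "\<dots> = (LINT v|lborel. normal_density 0 (sqrt (t - 0)) v * g (x + v))"
      by (rule N.expectation_normal[where f="\<lambda>v. g (x + v)"]) (use t in auto)
    \<comment> \<open>A shift of the variable by \<open>x\<close>; \<open>heat_kernel 0 t\<close> is
      the density with variance \<open>t\<close>.\<close>
    also have "\<dots> = H.V 0 t x"
      unfolding H.V_def using t
      by (subst (2) lborel_integral_real_affine[where c=1 and t=x]) (auto simp: heat_kernel_density mult.commute)
    finally show "u t x = H.V 0 t x * exp (\<Sigma>' * t)" by (simp add: assms(2) mult.commute)
  next
    fix x
    have "(LINT \<omega>|W. g (x + B 0 \<omega>)) = (LINT \<omega>|W. g x)"
      by (rule Bochner_Integration.integral_cong) (auto simp: B0)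
    then show "u 0 x = g x" by (simp add: assms(2) W.prob_space)
  qed
  show ?thesis using goal1 goal2 goal3 by blast
qed

end
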